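(* Let $\mathcal K$ be the kernel of the Atiyah sequence of modules and Lie algebras $0\to\mathcal K\to\mathcal A\to\mathfrak X(M)\to0$ associated to a principal bundle with semisimple structure group $G$ over a manifold $M$, and let $\mathfrak g=\operatorname{Lie}(G)$. The maximal finite-codimensional Lie ideals of $\mathcal K$ are exactly the subspaces of the form $\mathcal K(m,\mathfrak g_0)=\{k\in\mathcal K:k_m\in\mathfrak g_0\}$, where $m\in M$ and $\mathfrak g_0$ is a maximal Lie ideal of $\mathfrak g$.
   Context: All manifolds are smooth, second countable, paracompact, Hausdorff, of finite nonzero dimension. For a (right) principal $G$-bundle $\pi:P\to M$, the Atiyah algebroid is the vector bundle $A=TP/G$ over $M$ (fiber $A_m$: classes of tangent vectors $X_u\in T_uP$, $\pi(u)=m$, under $X_u\sim(T_ur_g)X_u$), with anchor $\pi_*:A\to TM$, $[X_u]\mapsto T_u\pi X_u$. Its sections $\mathcal A=\Gamma(A)$ are the $G$-invariant vector fields on $P$ with the bracket of vector fields. $K=\ker\pi_*\cong P\times_G\mathfrak g$ (adjoint action) and $\mathcal K=\Gamma(K)$, a Lie ideal of $\mathcal A$ on which the bracket is $C^\infty(M)$-bilinear; so each fiber $K_m$ is a Lie algebra, isomorphic to $\mathfrak g$. For each $m$ one fixes such an identification $K_m\cong\mathfrak g$ (coming from a point $u\in\pi^{-1}(m)$ via $h\mapsto[u,h]\in P\times_G\mathfrak g$; it is a linear isomorphism respecting brackets up to a sign convention), so that ideals $\mathfrak g_0$ of $\mathfrak g$ are viewed as ideals of $K_m$. A Lie group is semisimple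 if its Lie algebra is. "Maximal finite-codimensional Lie ideal" means a proper finite-codimensional Lie ideal not strictly contained in any other proper finite-codimensional Lie ideal; a maximal ideal of $\mathfrak g$ is a proper ideal not strictly contained in any other proper ideal. *)

theory Defs
  imports "HOL-Analysis.Analysis" "HOL-Algebra.Group" "HOL-Library.Function_Algebras"
begin

instantiation "fun" :: (type, real_vector) real_vector
begin

definition scaleR_fun :: "real \<Rightarrow> ('a \<Rightarrow> 'b) \<Rightarrow> 'a \<Rightarrow> 'b"
  where "scaleR_fun c f = (\<lambda>x. c *\<^sub>R f x)"

instance
  by standard (auto simp: scaleR_fun_def plus_fun_def scaleR_add_left scaleR_add_right)

end

text \<open>A Lie algebra is given by a subspace \<open>L\<close> of a real vector space and a bracket \<open>br\<close>, of
  which only the values on \<open>L\<close> matter. The bracket is skew-symmetric in all uses below, so that left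
  ideals are ideals.\<close>

definition lie_ideal :: "'v::real_vector set \<Rightarrow> ('v \<Rightarrow> 'v \<Rightarrow> 'v) \<Rightarrow> 'v set \<Rightarrow> bool"
  where "lie_ideal L br I \<longleftrightarrow>
    subspace I \<and> I \<subseteq> L \<and> (\<forall>x\<in>L. \<forall>y\<in>I. br x y \<in> I)"

definition maximal_lie_ideal :: "'v::real_vector set \<Rightarrow> ('v \<Rightarrow> 'v \<Rightarrow> 'v) \<Rightarrow> 'v set \<Rightarrow> bool"
  where "maximal_lie_ideal L br I \<longleftrightarrow>
    lie_ideal L br I \<and> I \<noteq> L \<and>
    \<not> (\<exists>J. lie_ideal L br J \<and> J \<noteq> L \<and> I \<subset> J)"

text \<open>\<open>L / I\<close> is finite-dimensional: the classes of some finite \<open>B \<subseteq> L\<close> span it.\<close>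

definition finite_codim :: "'v::real_vector set \<Rightarrow> 'v set \<Rightarrow> bool"
  where "finite_codim L I \<longleftrightarrow> (\<exists>B. finite B \<and> B \<subseteq> L \<and> L \<subseteq> span (I \<union> B))"

definition maximal_finite_codim_lie_ideal ::
    "'v::real_vector set \<Rightarrow> ('v \<Rightarrow> 'v \<Rightarrow> 'v) \<Rightarrow> 'v set \<Rightarrow> bool"
  where "maximal_finite_codim_lie_ideal L br I \<longleftrightarrow>
    lie_ideal L br I \<and> finite_codim L I \<and> I \<noteq> L \<and>
    \<not> (\<exists>J. lie_ideal L br J \<and> finite_codim L J \<and> J \<noteq> L \<and> I \<subset> J)"

definition simple_lie_algebra :: "'v::real_vector set \<Rightarrow> ('v \<Rightarrow> 'v \<Rightarrow> 'v) \<Rightarrow> bool"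
  where "simple_lie_algebra L br \<longleftrightarrow>
    (\<exists>x\<in>L. \<exists>y\<in>L. br x y \<noteq> 0) \<and>
    (\<forall>I. lie_ideal L br I \<longrightarrow> I = {0} \<or> I = L)"

text \<open>The last conjunct makes the sum of the simple ideals in \<open>S\<close> direct.\<close>

definition semisimple_lie_algebra :: "'v::real_vector set \<Rightarrow> ('v \<Rightarrow> 'v \<Rightarrow> 'v) \<Rightarrow> bool"
  where "semisimple_lie_algebra L br \<longleftrightarrow>
    (\<exists>S. finite S \<and>
      (\<forall>I\<in>S. lie_ideal L br I \<and> simple_lie_algebra I br) \<and>
      L = span (\<Union>S) \<and>
      (\<forall>I\<in>S. I \<inter> span (\<Union>(S - {I})) = {0}))"

text \<open>On an open set, \<open>C_k_on k\<close> is \<open>C\<^sup>k\<close>: a map is \<open>C\<^sup>k\<^sup>+\<^sup>1\<close> iff it is differentiable and all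
  its directional derivatives are \<open>C\<^sup>k\<close>.\<close>

primrec C_k_on :: "nat \<Rightarrow> 'a::euclidean_space set \<Rightarrow> ('a \<Rightarrow> 'b::euclidean_space) \<Rightarrow> bool"
  where
    "C_k_on 0 S f \<longleftrightarrow> continuous_on S f"
  | "C_k_on (Suc k) S f \<longleftrightarrow>
      (\<forall>x\<in>S. f differentiable (at x)) \<and>
      (\<forall>v. C_k_on k S (\<lambda>x. frechet_derivative f (at x) v))"

definition smooth_on :: "'a::euclidean_space set \<Rightarrow> ('a \<Rightarrow> 'b::euclidean_space) \<Rightarrow> bool"
  where "smooth_on S f \<longleftrightarrow> (\<forall>k. C_k_on k S f)"

text \<open>The points of a manifold form a Hausdorff, second countable topological type. A chart
  \<open>(U, \<phi>)\<close> is a homeomorphism of the open set \<open>U\<close> onto an open subset of a Euclidean space of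
  (nonzero) dimension \<open>DIM('e)\<close>; values of \<open>\<phi>\<close> outside \<open>U\<close> are irrelevant.
  Paracompactness follows, since these spaces are locally compact.\<close>

type_synonym ('m, 'e) atlas = "('m set \<times> ('m \<Rightarrow> 'e)) set"

definition smooth_manifold ::
    "('m::{t2_space,second_countable_topology}, 'e::euclidean_space) atlas \<Rightarrow> bool"
  where "smooth_manifold A \<longleftrightarrow>
    (\<Union>(U, \<phi>)\<in>A. U) = UNIV \<and>
    (\<forall>(U, \<phi>)\<in>A. open U \<and> open (\<phi> ` U) \<and> homeomorphism U (\<phi> ` U) \<phi> (inv_into U \<phi>)) \<and>
    (\<forall>(U, \<phi>)\<in>A. \<forall>(V, \<psi>)\<in>A. smooth_on (\<phi> ` (U \<inter> V)) (\<psi> \<circ> inv_into U \<phi>))"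

definition euclidean_atlas :: "('e::euclidean_space, 'e) atlas"
  where "euclidean_atlas = {(UNIV, id)}"

definition product_atlas :: "('m, 'd) atlas \<Rightarrow> ('n, 'e) atlas \<Rightarrow> ('m \<times> 'n, 'd \<times> 'e) atlas"
  where "product_atlas A B = {(U \<times> V, map_prod \<phi> \<psi>) | U \<phi> V \<psi>. (U, \<phi>) \<in> A \<and> (V, \<psi>) \<in> B}"

text \<open>To be used for open \<open>W\<close>.\<close>

definition smooth_map_on ::
    "('m::topological_space, 'd::euclidean_space) atlas \<Rightarrow> ('n::topological_space, 'e::euclidean_space) atlas
      \<Rightarrow> 'm set \<Rightarrow> ('m \<Rightarrow> 'n) \<Rightarrow> bool"
  where "smooth_map_on A B W F \<longleftrightarrow>
    continuous_on W F \<and>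
    (\<forall>(U, \<phi>)\<in>A. \<forall>(V, \<psi>)\<in>B.
      smooth_on (\<phi> ` (U \<inter> W \<inter> F -` V)) (\<psi> \<circ> F \<circ> inv_into U \<phi>))"

abbreviation smooth_map ::
    "('m::topological_space, 'd::euclidean_space) atlas \<Rightarrow> ('n::topological_space, 'e::euclidean_space) atlas
      \<Rightarrow> ('m \<Rightarrow> 'n) \<Rightarrow> bool"
  where "smooth_map A B F \<equiv> smooth_map_on A B UNIV F"

definition smooth_functions ::
    "('m::topological_space, 'd::euclidean_space) atlas \<Rightarrow> ('m \<Rightarrow> real) set"
  where "smooth_functions A = {f. smooth_map A euclidean_atlas f}"

text \<open>Tangent vectors at \<open>p\<close> are the derivations at \<open>p\<close> of the algebra of smooth functions,
  extended by \<open>0\<close> to all functions so that equality of functionals is equality of tangent vectors.\<close>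

definition tangent_space ::
    "('m::topological_space, 'd::euclidean_space) atlas \<Rightarrow> 'm \<Rightarrow> (('m \<Rightarrow> real) \<Rightarrow> real) set"
  where "tangent_space A p = {v.
    (\<forall>f. f \<notin> smooth_functions A \<longrightarrow> v f = 0) \<and>
    (\<forall>f\<in>smooth_functions A. \<forall>g\<in>smooth_functions A. v (\<lambda>x. f x + g x) = v f + v g) \<and>
    (\<forall>c. \<forall>f\<in>smooth_functions A. v (\<lambda>x. c * f x) = c * v f) \<and>
    (\<forall>f\<in>smooth_functions A. \<forall>g\<in>smooth_functions A.
      v (\<lambda>x. f x * g x) = v f * g p + f p * v g)}"

text \<open>The differential \<open>T\<^sub>pF\<close> of a smooth map \<open>F\<close> into a manifold with atlas \<open>B\<close>, on derivations
  at any point \<open>p\<close>.\<close>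

definition tangent_map ::
    "('n::topological_space, 'e::euclidean_space) atlas \<Rightarrow> ('m \<Rightarrow> 'n)
      \<Rightarrow> (('m \<Rightarrow> real) \<Rightarrow> real) \<Rightarrow> ('n \<Rightarrow> real) \<Rightarrow> real"
  where "tangent_map B F v = (\<lambda>f. if f \<in> smooth_functions B then v (f \<circ> F) else 0)"

type_synonym 'm vfield = "'m \<Rightarrow> ('m \<Rightarrow> real) \<Rightarrow> real"

definition smooth_vector_fields ::
    "('m::topological_space, 'd::euclidean_space) atlas \<Rightarrow> 'm vfield set"
  where "smooth_vector_fields A = {X.
    (\<forall>p. X p \<in> tangent_space A p) \<and>
    (\<forall>f\<in>smooth_functions A. (\<lambda>p. X p f) \<in> smooth_functions A)}"

definition vfield_bracket :: "'m vfield \<Rightarrow> 'm vfield \<Rightarrow> 'm vfield"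
  where "vfield_bracket X Y = (\<lambda>p f. X p (\<lambda>q. Y q f) - Y p (\<lambda>q. X q f))"

definition lie_group ::
    "'g::{t2_space,second_countable_topology} monoid \<Rightarrow> ('g, 'e::euclidean_space) atlas \<Rightarrow> bool"
  where "lie_group G AG \<longleftrightarrow>
    group G \<and> carrier G = UNIV \<and> smooth_manifold AG \<and>
    smooth_map (product_atlas AG AG) AG (\<lambda>(g, h). g \<otimes>\<^bsub>G\<^esub> h) \<and>
    smooth_map AG AG (\<lambda>g. inv\<^bsub>G\<^esub> g)"

definition lie_algebra_of ::
    "'g::topological_space monoid \<Rightarrow> ('g, 'e::euclidean_space) atlas \<Rightarrow> (('g \<Rightarrow> real) \<Rightarrow> real) set"
  where "lie_algebra_of G AG = tangent_space AG \<one>\<^bsub>G\<^esub>"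

definition left_invariant_field ::
    "'g::topological_space monoid \<Rightarrow> ('g, 'e::euclidean_space) atlas
      \<Rightarrow> (('g \<Rightarrow> real) \<Rightarrow> real) \<Rightarrow> 'g vfield"
  where "left_invariant_field G AG a = (\<lambda>g. tangent_map AG (\<lambda>h. g \<otimes>\<^bsub>G\<^esub> h) a)"

definition lie_algebra_bracket ::
    "'g::topological_space monoid \<Rightarrow> ('g, 'e::euclidean_space) atlas
      \<Rightarrow> (('g \<Rightarrow> real) \<Rightarrow> real) \<Rightarrow> (('g \<Rightarrow> real) \<Rightarrow> real) \<Rightarrow> ('g \<Rightarrow> real) \<Rightarrow> real"
  where "lie_algebra_bracket G AG a b =
    vfield_bracket (left_invariant_field G AG a) (left_invariant_field G AG b) \<one>\<^bsub>G\<^esub>"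

definition semisimple_lie_group ::
    "'g::{t2_space,second_countable_topology} monoid \<Rightarrow> ('g, 'e::euclidean_space) atlas \<Rightarrow> bool"
  where "semisimple_lie_group G AG \<longleftrightarrow>
    lie_group G AG \<and> semisimple_lie_algebra (lie_algebra_of G AG) (lie_algebra_bracket G AG)"

definition local_trivialization ::
    "'g::topological_space monoid \<Rightarrow> ('g, 'eg::euclidean_space) atlas
      \<Rightarrow> ('p::topological_space, 'ep::euclidean_space) atlas
      \<Rightarrow> ('m::topological_space, 'em::euclidean_space) atlas
      \<Rightarrow> ('p \<Rightarrow> 'g \<Rightarrow> 'p) \<Rightarrow> ('p \<Rightarrow> 'm) \<Rightarrow> 'm set \<Rightarrow> ('m \<times> 'g \<Rightarrow> 'p) \<Rightarrow> bool"
  where "local_trivialization G AG AP AM act pr U \<psi> \<longleftrightarrow>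
    bij_betw \<psi> (U \<times> UNIV) (pr -` U) \<and>
    smooth_map_on (product_atlas AM AG) AP (U \<times> UNIV) \<psi> \<and>
    smooth_map_on AP (product_atlas AM AG) (pr -` U) (inv_into (U \<times> UNIV) \<psi>) \<and>
    (\<forall>x\<in>U. \<forall>g. pr (\<psi> (x, g)) = x) \<and>
    (\<forall>x\<in>U. \<forall>g h. \<psi> (x, g \<otimes>\<^bsub>G\<^esub> h) = act (\<psi> (x, g)) h)"

text \<open>\<open>act u g\<close> is \<open>u\<cdot>g\<close>. That the action is free and transitive on the fibers, and that \<open>pr\<close> is a
  surjective submersion, follows from local triviality.\<close>

definition principal_bundle ::
    "'g::{t2_space,second_countable_topology} monoid \<Rightarrow> ('g, 'eg::euclidean_space) atlas
      \<Rightarrow> ('p::{t2_space,second_countable_topology}, 'ep::euclidean_space) atlas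
      \<Rightarrow> ('m::{t2_space,second_countable_topology}, 'em::euclidean_space) atlas
      \<Rightarrow> ('p \<Rightarrow> 'g \<Rightarrow> 'p) \<Rightarrow> ('p \<Rightarrow> 'm) \<Rightarrow> bool"
  where "principal_bundle G AG AP AM act pr \<longleftrightarrow>
    lie_group G AG \<and> smooth_manifold AP \<and> smooth_manifold AM \<and>
    smooth_map AP AM pr \<and>
    smooth_map (product_atlas AP AG) AP (\<lambda>(u, g). act u g) \<and>
    (\<forall>u. act u \<one>\<^bsub>G\<^esub> = u) \<and>
    (\<forall>u g h. act (act u g) h = act u (g \<otimes>\<^bsub>G\<^esub> h)) \<and>
    (\<forall>x. \<exists>U \<psi>. open U \<and> x \<in> U \<and> local_trivialization G AG AP AM act pr U \<psi>)"

text \<open>The class in \<open>TP/G\<close> of the tangent vector \<open>X\<close> at \<open>u\<close>. Tangent vectors carry their base point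
  here, since the zero derivations at different points are the same functional.\<close>

definition atiyah_class ::
    "('p::topological_space, 'ep::euclidean_space) atlas \<Rightarrow> ('p \<Rightarrow> 'g \<Rightarrow> 'p)
      \<Rightarrow> 'p \<times> (('p \<Rightarrow> real) \<Rightarrow> real) \<Rightarrow> ('p \<times> (('p \<Rightarrow> real) \<Rightarrow> real)) set"
  where "atiyah_class AP act = (\<lambda>(u, X). {(act u g, tangent_map AP (\<lambda>w. act w g) X) | g. True})"

text \<open>Sections of \<open>TP/G\<close>, as \<open>G\<close>-invariant vector fields on \<open>P\<close>; their bracket is
  \<^const>\<open>vfield_bracket\<close>.\<close>

definition atiyah_sections ::
    "('p::topological_space, 'ep::euclidean_space) atlas \<Rightarrow> ('p \<Rightarrow> 'g \<Rightarrow> 'p) \<Rightarrow> 'p vfield set"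
  where "atiyah_sections AP act =
    {X \<in> smooth_vector_fields AP. \<forall>u g. X (act u g) = tangent_map AP (\<lambda>w. act w g) (X u)}"

text \<open>The kernel of the anchor \<open>[X\<^sub>u] \<mapsto> T\<^sub>u\<pi> X\<^sub>u\<close> on sections.\<close>

definition atiyah_kernel ::
    "('p::topological_space, 'ep::euclidean_space) atlas
      \<Rightarrow> ('m::topological_space, 'em::euclidean_space) atlas
      \<Rightarrow> ('p \<Rightarrow> 'g \<Rightarrow> 'p) \<Rightarrow> ('p \<Rightarrow> 'm) \<Rightarrow> 'p vfield set"
  where "atiyah_kernel AP AM act pr =
    {X \<in> atiyah_sections AP act. \<forall>u. tangent_map AM pr (X u) = 0}"

text \<open>The value at \<open>m\<close> of the section of \<open>TP/G\<close> given by an invariant field \<open>k\<close>: the class of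
  \<open>k u\<close> for any \<open>u\<close> over \<open>m\<close>, which as a set consists of all values of \<open>k\<close> on the fiber.\<close>

definition section_value ::
    "('p \<Rightarrow> 'm) \<Rightarrow> 'p vfield \<Rightarrow> 'm \<Rightarrow> ('p \<times> (('p \<Rightarrow> real) \<Rightarrow> real)) set"
  where "section_value pr k m = {(u, k u) | u. pr u = m}"

text \<open>The identification \<open>\<gg> \<rightarrow> K\<^sub>m\<close> given by \<open>u\<close> over \<open>m\<close>. Under \<open>P \<times>\<^sub>G \<gg> \<cong> K\<close>, the element \<open>[u, h]\<close> is
  the class of the fundamental vector at \<open>u\<close> generated by \<open>h\<close>, the image of \<open>h\<close> under the
  differential at the unit of the orbit map \<open>g \<mapsto> u\<cdot>g\<close>.\<close>

definition fiber_identification ::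
    "('p::topological_space, 'ep::euclidean_space) atlas \<Rightarrow> ('p \<Rightarrow> 'g \<Rightarrow> 'p)
      \<Rightarrow> 'p \<Rightarrow> (('g \<Rightarrow> real) \<Rightarrow> real) \<Rightarrow> ('p \<times> (('p \<Rightarrow> real) \<Rightarrow> real)) set"
  where "fiber_identification AP act u h = atiyah_class AP act (u, tangent_map AP (\<lambda>g. act u g) h)"

text \<open>The point \<open>s m\<close> over \<open>m\<close> fixes the identification of \<open>K\<^sub>m\<close> with \<open>\<gg>\<close>; \<open>s\<close> need not be
  continuous.\<close>

definition kernel_ideal ::
    "('p::topological_space, 'ep::euclidean_space) atlas
      \<Rightarrow> ('m::topological_space, 'em::euclidean_space) atlas
      \<Rightarrow> ('p \<Rightarrow> 'g \<Rightarrow> 'p) \<Rightarrow> ('p \<Rightarrow> 'm) \<Rightarrow> ('m \<Rightarrow> 'p)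
      \<Rightarrow> 'm \<Rightarrow> (('g \<Rightarrow> real) \<Rightarrow> real) set \<Rightarrow> 'p vfield set"
  where "kernel_ideal AP AM act pr s m \<gg>\<^sub>0 =
    {k \<in> atiyah_kernel AP AM act pr.
      section_value pr k m \<in> fiber_identification AP act (s m) ` \<gg>\<^sub>0}"

end

theory Submission
  imports Defs "HOL-Computational_Algebra.Polynomial"
begin

text \<open>
  Fix for every \<open>m\<close> the identification of \<open>K\<^sub>m\<close> with \<open>\<gg>\<close> given by \<open>s m\<close>. Then \<open>\<K>\<close> becomes an algebra of functions
  \<open>M \<rightarrow> \<gg>\<close> with the pointwise bracket (up to sign): a module over \<open>C = C\<^sup>\<infinity>(M)\<close> with local frames and surjective
  evaluations. That the ideals \<open>\<K>(m, \<gg>\<^sub>0)\<close> are maximal of finite codimension follows from surjectivity of the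
  evaluation at \<open>m\<close> alone.

  The converse rests on \<open>\<K> = [\<K>, \<K>]\<close>. Locally this holds since \<open>[\<gg>, \<gg>] = \<gg>\<close>, but to write a section of a bundle
  over a noncompact base as a finite sum of brackets one needs finitely many global sections spanning every fiber.
  A locally finite sum of frames with generic coefficients yields \<open>dim M + dim \<gg> + 1\<close> of them, because the bad
  coefficients form smooth images of spaces of smaller dimension.

  Now let \<open>I\<close> be a maximal ideal of finite codimension. If the ideal \<open>C I\<close> were \<open>\<K>\<close>, then
  \<open>\<K> = [\<K>, C I] = [C \<K>, I] \<subseteq> I\<close>; so \<open>I\<close> is a submodule. For \<open>f \<in> C\<close> the ideal \<open>{k. f k \<in> I}\<close> is \<open>I\<close> or \<open>\<K>\<close>,
  hence \<open>J = {f. f \<K> \<subseteq> I}\<close> is a prime ideal of \<open>C\<close>, and finite codimension gives for every \<open>f\<close> a polynomial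
  \<open>p \<noteq> 0\<close> with \<open>p \<circ> f \<in> J\<close>. The latter yields a common zero \<open>m\<close> of \<open>J\<close> and, with primeness, that \<open>J\<close> consists of
  all functions vanishing at \<open>m\<close>. By the local frames \<open>I\<close> contains all sections vanishing at \<open>m\<close>, so it is the
  preimage of an ideal of \<open>\<gg>\<close> under evaluation at \<open>m\<close>.
\<close>

section \<open>Smooth maps between Euclidean spaces\<close>

text \<open>Over a noncompact base two obstacles shape the proof. Elements of a span are finite
  sums, so brackets found chart by chart on an infinite cover cannot simply be added. With a number
  of generators independent of the point, infinitely many local pieces can be absorbed into finitely
  many second entries of brackets. The number dim M + dim \<gg> + 1 arises because a linear relation
  among coefficient vectors is described by a point of M and at most dim \<gg> scalars, a family too
  small to fill a space of one dimension more. Likewise C then has maximal ideals that belong to no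
  point, for instance those above the ideal of compactly supported functions. They are excluded by
  the polynomial relation of a single function that grows along a locally finite cover. Since
  tangent vectors are derivations of globally defined functions, local constructions have to be cut
  off, and Hadamard's lemma is the bridge between derivations and coordinates.\<close>

lemma C_k_on_cong:
  assumes "open S" "\<And>x. x \<in> S \<Longrightarrow> f x = g x"
  shows "C_k_on k S f \<longleftrightarrow> C_k_on k S g"
  using assms(2)
proof (induction k arbitrary: f g)
  case 0
  then show ?case by (simp cong: continuous_on_cong)
next
  case (Suc k)
  have *: "C_k_on (Suc k) S g'" if f: "C_k_on (Suc k) S f'" and eq: "\<And>x. x \<in> S \<Longrightarrow> f' x = g' x" for f' g' :: "'a \<Rightarrow> 'b"
  proof -
    have d: "(g' has_derivative frechet_derivative f' (at x)) (at x)" if "x \<in> S" for x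
      using f that eq assms(1)
      by (auto simp: frechet_derivative_works intro: has_derivative_transform_within_open)
    then have eq': "frechet_derivative g' (at x) = frechet_derivative f' (at x)" if "x \<in> S" for x
      using that frechet_derivative_at by metis
    have "C_k_on k S (\<lambda>x. frechet_derivative f' (at x) v) \<longleftrightarrow>
        C_k_on k S (\<lambda>x. frechet_derivative g' (at x) v)" for v
      by (rule Suc.IH) (simp add: eq')
    then show ?thesis using d f by (auto simp: differentiable_def)
  qed
  show ?case using *[of f g] *[of g f] Suc.prems by metis
qed

text \<open>Smoothness inductions below exhibit a derivative \<open>f'\<close> explicitly;
  uniqueness of the derivative at each point identifies it with
  \<open>frechet_derivative\<close>.\<close>

lemma C_k_on_SucI:
  assumes "open S" "\<And>x. x \<in> S \<Longrightarrow> (f has_derivative f' x) (at x)" "\<And>v. C_k_on k S (\<lambda>x. f' x v)"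
  shows "C_k_on (Suc k) S f"
proof -
  have "frechet_derivative f (at x) = f' x" if "x \<in> S" for x
    using assms(2)[OF that] frechet_derivative_at by metis
  with C_k_on_cong[OF assms(1), of "\<lambda>x. f' x v" "\<lambda>x. frechet_derivative f (at x) v" for v]
  have "C_k_on k S (\<lambda>x. f' x v) \<longleftrightarrow> C_k_on k S (\<lambda>x. frechet_derivative f (at x) v)" for v
    by simp
  with assms show ?thesis by (auto simp: differentiable_def)
qed

lemma C_k_on_Suc_has_derivative:
  assumes "C_k_on (Suc k) S f" "x \<in> S"
  shows "(f has_derivative frechet_derivative f (at x)) (at x)"
  using assms by (simp add: frechet_derivative_works)

lemma C_k_on_subset: "C_k_on k S f \<Longrightarrow> T \<subseteq> S \<Longrightarrow> C_k_on k T f"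
  by (induction k arbitrary: f) (auto intro: continuous_on_subset)

lemma C_k_on_Suc_imp: "C_k_on (Suc k) S f \<Longrightarrow> C_k_on k S f"
proof (induction k arbitrary: f)
  case 0
  then show ?case
    using differentiable_imp_continuous_within by (auto intro!: continuous_at_imp_continuous_on)
next
  case (Suc k)
  then have "C_k_on (Suc k) S (\<lambda>x. frechet_derivative f (at x) v)" for v
    using C_k_on.simps(2)[of "Suc k" S f] by blast
  then have "C_k_on k S (\<lambda>x. frechet_derivative f (at x) v)" for v
    by (rule Suc.IH)
  moreover have "\<forall>x\<in>S. f differentiable at x"
    using Suc.prems C_k_on.simps(2)[of "Suc k" S f] by blast
  ultimately show ?case by simp
qed

lemma C_k_on_local:
  assumes "\<And>x. x \<in> S \<Longrightarrow> \<exists>T. open T \<and> x \<in> T \<and> C_k_on k T f"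
  shows "C_k_on k S f"
  using assms
proof (induction k arbitrary: f)
  case 0
  have "continuous (at x within S) f" if x: "x \<in> S" for x
  proof -
    obtain T where "open T" "x \<in> T" "continuous_on T f" using 0[OF x] by auto
    then have "continuous (at x) f" by (simp add: continuous_on_eq_continuous_at)
    then show ?thesis by (rule continuous_at_imp_continuous_at_within)
  qed
  then show ?case by (simp add: continuous_on_eq_continuous_within)
next
  case (Suc k)
  have "f differentiable at x" if "x \<in> S" for x
    using Suc.prems[OF that] by auto
  moreover have "C_k_on k S (\<lambda>x. frechet_derivative f (at x) v)" for v
    using Suc.prems by (intro Suc.IH) fastforce
  ultimately show ?case by simp
qed

lemma C_k_on_const [simp]: "C_k_on k S (\<lambda>x. c)"
  by (induction k arbitrary: c) (auto simp: )

lemma C_k_on_id: "open S \<Longrightarrow> C_k_on k S (\<lambda>x. x)"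
  by (cases k) (auto intro!: C_k_on_SucI[where f'="\<lambda>x v. v"])

lemma C_k_on_bounded_linear:
  assumes l: "bounded_linear l" and "open S"
  shows "C_k_on k S f \<Longrightarrow> C_k_on k S (\<lambda>x. l (f x))"
proof (induction k arbitrary: f)
  case 0
  then show ?case by (simp add: bounded_linear.continuous_on[OF l])
next
  case (Suc k)
  show ?case
  proof (rule C_k_on_SucI[OF assms(2)])
    show "((\<lambda>x. l (f x)) has_derivative (\<lambda>v. l (frechet_derivative f (at x) v))) (at x)" if "x \<in> S" for x
      using C_k_on_Suc_has_derivative[OF Suc.prems that] bounded_linear.has_derivative[OF l] by auto
    show "C_k_on k S (\<lambda>x. l (frechet_derivative f (at x) v))" for v
      using Suc by auto
  qed
qed

lemma C_k_on_add:
  assumes "open S"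
  shows "C_k_on k S f \<Longrightarrow> C_k_on k S g \<Longrightarrow> C_k_on k S (\<lambda>x. f x + g x)"
proof (induction k arbitrary: f g)
  case 0
  then show ?case by (simp add: continuous_on_add)
next
  case (Suc k)
  show ?case
  proof (rule C_k_on_SucI[OF assms])
    show "((\<lambda>x. f x + g x) has_derivative
        (\<lambda>v. frechet_derivative f (at x) v + frechet_derivative g (at x) v)) (at x)" if "x \<in> S" for x
      using Suc.prems that by (intro has_derivative_add C_k_on_Suc_has_derivative)
    show "C_k_on k S (\<lambda>x. frechet_derivative f (at x) v + frechet_derivative g (at x) v)" for v
      using Suc by auto
  qed
qed

text \<open>The product rule pairs \<open>f\<close> itself with a derivative of \<open>g\<close>, so
  the induction needs both maps also at the lower order, which \<open>C_k_on_Suc_imp\<close>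
  provides.\<close>

lemma C_k_on_bounded_bilinear:
  assumes l: "bounded_bilinear l" and "open S"
  shows "C_k_on k S f \<Longrightarrow> C_k_on k S g \<Longrightarrow> C_k_on k S (\<lambda>x. l (f x) (g x))"
proof (induction k arbitrary: f g)
  case 0
  then show ?case by (simp add: bounded_bilinear.continuous_on[OF l])
next
  case (Suc k)
  show ?case
  proof (rule C_k_on_SucI[OF assms(2)])
    show "((\<lambda>x. l (f x) (g x)) has_derivative
        (\<lambda>v. l (f x) (frechet_derivative g (at x) v) + l (frechet_derivative f (at x) v) (g x))) (at x)"
      if "x \<in> S" for x
      using Suc.prems that by (intro bounded_bilinear.FDERIV[OF l] C_k_on_Suc_has_derivative)
    show "C_k_on k S (\<lambda>x. l (f x) (frechet_derivative g (at x) v) + l (frechet_derivative f (at x) v) (g x))"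
      for v
      using Suc.prems C_k_on_Suc_imp[OF Suc.prems(1)] C_k_on_Suc_imp[OF Suc.prems(2)]
      by (intro C_k_on_add Suc.IH assms) auto
  qed
qed

lemma C_k_on_sum:
  assumes "open S" "\<And>i. i \<in> I \<Longrightarrow> C_k_on k S (f i)"
  shows "C_k_on k S (\<lambda>x. \<Sum>i\<in>I. f i x)"
proof (cases "finite I")
  case True
  then show ?thesis using assms(2)
    by (induction I) (auto intro: C_k_on_add[OF assms(1)])
qed auto

text \<open>In the chain rule the direction in which \<open>g\<close> is differentiated moves with
  \<open>x\<close>, whereas \<open>C_k_on\<close> controls derivatives in fixed directions.
  Expanding the moving direction in the basis leaves products of scalar functions with derivatives
  of \<open>g\<close> in fixed directions, to which the induction applies.\<close>

lemma C_k_on_compose: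
  assumes "open S" "open T" "f ` S \<subseteq> T"
  shows "C_k_on k T g \<Longrightarrow> C_k_on k S f \<Longrightarrow> C_k_on k S (\<lambda>x. g (f x))"
proof (induction k arbitrary: g)
  case 0
  then show ?case using assms by (auto intro: continuous_on_compose2)
next
  case (Suc k)
  let ?D = "\<lambda>f x. frechet_derivative f (at x)"
  have lin: "linear (?D g (f x))" if "x \<in> S" for x
    using Suc.prems(1) assms(3) that by (intro linear_frechet_derivative) auto
  show ?case
  proof (rule C_k_on_SucI[OF assms(1)])
    show "((\<lambda>x. g (f x)) has_derivative (\<lambda>v. \<Sum>b\<in>Basis. (?D f x v \<bullet> b) *\<^sub>R ?D g (f x) b)) (at x)"
      if "x \<in> S" for x
    proof -
      have "f x \<in> T" using assms(3) that by auto
      then have "(g \<circ> f has_derivative ?D g (f x) \<circ> ?D f x) (at x)"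
        using Suc.prems that by (intro diff_chain_at C_k_on_Suc_has_derivative)
      moreover have rep: "?D g (f x) w = (\<Sum>b\<in>Basis. (w \<bullet> b) *\<^sub>R ?D g (f x) b)" for w
      proof -
        have "?D g (f x) (\<Sum>b\<in>Basis. (w \<bullet> b) *\<^sub>R b) = (\<Sum>b\<in>Basis. (w \<bullet> b) *\<^sub>R ?D g (f x) b)"
          using lin[OF that] by (simp add: linear_sum linear_cmul)
        then show ?thesis by (simp add: euclidean_representation)
      qed
      have "?D g (f x) \<circ> ?D f x = (\<lambda>v. \<Sum>b\<in>Basis. (?D f x v \<bullet> b) *\<^sub>R ?D g (f x) b)"
        unfolding comp_def by (rule ext) (rule rep)
      ultimately show ?thesis by (simp add: comp_def)
    qed
    show "C_k_on k S (\<lambda>x. \<Sum>b\<in>Basis. (?D f x v \<bullet> b) *\<^sub>R ?D g (f x) b)" for v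
    proof (intro C_k_on_sum C_k_on_bounded_bilinear[OF bounded_bilinear_scaleR] assms)
      fix b :: 'b
      show "C_k_on k S (\<lambda>x. ?D f x v \<bullet> b)" 
        using Suc.prems by (intro C_k_on_bounded_linear[OF bounded_linear_inner_left] assms) simp
      show "C_k_on k S (\<lambda>x. ?D g (f x) b)"
        by (rule Suc.IH) (use Suc.prems C_k_on_Suc_imp[OF Suc.prems(2)] in auto)
    qed
  qed
qed

lemma C_k_on_inverse: "C_k_on k (- {0}) (inverse :: real \<Rightarrow> real)"
proof (induction k)
  case 0
  then show ?case by (auto intro!: continuous_intros)
next
  case (Suc k)
  show ?case
  proof (rule C_k_on_SucI)
    show "((inverse :: real \<Rightarrow> real) has_derivative (\<lambda>v. - (inverse x * v * inverse x))) (at x)"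
      if "x \<in> - {0}" for x
      using that by (intro has_derivative_inverse') auto
    show "C_k_on k (- {0}) (\<lambda>x. - (inverse x * v * inverse x))" for v :: real
    proof -
      have "C_k_on k (- {0}) (\<lambda>x. (-v) * (inverse x * inverse x))"
        by (intro C_k_on_bounded_linear[OF bounded_linear_mult_right]
            C_k_on_bounded_bilinear[OF bounded_bilinear_mult] Suc) auto
      then show ?thesis by (simp add: algebra_simps)
    qed
  qed auto
qed

lemma smooth_on_cong:
  "open S \<Longrightarrow> (\<And>x. x \<in> S \<Longrightarrow> f x = g x) \<Longrightarrow> smooth_on S f \<longleftrightarrow> smooth_on S g"
  unfolding smooth_on_def using C_k_on_cong[of S f g] by simp

lemma smooth_on_subset: "smooth_on S f \<Longrightarrow> T \<subseteq> S \<Longrightarrow> smooth_on T f"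
  unfolding smooth_on_def by (auto intro: C_k_on_subset)

lemma smooth_on_local:
  "(\<And>x. x \<in> S \<Longrightarrow> \<exists>T. open T \<and> x \<in> T \<and> smooth_on T f) \<Longrightarrow> smooth_on S f"
  unfolding smooth_on_def by (intro allI C_k_on_local) blast

lemma smooth_on_const [simp]: "smooth_on S (\<lambda>x. c)"
  by (simp add: smooth_on_def)

lemma smooth_on_id: "open S \<Longrightarrow> smooth_on S (\<lambda>x. x)"
  by (simp add: smooth_on_def C_k_on_id)

lemma smooth_on_bounded_linear:
  "bounded_linear l \<Longrightarrow> open S \<Longrightarrow> smooth_on S f \<Longrightarrow> smooth_on S (\<lambda>x. l (f x))"
  by (simp add: smooth_on_def C_k_on_bounded_linear)

lemma smooth_on_bounded_bilinear:
  "bounded_bilinear l \<Longrightarrow> open S \<Longrightarrow> smooth_on S f \<Longrightarrow> smooth_on S g \<Longrightarrow> smooth_on S (\<lambda>x. l (f x) (g x))"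
  by (simp add: smooth_on_def C_k_on_bounded_bilinear)

lemma smooth_on_add: "open S \<Longrightarrow> smooth_on S f \<Longrightarrow> smooth_on S g \<Longrightarrow> smooth_on S (\<lambda>x. f x + g x)"
  by (simp add: smooth_on_def C_k_on_add)

lemma smooth_on_compose:
  "smooth_on T g \<Longrightarrow> smooth_on S f \<Longrightarrow> open S \<Longrightarrow> open T \<Longrightarrow> f ` S \<subseteq> T \<Longrightarrow> smooth_on S (\<lambda>x. g (f x))"
  by (simp add: smooth_on_def C_k_on_compose)

lemmas smooth_on_mult = smooth_on_bounded_bilinear[OF bounded_bilinear_mult]
lemmas smooth_on_scaleR = smooth_on_bounded_bilinear[OF bounded_bilinear_scaleR]
lemmas smooth_on_inner = smooth_on_bounded_bilinear[OF bounded_bilinear_inner]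
lemmas smooth_on_fst = smooth_on_bounded_linear[OF bounded_linear_fst]
lemmas smooth_on_snd = smooth_on_bounded_linear[OF bounded_linear_snd]
lemmas smooth_on_inner_left = smooth_on_bounded_linear[OF bounded_linear_inner_left]

lemma smooth_on_uminus: "open S \<Longrightarrow> smooth_on S f \<Longrightarrow> smooth_on S (\<lambda>x. - f x)"
  by (rule smooth_on_bounded_linear[OF bounded_linear_minus[OF bounded_linear_ident]])

lemma smooth_on_diff: "open S \<Longrightarrow> smooth_on S f \<Longrightarrow> smooth_on S g \<Longrightarrow> smooth_on S (\<lambda>x. f x - g x)"
  using smooth_on_add[of S f "\<lambda>x. - g x"] smooth_on_uminus[of S g] by simp

lemma smooth_on_Pair:
  assumes "open S" "smooth_on S f" "smooth_on S g"
  shows "smooth_on S (\<lambda>x. (f x, g x))"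
proof -
  have "bounded_linear (\<lambda>a. (a, 0))" "bounded_linear (\<lambda>a. (0, a))"
    by (rule bounded_linear_Pair[OF bounded_linear_ident bounded_linear_zero]
        bounded_linear_Pair[OF bounded_linear_zero bounded_linear_ident])+
  then have "smooth_on S (\<lambda>x. (f x, 0) + (0, g x))"
    using smooth_on_bounded_linear[OF _ assms(1,2)] smooth_on_bounded_linear[OF _ assms(1,3)]
    by (intro smooth_on_add assms(1)) blast+
  then show ?thesis by simp
qed

lemma smooth_on_imp_continuous_on: "smooth_on S f \<Longrightarrow> continuous_on S f"
  unfolding smooth_on_def using C_k_on.simps(1)[of S f] by blast

lemma smooth_on_has_derivative:
  "smooth_on S f \<Longrightarrow> x \<in> S \<Longrightarrow> (f has_derivative frechet_derivative f (at x)) (at x)"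
  unfolding smooth_on_def using C_k_on_Suc_has_derivative[of 0 S f x] by blast

lemma smooth_on_directional: "smooth_on S f \<Longrightarrow> smooth_on S (\<lambda>x. frechet_derivative f (at x) v)"
  unfolding smooth_on_def using C_k_on.simps(2)[of _ S f] by blast

section \<open>A smooth function vanishing exactly on a half-line\<close>

definition flat :: "real \<Rightarrow> real"
  where "flat t = (if t > 0 then exp (- inverse t) else 0)"

lemma flat_nonneg: "flat t \<ge> 0" and flat_eq_0_iff: "flat t = 0 \<longleftrightarrow> t \<le> 0"
  by (auto simp: flat_def)

lemma poly_times_exp_minus_tendsto_0:
  fixes p :: "real poly"
  shows "((\<lambda>s. poly p s * exp (- s)) \<longlongrightarrow> 0) at_top"
proof -
  have "((\<lambda>s. \<Sum>i\<le>degree p. coeff p i * (s ^ i / exp s)) \<longlongrightarrow> (\<Sum>i\<le>degree p. coeff p i * 0)) at_top"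
    by (intro tendsto_sum tendsto_mult tendsto_const tendsto_power_div_exp_0)
  then show ?thesis
    by (simp add: poly_altdef sum_distrib_right exp_minus divide_inverse mult.assoc)
qed

text \<open>The functions \<open>F p\<close>, that is p(1/t) exp(-1/t) extended by zero to t \<le>
  0, are closed under differentiation: with s = 1/t the derivative is \<open>F (q p)\<close> for q p
  = s^2 (p - p'). Smoothness of all of them follows by induction, and \<open>flat\<close> is
  \<open>F 1\<close>.\<close>

lemma smooth_flat: "smooth_on UNIV flat"
proof -
  define F where "F p t = (if t > 0 then poly p (inverse t) * exp (- inverse t) else 0)"
    for p :: "real poly" and t :: real
  define q where "q p = [:0, 0, 1:] * (p - pderiv p)" for p :: "real poly"
  have lim: "(F p \<longlongrightarrow> 0) (at 0)" for p
  proof -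
    have "((\<lambda>t. poly p (inverse t) * exp (- inverse t)) \<longlongrightarrow> 0) (at_right 0)"
      by (rule filterlim_compose[OF poly_times_exp_minus_tendsto_0 filterlim_inverse_at_top_right])
    then have "(F p \<longlongrightarrow> 0) (at_right 0)"
      by (rule Lim_transform_eventually) (auto simp: F_def eventually_at_right_less eventually_at_filter)
    moreover have "(F p \<longlongrightarrow> 0) (at_left 0)"
      by (rule tendsto_eventually) (auto simp: F_def eventually_at_filter)
    ultimately show ?thesis by (simp add: filterlim_split_at)
  qed
  have der: "(F p has_real_derivative F (q p) t) (at t)" for p t
  proof (cases t "0 :: real" rule: linorder_cases)
    case less
    have "((\<lambda>t. 0) has_real_derivative 0) (at t)" by simp
    then have "(F p has_real_derivative 0) (at t)"
      by (rule has_field_derivative_transform_within_open[where S="{..<0}"]) (use less in \<open>auto simp: F_def\<close>)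
    then show ?thesis using less by (simp add: F_def)
  next
    case equal
    \<comment> \<open>The difference quotient at 0 stays in the family: division by h multiplies the
      polynomial by its variable, which is \<open>pCons 0 p\<close>.\<close>
    have "((\<lambda>h. F (pCons 0 p) h) \<longlongrightarrow> 0) (at 0)" by (rule lim)
    moreover have "F (pCons 0 p) h = (F p (0 + h) - F p 0) / h" for h
      by (auto simp: F_def field_simps)
    ultimately show ?thesis using equal by (simp add: DERIV_def F_def)
  next
    case greater
    have "((\<lambda>t. poly p (inverse t) * exp (- inverse t)) has_real_derivative F (q p) t) (at t)"
      using greater
      by (auto intro!: derivative_eq_intros DERIV_chain'[OF _ poly_DERIV] simp: F_def q_def power2_eq_square algebra_simps)
    then show ?thesis
      by (rule has_field_derivative_transform_within_open[where S="{0<..}"]) (use greater in \<open>auto simp: F_def\<close>)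
  qed
  have "C_k_on (Suc k) UNIV (F p)" for k p
  proof (induction k arbitrary: p)
    case 0
    show ?case
    proof (rule C_k_on_SucI)
      show "(F p has_derivative (\<lambda>v. F (q p) x * v)) (at x)" for x
        using der[of p x] by (simp add: has_field_derivative_def)
      have "continuous_on UNIV (F (q p))"
        using der by (meson DERIV_isCont continuous_at_imp_continuous_on)
      then show "C_k_on 0 UNIV (\<lambda>x. F (q p) x * v)" for v
        by (auto intro!: continuous_intros)
    qed auto
  next
    case (Suc k)
    show ?case
    proof (rule C_k_on_SucI)
      show "(F p has_derivative (\<lambda>v. F (q p) x * v)) (at x)" for x
        using der[of p x] by (simp add: has_field_derivative_def)
      show "C_k_on (Suc k) UNIV (\<lambda>x. F (q p) x * v)" for v
        using Suc by (intro C_k_on_bounded_bilinear[OF bounded_bilinear_mult]) auto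
    qed auto
  qed
  then have "C_k_on k UNIV (F 1)" for k using C_k_on_Suc_imp by blast
  moreover have "F 1 = flat" by (auto simp: F_def flat_def)
  ultimately show ?thesis by (simp add: smooth_on_def)
qed

lemma smooth_on_flat: "open S \<Longrightarrow> smooth_on S f \<Longrightarrow> smooth_on S (\<lambda>x. flat (f x))"
  by (rule smooth_on_compose[OF smooth_flat]) auto

section \<open>Parameter integrals and Hadamard's lemma\<close>

lemma smooth_on_parameter_integral:
  fixes F :: "real \<times> 'a::euclidean_space \<Rightarrow> real"
  assumes F: "smooth_on Q F" and "open Q" "open V" "{0..1} \<times> V \<subseteq> Q"
  shows "smooth_on V (\<lambda>w. integral {0..1} (\<lambda>t. F (t, w)))"
proof -
  \<comment> \<open>The integrand stays arbitrary in the induction: a directional derivative of the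
    integral is the integral of \<open>D x (0, v)\<close>, a smooth function of the same
    kind.\<close>
  have "smooth_on Q F \<Longrightarrow> C_k_on k V (\<lambda>w. integral {0..1} (\<lambda>t. F (t, w)))" for k
  proof (induction k arbitrary: F)
    case 0
    have "continuous_on ({0..1} \<times> V) F"
      using smooth_on_imp_continuous_on[OF 0] assms(4) continuous_on_subset by blast
    then have "continuous_on (V \<times> cbox 0 1) (\<lambda>(w, t). F (t, w))"
      by (auto simp: split_beta intro!: continuous_on_compose2[where f="\<lambda>x. (snd x, fst x)"] continuous_intros)
    from integral_continuous_on_param[OF this] show ?case by simp
  next
    case (Suc k)
    define D where "D = (\<lambda>x. frechet_derivative F (at x))"
    have DF: "(F has_derivative D x) (at x)" if "x \<in> Q" for x
      using smooth_on_has_derivative[OF Suc.prems that] by (simp add: D_def)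
    have smD: "smooth_on Q (\<lambda>x. D x v)" for v
      using smooth_on_directional[OF Suc.prems] by (simp add: D_def)
    \<comment> \<open>\<open>leibniz_rule\<close> asks for derivatives as bounded linear maps
      depending continuously on both arguments; continuity is checked on basis vectors.\<close>
    define E where "E w t = Blinfun (\<lambda>v. D (t, w) (0, v))" for w t
    have E: "blinfun_apply (E w t) = (\<lambda>v. D (t, w) (0, v))" if "(t, w) \<in> Q" for w t
    proof -
      have "bounded_linear (D (t, w))" using DF[OF that] by (rule has_derivative_bounded_linear)
      then have "bounded_linear (\<lambda>v. D (t, w) (0, v))"
        by (rule bounded_linear_compose) (rule bounded_linear_Pair[OF bounded_linear_zero bounded_linear_ident])
      then show ?thesis by (simp add: E_def bounded_linear_Blinfun_apply)
    qed
    have cont: "continuous_on (V \<times> cbox 0 1) (\<lambda>(w, t). E w t)"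
    proof (rule continuous_on_blinfun_componentwise)
      fix i :: 'a assume "i \<in> Basis"
      have "continuous_on (V \<times> cbox 0 1) (\<lambda>x. D (snd x, fst x) (0, i))"
        by (rule continuous_on_compose2[OF smooth_on_imp_continuous_on[OF smD]])
          (use assms(4) in \<open>auto intro!: continuous_intros\<close>)
      then show "continuous_on (V \<times> cbox 0 1) (\<lambda>x. blinfun_apply (case x of (w, t) \<Rightarrow> E w t) i)"
        by (rule continuous_on_eq) (use assms(4) E in \<open>auto simp: subset_iff\<close>)
    qed
    have int: "(\<lambda>t. F (t, w)) integrable_on cbox 0 1" if "w \<in> V" for w
      by (rule integrable_continuous)
        (use that assms(4) in \<open>auto intro!: continuous_on_compose2[OF smooth_on_imp_continuous_on[OF Suc.prems]] continuous_intros\<close>)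
    have der: "((\<lambda>w. integral {0..1} (\<lambda>t. F (t, w))) has_derivative
        (\<lambda>v. integral {0..1} (\<lambda>t. D (t, w) (0, v)))) (at w)" if w: "w \<in> V" for w
    proof -
      obtain e where e: "e > 0" "ball w e \<subseteq> V" using assms(3) w openE by blast
      have "((\<lambda>w. integral (cbox 0 1) (\<lambda>t. F (t, w))) has_derivative
          blinfun_apply (integral (cbox 0 1) (E w))) (at w within ball w e)"
      proof (rule leibniz_rule)
        show "((\<lambda>w. F (t, w)) has_derivative blinfun_apply (E x t)) (at x within ball w e)"
          if "x \<in> ball w e" "t \<in> cbox 0 1" for x t
        proof -
          have Q: "(t, x) \<in> Q" using that e assms(4) by (auto simp: subset_iff)
          have "((\<lambda>w. (t, w)) has_derivative (\<lambda>v. (0, v))) (at x within ball w e)"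
            by (auto intro!: derivative_eq_intros)
          from has_derivative_compose[OF this DF[OF Q]] show ?thesis by (simp add: E[OF Q])
        qed
        show "continuous_on (ball w e \<times> cbox 0 1) (\<lambda>(x, t). E x t)"
          using cont by (rule continuous_on_subset) (use e in auto)
      qed (use int e in auto)
      moreover have "blinfun_apply (integral (cbox 0 1) (E w)) = (\<lambda>v. integral {0..1} (\<lambda>t. D (t, w) (0, v)))"
      proof
        fix v
        have "E w integrable_on cbox 0 1"
        proof (rule integrable_continuous)
          show "continuous_on (cbox 0 1) (E w)"
            using continuous_on_compose2[OF cont, of "cbox 0 1" "\<lambda>t. (w, t)"] w
            by (simp add: image_subset_iff continuous_on_Pair)
        qed
        then have "blinfun_apply (integral (cbox 0 1) (E w)) v = integral (cbox 0 1) (\<lambda>t. blinfun_apply (E w t) v)"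
          by (rule blinfun_apply_integral)
        also have "\<dots> = integral {0..1} (\<lambda>t. D (t, w) (0, v))"
          using assms(4) w by (auto simp: E subset_iff intro!: integral_cong)
        finally show "blinfun_apply (integral (cbox 0 1) (E w)) v = integral {0..1} (\<lambda>t. D (t, w) (0, v))" .
      qed
      ultimately show ?thesis using e at_within_open[of w "ball w e"] by simp
    qed
    show ?case
      by (rule C_k_on_SucI[OF assms(3) der Suc.IH[OF smD]])
  qed
  then show ?thesis using F by (simp add: smooth_on_def)
qed

lemma has_derivative_eq_frechet:
  "(f has_derivative f') (at x) \<Longrightarrow> frechet_derivative f (at x) = f'"
  using frechet_derivative_at by metis

text \<open>The mean of the partial derivative in direction \<open>b\<close> over the segment from
  \<open>y0\<close> to \<open>y\<close>. These are the coefficients in Hadamard's lemma, which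
  writes a function vanishing at \<open>y0\<close> as a combination of coordinates with smooth
  coefficients.\<close>

definition hadamard_quotient :: "('a::euclidean_space \<Rightarrow> real) \<Rightarrow> 'a \<Rightarrow> 'a \<Rightarrow> 'a \<Rightarrow> real"
  where "hadamard_quotient f y0 y b = integral {0..1} (\<lambda>t. frechet_derivative f (at (y0 + t *\<^sub>R (y - y0))) b)"

lemma hadamard_quotient_center: "hadamard_quotient f y0 y0 b = frechet_derivative f (at y0) b"
  by (simp add: hadamard_quotient_def)

text \<open>The expansion is the fundamental theorem of calculus along the segment from
  \<open>y0\<close> to \<open>y\<close>, which stays in the ball. The parameter \<open>z\<close> is
  carried along because the coefficients must be smooth jointly in both variables.\<close>

lemma
  fixes F :: "'a::euclidean_space \<times> 'b::euclidean_space \<Rightarrow> real"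
  assumes F: "smooth_on (ball y0 e \<times> T) F" and "open T"
  shows smooth_on_hadamard_quotient:
      "smooth_on (ball y0 e \<times> T) (\<lambda>w. hadamard_quotient (\<lambda>y. F (y, snd w)) y0 (fst w) b)"
    and hadamard_expansion: "y \<in> ball y0 e \<Longrightarrow> z \<in> T \<Longrightarrow>
      F (y, z) - F (y0, z) = (\<Sum>b\<in>Basis. ((y - y0) \<bullet> b) * hadamard_quotient (\<lambda>y. F (y, z)) y0 y b)"
proof -
  define S where "S = ball y0 e \<times> T"
  have oS: "open S" using assms(2) by (auto simp: S_def open_Times)
  define DF where "DF = (\<lambda>x. frechet_derivative F (at x))"
  have DF: "(F has_derivative DF x) (at x)" if "x \<in> S" for x
    using smooth_on_has_derivative F that by (auto simp: DF_def S_def)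
  have smDF: "smooth_on S (\<lambda>x. DF x v)" for v
    using smooth_on_directional[OF F] by (simp add: DF_def S_def)
  define A where "A = (\<lambda>w :: real \<times> ('a \<times> 'b). (y0 + fst w *\<^sub>R (fst (snd w) - y0), snd (snd w)))"
  have smA: "smooth_on UNIV A" unfolding A_def
    by (intro smooth_on_Pair smooth_on_add smooth_on_scaleR smooth_on_diff smooth_on_fst smooth_on_snd smooth_on_id
        smooth_on_const) auto
  have cA: "continuous_on UNIV A" by (rule smooth_on_imp_continuous_on[OF smA])
  \<comment> \<open>\<open>A\<close> maps (t, y, z) to the point at time t on the segment, with z
    kept. The preimage \<open>W\<close> of \<open>S\<close> is an open set containing {0..1}
    \<times> S, as the parameter integral requires.\<close>
  define W where "W = A -` S"
  have oW: "open W" unfolding W_def using open_vimage[OF oS cA] .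
  have in_S: "(y0 + t *\<^sub>R (y - y0), z) \<in> S" if "(y, z) \<in> S" "t \<in> {0..1}" for y z t
  proof -
    have "norm (t *\<^sub>R (y - y0)) \<le> norm (y - y0)"
      using that by (auto intro: mult_left_le_one_le)
    then have "y0 + t *\<^sub>R (y - y0) \<in> ball y0 e"
      using that by (auto simp: S_def dist_norm norm_minus_commute)
    then show ?thesis using that by (auto simp: S_def)
  qed
  define D where "D b = (\<lambda>w. integral {0..1} (\<lambda>t. DF (A (t, w)) (b, 0)))" for b
  have 1: "smooth_on S (D b)" for b
    unfolding D_def
  proof (rule smooth_on_parameter_integral[where Q=W])
    show "smooth_on W (\<lambda>w. DF (A w) (b, 0))"
      by (rule smooth_on_compose[OF smDF, where f=A])
        (use oS oW smooth_on_subset[OF smA] in \<open>auto simp: W_def S_def\<close>)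
    show "{0..1} \<times> S \<subseteq> W" using in_S by (auto simp: W_def A_def)
  qed (use oW oS in auto)
  have 2: "F (y, z) - F (y0, z) = (\<Sum>b\<in>Basis. ((y - y0) \<bullet> b) * D b (y, z))"
    if yz: "y \<in> ball y0 e" "z \<in> T" for y z
  proof -
    have S: "(y, z) \<in> S" using yz by (simp add: S_def)
    define G where "G t = A (t, (y, z))" for t
    have G: "G t \<in> S" if "t \<in> {0..1}" for t using in_S[OF S that] by (simp add: G_def A_def)
    have "((\<lambda>t. DF (G t) (y - y0, 0)) has_integral (F (G 1) - F (G 0))) {0..1}"
    proof (rule fundamental_theorem_of_calculus)
      fix t :: real assume t: "t \<in> {0..1}"
      have "(G has_derivative (\<lambda>s. (s *\<^sub>R (y - y0), 0))) (at t within {0..1})"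
        unfolding G_def A_def by (auto intro!: derivative_eq_intros)
      from has_derivative_compose[OF this DF[OF G[OF t]]]
      have "((\<lambda>t. F (G t)) has_derivative (\<lambda>s. DF (G t) (s *\<^sub>R (y - y0), 0))) (at t within {0..1})" .
      moreover have "DF (G t) (s *\<^sub>R (y - y0), 0) = s *\<^sub>R DF (G t) (y - y0, 0)" for s
      proof -
        have "DF (G t) (s *\<^sub>R (y - y0, 0)) = s *\<^sub>R DF (G t) (y - y0, 0)"
          using DF[OF G[OF t]] has_derivative_linear linear_cmul by blast
        then show ?thesis by simp
      qed
      ultimately show "((\<lambda>t. F (G t)) has_vector_derivative DF (G t) (y - y0, 0)) (at t within {0..1})"
        by (simp add: has_vector_derivative_def)
    qed auto
    then have "F (G 1) - F (G 0) = integral {0..1} (\<lambda>t. DF (G t) (y - y0, 0))"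
      by (simp add: integral_unique)
    also have "\<dots> = integral {0..1} (\<lambda>t. \<Sum>b\<in>Basis. ((y - y0) \<bullet> b) * DF (G t) (b, 0))"
    proof (rule integral_cong)
      fix t :: real assume t: "t \<in> {0..1}"
      have lin: "linear (DF (G t))" using DF[OF G[OF t]] has_derivative_linear by blast
      have "(y - y0, 0) = (\<Sum>b\<in>Basis. ((y - y0) \<bullet> b) *\<^sub>R (b, 0))"
        by (simp add: prod_eq_iff fst_sum snd_sum euclidean_representation)
      then have "DF (G t) (y - y0, 0) = DF (G t) (\<Sum>b\<in>Basis. ((y - y0) \<bullet> b) *\<^sub>R (b, 0))"
        by (rule arg_cong)
      also have "\<dots> = (\<Sum>b\<in>Basis. ((y - y0) \<bullet> b) * DF (G t) (b, 0))"
        using linear_cmul[OF lin, of _ "(_, 0)"] by (simp add: linear_sum[OF lin])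
      finally show "DF (G t) (y - y0, 0) = (\<Sum>b\<in>Basis. ((y - y0) \<bullet> b) * DF (G t) (b, 0))" .
    qed
    also have "\<dots> = (\<Sum>b\<in>Basis. integral {0..1} (\<lambda>t. ((y - y0) \<bullet> b) * DF (G t) (b, 0)))"
    proof (rule integral_sum)
      fix b :: 'a
      have "continuous_on {0..1} (\<lambda>t. DF (G t) (b, 0))"
        by (rule continuous_on_compose2[OF smooth_on_imp_continuous_on[OF smDF]])
          (auto simp: G_def A_def in_S[OF S] intro!: continuous_intros)
      then show "(\<lambda>t. ((y - y0) \<bullet> b) * DF (G t) (b, 0)) integrable_on {0..1}"
        by (intro integrable_continuous_real continuous_intros)
    qed auto
    also have "\<dots> = (\<Sum>b\<in>Basis. ((y - y0) \<bullet> b) * D b (y, z))"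
      by (simp add: D_def G_def)
    finally show ?thesis by (simp add: G_def A_def)
  qed
  have 3: "D b (y, z) = hadamard_quotient (\<lambda>y. F (y, z)) y0 y b" if yz: "(y, z) \<in> S" for b y z
    unfolding D_def hadamard_quotient_def
  proof (rule integral_cong)
    fix t :: real assume t: "t \<in> {0..1}"
    have "((\<lambda>y. (y, z)) has_derivative (\<lambda>v. (v, 0))) (at (y0 + t *\<^sub>R (y - y0)))"
      by (auto intro!: derivative_eq_intros)
    from has_derivative_compose[OF this DF[OF in_S[OF yz t]]]
    have "frechet_derivative (\<lambda>y. F (y, z)) (at (y0 + t *\<^sub>R (y - y0))) = (\<lambda>v. DF (y0 + t *\<^sub>R (y - y0), z) (v, 0))"
      by (rule has_derivative_eq_frechet)
    then show "DF (A (t, y, z)) (b, 0) = frechet_derivative (\<lambda>y. F (y, z)) (at (y0 + t *\<^sub>R (y - y0))) b"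
      by (simp add: A_def)
  qed
  have "smooth_on S (\<lambda>w. hadamard_quotient (\<lambda>y. F (y, snd w)) y0 (fst w) b) \<longleftrightarrow> smooth_on S (D b)"
    by (rule smooth_on_cong[OF oS]) (metis 3 prod.collapse)
  with 1 show "smooth_on (ball y0 e \<times> T) (\<lambda>w. hadamard_quotient (\<lambda>y. F (y, snd w)) y0 (fst w) b)"
    by (simp add: S_def)
  show "F (y, z) - F (y0, z) = (\<Sum>b\<in>Basis. ((y - y0) \<bullet> b) * hadamard_quotient (\<lambda>y. F (y, z)) y0 y b)"
    if "y \<in> ball y0 e" "z \<in> T"
    using 2[OF that] 3 that by (simp add: S_def)
qed

section \<open>Smooth maps between manifolds\<close>

lemma
  assumes "smooth_manifold A" "(U, \<phi>) \<in> A"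
  shows chart_open: "open U" and chart_open_image: "open (\<phi> ` U)"
    and chart_homeomorphism: "homeomorphism U (\<phi> ` U) \<phi> (inv_into U \<phi>)"
    and chart_continuous: "continuous_on U \<phi>"
    and chart_inj: "inj_on \<phi> U"
proof -
  show 1: "open U" and "open (\<phi> ` U)" and 2: "homeomorphism U (\<phi> ` U) \<phi> (inv_into U \<phi>)"
    using assms unfolding smooth_manifold_def by auto
  show "continuous_on U \<phi>" using 2 by (simp add: homeomorphism_def)
  show "inj_on \<phi> U" using 2 by (auto simp: homeomorphism_def intro: inj_on_inverseI)
qed

lemma chart_transition:
  "smooth_manifold A \<Longrightarrow> (U, \<phi>) \<in> A \<Longrightarrow> (V, \<psi>) \<in> A \<Longrightarrow> smooth_on (\<phi> ` (U \<inter> V)) (\<lambda>y. \<psi> (inv_into U \<phi> y))"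
  unfolding smooth_manifold_def comp_def by (auto split: prod.splits)

lemma chart_exists:
  assumes "smooth_manifold A"
  obtains U \<phi> where "(U, \<phi>) \<in> A" "x \<in> U"
proof -
  have "x \<in> (\<Union>(U, \<phi>)\<in>A. U)" using assms by (simp add: smooth_manifold_def)
  then show ?thesis using that by auto
qed

lemma chart_open_image_Int:
  assumes "smooth_manifold A" "(U, \<phi>) \<in> A" "open W"
  shows "open (\<phi> ` (U \<inter> W))"
proof -
  have "openin (top_of_set U) (U \<inter> W)" using assms(3) by auto
  then have "openin (top_of_set (\<phi> ` U)) (\<phi> ` (U \<inter> W))"
    using homeomorphism_imp_open_map[OF chart_homeomorphism[OF assms(1,2)]] by blast
  then show ?thesis using chart_open_image[OF assms(1,2)] openin_open_trans by blast
qed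

lemma chart_inv [simp]:
  assumes "smooth_manifold A" "(U, \<phi>) \<in> A" "x \<in> U"
  shows "inv_into U \<phi> (\<phi> x) = x"
  using chart_inj[OF assms(1,2)] assms(3) by simp

lemma smooth_manifold_euclidean: "smooth_manifold (euclidean_atlas :: ('e::euclidean_space, 'e) atlas)"
  unfolding smooth_manifold_def euclidean_atlas_def
  by (auto simp: homeomorphism_def inv_into_def comp_def intro!: smooth_on_id continuous_on_id)

lemma map_prod_image_Int:
  "map_prod \<phi> \<psi> ` ((U \<times> V) \<inter> (U' \<times> V')) = (\<phi> ` (U \<inter> U')) \<times> (\<psi> ` (V \<inter> V'))"
  by (simp add: Times_Int_Times map_prod_surj_on[OF refl refl])

lemma inv_into_map_prod:
  assumes "inj_on \<phi> U" "inj_on \<psi> V" "y \<in> \<phi> ` U" "z \<in> \<psi> ` V"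
  shows "inv_into (U \<times> V) (map_prod \<phi> \<psi>) (y, z) = (inv_into U \<phi> y, inv_into V \<psi> z)"
proof (rule inv_into_f_eq)
  show "inj_on (map_prod \<phi> \<psi>) (U \<times> V)" using assms by (simp add: map_prod_inj_on)
qed (use assms in \<open>auto simp: f_inv_into_f inv_into_into\<close>)

lemma smooth_manifoldI:
  assumes "\<And>x. \<exists>U \<phi>. (U, \<phi>) \<in> A \<and> x \<in> U"
    "\<And>U \<phi>. (U, \<phi>) \<in> A \<Longrightarrow> open U \<and> open (\<phi> ` U) \<and> homeomorphism U (\<phi> ` U) \<phi> (inv_into U \<phi>)"
    "\<And>U \<phi> V \<psi>. (U, \<phi>) \<in> A \<Longrightarrow> (V, \<psi>) \<in> A \<Longrightarrow> smooth_on (\<phi> ` (U \<inter> V)) (\<psi> \<circ> inv_into U \<phi>)"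
  shows "smooth_manifold A"
  unfolding smooth_manifold_def
proof (intro conjI)
  have "x \<in> (\<Union>(U, \<phi>)\<in>A. U)" for x using assms(1)[of x] by auto
  then show "(\<Union>(U, \<phi>)\<in>A. U) = UNIV" by blast
  show "\<forall>(U, \<phi>)\<in>A. open U \<and> open (\<phi> ` U) \<and> homeomorphism U (\<phi> ` U) \<phi> (inv_into U \<phi>)"
    using assms(2) by auto
  show "\<forall>(U, \<phi>)\<in>A. \<forall>(V, \<psi>)\<in>A. smooth_on (\<phi> ` (U \<inter> V)) (\<psi> \<circ> inv_into U \<phi>)"
    using assms(3) by auto
qed

lemma smooth_manifold_product:
  assumes A: "smooth_manifold A" and B: "smooth_manifold B"
  shows "smooth_manifold (product_atlas A B)"
proof (rule smooth_manifoldI, goal_cases)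
  case (1 z)
  obtain U \<phi> V \<psi> where "(U, \<phi>) \<in> A" "fst z \<in> U" "(V, \<psi>) \<in> B" "snd z \<in> V"
    using chart_exists[OF A, of "fst z"] chart_exists[OF B, of "snd z"] by metis
  then have "(U \<times> V, map_prod \<phi> \<psi>) \<in> product_atlas A B \<and> z \<in> U \<times> V"
    by (auto simp: product_atlas_def mem_Times_iff)
  then show ?case by blast
next
  case (2 P \<Phi>)
  then obtain U \<phi> V \<psi> where W: "P = U \<times> V" "\<Phi> = map_prod \<phi> \<psi>" and U: "(U, \<phi>) \<in> A" and V: "(V, \<psi>) \<in> B"
    by (auto simp: product_atlas_def)
  note inj = chart_inj[OF A U] chart_inj[OF B V]
  have im: "map_prod \<phi> \<psi> ` (U \<times> V) = \<phi> ` U \<times> \<psi> ` V"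
    using map_prod_image_Int[of \<phi> \<psi> U V U V] by simp
  have "homeomorphism (U \<times> V) (\<phi> ` U \<times> \<psi> ` V) (map_prod \<phi> \<psi>) (inv_into (U \<times> V) (map_prod \<phi> \<psi>))"
  proof (rule homeomorphismI)
    show "continuous_on (U \<times> V) (map_prod \<phi> \<psi>)"
      unfolding map_prod_def split_beta
      by (intro continuous_on_Pair continuous_on_compose2[OF chart_continuous[OF A U], of _ fst]
          continuous_on_compose2[OF chart_continuous[OF B V], of _ snd] continuous_intros) auto
    have "continuous_on (\<phi> ` U \<times> \<psi> ` V) (\<lambda>w. (inv_into U \<phi> (fst w), inv_into V \<psi> (snd w)))"
      using chart_homeomorphism[OF A U] chart_homeomorphism[OF B V]
      by (intro continuous_on_Pair continuous_on_compose2[of "\<phi> ` U" "inv_into U \<phi>" _ fst]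
          continuous_on_compose2[of "\<psi> ` V" "inv_into V \<psi>" _ snd] continuous_intros)
        (auto simp: homeomorphism_def)
    then show "continuous_on (\<phi> ` U \<times> \<psi> ` V) (inv_into (U \<times> V) (map_prod \<phi> \<psi>))"
      by (rule continuous_on_eq) (use inj in \<open>auto simp: inv_into_map_prod\<close>)
  qed (use inj in \<open>auto simp: inv_into_map_prod inv_into_into f_inv_into_f\<close>)
  then show ?case using W chart_open[OF A U] chart_open[OF B V] chart_open_image[OF A U] chart_open_image[OF B V]
    by (auto simp: im intro: open_Times)
next
  case (3 P \<Phi> P' \<Phi>')
  then obtain U \<phi> V \<psi> U' \<phi>' V' \<psi>' where W: "P = U \<times> V" "\<Phi> = map_prod \<phi> \<psi>" "P' = U' \<times> V'" "\<Phi>' = map_prod \<phi>' \<psi>'"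
    and U: "(U, \<phi>) \<in> A" and V: "(V, \<psi>) \<in> B" and U': "(U', \<phi>') \<in> A" and V': "(V', \<psi>') \<in> B"
    by (auto simp: product_atlas_def)
  note inj = chart_inj[OF A U] chart_inj[OF B V]
  let ?S = "\<phi> ` (U \<inter> U')" and ?T = "\<psi> ` (V \<inter> V')"
  have op: "open ?S" "open ?T"
    using chart_open_image_Int[OF A U chart_open[OF A U']] chart_open_image_Int[OF B V chart_open[OF B V']] by auto
  have opp: "open (?S \<times> ?T)" using op by (rule open_Times)
  have "smooth_on (?S \<times> ?T) (\<lambda>w. (\<phi>' (inv_into U \<phi> (fst w)), \<psi>' (inv_into V \<psi> (snd w))))"
  proof (rule smooth_on_Pair[OF opp])
    show "smooth_on (?S \<times> ?T) (\<lambda>w. \<phi>' (inv_into U \<phi> (fst w)))"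
      by (rule smooth_on_compose[OF chart_transition[OF A U U'] smooth_on_fst[OF opp smooth_on_id[OF opp]]])
        (use op opp in auto)
    show "smooth_on (?S \<times> ?T) (\<lambda>w. \<psi>' (inv_into V \<psi> (snd w)))"
      by (rule smooth_on_compose[OF chart_transition[OF B V V'] smooth_on_snd[OF opp smooth_on_id[OF opp]]])
        (use op opp in auto)
  qed
  moreover have "map_prod \<phi>' \<psi>' (inv_into (U \<times> V) (map_prod \<phi> \<psi>) w) =
      (\<phi>' (inv_into U \<phi> (fst w)), \<psi>' (inv_into V \<psi> (snd w)))" if "w \<in> ?S \<times> ?T" for w
    using that inj by (auto simp: inv_into_map_prod)
  ultimately have "smooth_on (?S \<times> ?T) (map_prod \<phi>' \<psi>' \<circ> inv_into (U \<times> V) (map_prod \<phi> \<psi>))"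
    using smooth_on_cong[OF opp, of "map_prod \<phi>' \<psi>' \<circ> inv_into (U \<times> V) (map_prod \<phi> \<psi>)"] by simp
  then show ?case by (simp add: W map_prod_image_Int)
qed

lemma smooth_map_on_continuous: "smooth_map_on A B W F \<Longrightarrow> continuous_on W F"
  by (simp add: smooth_map_on_def)

lemma smooth_map_on_chart:
  assumes "smooth_map_on A B W F" "(U, \<phi>) \<in> A" "(V, \<psi>) \<in> B"
  shows "smooth_on (\<phi> ` (U \<inter> W \<inter> F -` V)) (\<lambda>y. \<psi> (F (inv_into U \<phi> y)))"
proof -
  have "\<forall>p\<in>A. \<forall>q\<in>B. smooth_on (snd p ` (fst p \<inter> W \<inter> F -` fst q)) (\<lambda>y. snd q (F (inv_into (fst p) (snd p) y)))"
    using assms(1) by (simp add: smooth_map_on_def case_prod_unfold comp_def)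
  from bspec[OF bspec[OF this assms(2)] assms(3)] show ?thesis by simp
qed

lemma smooth_map_onI:
  assumes "continuous_on W F"
    "\<And>U \<phi> V \<psi>. (U, \<phi>) \<in> A \<Longrightarrow> (V, \<psi>) \<in> B \<Longrightarrow> smooth_on (\<phi> ` (U \<inter> W \<inter> F -` V)) (\<lambda>y. \<psi> (F (inv_into U \<phi> y)))"
  shows "smooth_map_on A B W F"
proof -
  have "\<forall>p\<in>A. \<forall>q\<in>B. smooth_on (snd p ` (fst p \<inter> W \<inter> F -` fst q)) (\<lambda>y. snd q (F (inv_into (fst p) (snd p) y)))"
    by (intro ballI assms(2)) simp_all
  with assms(1) show ?thesis by (simp add: smooth_map_on_def case_prod_unfold comp_def)
qed

lemma smooth_map_on_subset:
  assumes "smooth_map_on A B W F" "W' \<subseteq> W"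
  shows "smooth_map_on A B W' F"
proof (rule smooth_map_onI)
  show "continuous_on W' F" using smooth_map_on_continuous[OF assms(1)] assms(2) by (rule continuous_on_subset)
  show "smooth_on (\<phi> ` (U \<inter> W' \<inter> F -` V)) (\<lambda>y. \<psi> (F (inv_into U \<phi> y)))"
    if "(U, \<phi>) \<in> A" "(V, \<psi>) \<in> B" for U \<phi> V \<psi>
    by (rule smooth_on_subset[OF smooth_map_on_chart[OF assms(1) that]]) (use assms(2) in auto)
qed

lemma smooth_map_on_local:
  assumes A: "smooth_manifold A" and B: "smooth_manifold B"
    and loc: "\<And>x. x \<in> W \<Longrightarrow> \<exists>T. open T \<and> x \<in> T \<and> smooth_map_on A B T F"
  shows "smooth_map_on A B W F"
proof (rule smooth_map_onI)
  show "continuous_on W F"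
  proof (rule continuous_at_imp_continuous_on, rule ballI)
    fix x assume "x \<in> W"
    then obtain T where "open T" "x \<in> T" "smooth_map_on A B T F" using loc by blast
    then have "open T" "x \<in> T" "continuous_on T F" by (auto intro: smooth_map_on_continuous)
    then show "isCont F x" by (simp add: continuous_on_eq_continuous_at)
  qed
  fix U \<phi> V \<psi> assume U: "(U, \<phi>) \<in> A" and V: "(V, \<psi>) \<in> B"
  show "smooth_on (\<phi> ` (U \<inter> W \<inter> F -` V)) (\<lambda>y. \<psi> (F (inv_into U \<phi> y)))"
  proof (rule smooth_on_local)
    fix y assume "y \<in> \<phi> ` (U \<inter> W \<inter> F -` V)"
    then obtain x where x: "x \<in> U" "x \<in> W" "F x \<in> V" "y = \<phi> x" by auto
    then obtain T where T: "open T" "x \<in> T" "smooth_map_on A B T F" using loc by blast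
    have "open (T \<inter> F -` V)"
      using continuous_open_preimage[OF smooth_map_on_continuous[OF T(3)] T(1) chart_open[OF B V]] .
    then have "open (\<phi> ` (U \<inter> (T \<inter> F -` V)))" by (rule chart_open_image_Int[OF A U])
    moreover have "y \<in> \<phi> ` (U \<inter> (T \<inter> F -` V))" using x T by auto
    moreover have "smooth_on (\<phi> ` (U \<inter> (T \<inter> F -` V))) (\<lambda>y. \<psi> (F (inv_into U \<phi> y)))"
      using smooth_map_on_chart[OF T(3) U V] by (simp add: Int_assoc)
    ultimately show "\<exists>T. open T \<and> y \<in> T \<and> smooth_on T (\<lambda>y. \<psi> (F (inv_into U \<phi> y)))" by blast
  qed
qed

lemma smooth_map_on_cong:
  assumes A: "smooth_manifold A" and B: "smooth_manifold B" and F: "smooth_map_on A B W F"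
    and "open W" and eq: "\<And>x. x \<in> W \<Longrightarrow> F x = F' x"
  shows "smooth_map_on A B W F'"
proof (rule smooth_map_onI)
  show "continuous_on W F'" by (rule continuous_on_eq[OF smooth_map_on_continuous[OF F] eq])
  fix U \<phi> V \<psi> assume U: "(U, \<phi>) \<in> A" and V: "(V, \<psi>) \<in> B"
  have op: "open (\<phi> ` (U \<inter> (W \<inter> F -` V)))"
    using continuous_open_preimage[OF smooth_map_on_continuous[OF F] assms(4) chart_open[OF B V]]
    by (rule chart_open_image_Int[OF A U])
  have "smooth_on (\<phi> ` (U \<inter> (W \<inter> F -` V))) (\<lambda>y. \<psi> (F (inv_into U \<phi> y)))"
    using smooth_map_on_chart[OF F U V] by (simp add: Int_assoc)
  then have "smooth_on (\<phi> ` (U \<inter> (W \<inter> F -` V))) (\<lambda>y. \<psi> (F' (inv_into U \<phi> y)))"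
    by (subst (asm) smooth_on_cong[OF op, where g="\<lambda>y. \<psi> (F' (inv_into U \<phi> y))"])
      (use eq chart_inv[OF A U] in auto)
  moreover have "U \<inter> (W \<inter> F -` V) = U \<inter> W \<inter> F' -` V" using eq by auto
  ultimately show "smooth_on (\<phi> ` (U \<inter> W \<inter> F' -` V)) (\<lambda>y. \<psi> (F' (inv_into U \<phi> y)))" by simp
qed

text \<open>Near \<open>x\<close> a chart of the middle manifold around \<open>F x\<close> is
  inserted, and the neighbourhood is shrunk until \<open>F\<close> maps it into that chart and
  \<open>G\<close> maps the result into the given chart of \<open>C\<close>.\<close>

lemma smooth_map_on_compose:
  assumes A: "smooth_manifold A" and B: "smooth_manifold B" and C: "smooth_manifold C"
    and G: "smooth_map_on B C W' G" and F: "smooth_map_on A B W F" and "open W" "open W'"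
    and sub: "\<And>x. x \<in> W \<Longrightarrow> F x \<in> W'"
  shows "smooth_map_on A C W (\<lambda>x. G (F x))"
proof (rule smooth_map_onI)
  show "continuous_on W (\<lambda>x. G (F x))"
    by (rule continuous_on_compose2[OF smooth_map_on_continuous[OF G] smooth_map_on_continuous[OF F]]) (use sub in auto)
  fix U \<phi> Z \<omega> assume U: "(U, \<phi>) \<in> A" and Z: "(Z, \<omega>) \<in> C"
  show "smooth_on (\<phi> ` (U \<inter> W \<inter> (\<lambda>x. G (F x)) -` Z)) (\<lambda>y. \<omega> (G (F (inv_into U \<phi> y))))"
  proof (rule smooth_on_local)
    fix y assume "y \<in> \<phi> ` (U \<inter> W \<inter> (\<lambda>x. G (F x)) -` Z)"
    then obtain x where x: "x \<in> U" "x \<in> W" "G (F x) \<in> Z" "y = \<phi> x" by auto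
    obtain V \<psi> where V: "(V, \<psi>) \<in> B" "F x \<in> V" using chart_exists[OF B] by blast
    let ?N = "W' \<inter> G -` Z"
    have oN: "open ?N"
      using continuous_open_preimage[OF smooth_map_on_continuous[OF G] \<open>open W'\<close> chart_open[OF C Z]] .
    have "open (V \<inter> ?N)" using oN chart_open[OF B V(1)] by auto
    then have "open (W \<inter> F -` (V \<inter> ?N))"
      using continuous_open_preimage[OF smooth_map_on_continuous[OF F] \<open>open W\<close>] by blast
    then have oT: "open (\<phi> ` (U \<inter> (W \<inter> F -` (V \<inter> ?N))))" (is "open ?T")
      by (rule chart_open_image_Int[OF A U])
    have "smooth_on ?T (\<lambda>y. (\<lambda>z. \<omega> (G (inv_into V \<psi> z))) (\<psi> (F (inv_into U \<phi> y))))"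
    proof (rule smooth_on_compose[where T="\<psi> ` (V \<inter> ?N)" and g="\<lambda>z. \<omega> (G (inv_into V \<psi> z))"
          and f="\<lambda>y. \<psi> (F (inv_into U \<phi> y))"])
      show "smooth_on (\<psi> ` (V \<inter> ?N)) (\<lambda>z. \<omega> (G (inv_into V \<psi> z)))"
        using smooth_map_on_chart[OF G V(1) Z] by (simp add: Int_assoc)
      show "smooth_on ?T (\<lambda>y. \<psi> (F (inv_into U \<phi> y)))"
        by (rule smooth_on_subset[OF smooth_map_on_chart[OF F U V(1)]]) auto
      show "open (\<psi> ` (V \<inter> ?N))" using chart_open_image_Int[OF B V(1) oN] .
      show "(\<lambda>y. \<psi> (F (inv_into U \<phi> y))) ` ?T \<subseteq> \<psi> ` (V \<inter> ?N)"
        using chart_inv[OF A U] by auto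
    qed (rule oT)
    then have "smooth_on ?T (\<lambda>y. \<omega> (G (F (inv_into U \<phi> y))))"
      by (subst (asm) smooth_on_cong[OF oT, where g="\<lambda>y. \<omega> (G (F (inv_into U \<phi> y)))"])
        (use chart_inv[OF A U] chart_inv[OF B V(1)] in auto)
    moreover have "y \<in> ?T" using x V sub by auto
    ultimately show "\<exists>T. open T \<and> y \<in> T \<and> smooth_on T (\<lambda>y. \<omega> (G (F (inv_into U \<phi> y))))" using oT by blast
  qed
qed

lemma smooth_map_on_id:
  assumes A: "smooth_manifold A"
  shows "smooth_map_on A A W (\<lambda>x. x)"
proof (rule smooth_map_onI[OF continuous_on_id])
  show "smooth_on (\<phi> ` (U \<inter> W \<inter> (\<lambda>x. x) -` V)) (\<lambda>y. \<psi> (inv_into U \<phi> y))"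
    if "(U, \<phi>) \<in> A" "(V, \<psi>) \<in> A" for U \<phi> V \<psi>
    by (rule smooth_on_subset[OF chart_transition[OF A that]]) auto
qed

lemma smooth_map_on_const:
  assumes A: "smooth_manifold A"
  shows "smooth_map_on A B W (\<lambda>x. c)"
  by (rule smooth_map_onI) auto

lemma smooth_map_on_fst:
  assumes A: "smooth_manifold A" and B: "smooth_manifold B"
  shows "smooth_map_on (product_atlas A B) A W fst"
proof (rule smooth_map_on_subset[where W=UNIV])
  show "smooth_map_on (product_atlas A B) A UNIV fst"
  proof (rule smooth_map_onI[OF continuous_on_fst[OF continuous_on_id]])
    fix P \<Phi> U' \<psi> assume "(P, \<Phi>) \<in> product_atlas A B" and U': "(U', \<psi>) \<in> A"
    then obtain U \<phi> V \<phi>' where P: "P = U \<times> V" "\<Phi> = map_prod \<phi> \<phi>'" and U: "(U, \<phi>) \<in> A" and V: "(V, \<phi>') \<in> B"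
      by (auto simp: product_atlas_def)
    have im: "\<Phi> ` (P \<inter> UNIV \<inter> fst -` U') = \<phi> ` (U \<inter> U') \<times> \<phi>' ` V"
      using map_prod_image_Int[of \<phi> \<phi>' U V U' V]
      by (simp add: P vimage_fst Times_Int_Times)
    have op: "open (\<phi> ` (U \<inter> U'))" "open (\<phi> ` (U \<inter> U') \<times> \<phi>' ` V)"
      using chart_open_image_Int[OF A U chart_open[OF A U']] chart_open_image[OF B V] by (auto intro: open_Times)
    have "smooth_on (\<phi> ` (U \<inter> U') \<times> \<phi>' ` V) (\<lambda>w. \<psi> (inv_into U \<phi> (fst w)))"
      by (rule smooth_on_compose[OF chart_transition[OF A U U'] smooth_on_fst[OF op(2) smooth_on_id[OF op(2)]] op(2,1)]) auto
    then show "smooth_on (\<Phi> ` (P \<inter> UNIV \<inter> fst -` U')) (\<lambda>y. \<psi> (fst (inv_into P \<Phi> y)))"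
      unfolding im
      by (subst smooth_on_cong[OF op(2), where g="\<lambda>w. \<psi> (inv_into U \<phi> (fst w))"])
        (use chart_inj[OF A U] chart_inj[OF B V] in \<open>auto simp: P inv_into_map_prod\<close>)
  qed
qed auto

lemma smooth_map_on_snd:
  assumes A: "smooth_manifold A" and B: "smooth_manifold B"
  shows "smooth_map_on (product_atlas A B) B W snd"
proof (rule smooth_map_on_subset[where W=UNIV])
  show "smooth_map_on (product_atlas A B) B UNIV snd"
  proof (rule smooth_map_onI[OF continuous_on_snd[OF continuous_on_id]])
    fix P \<Phi> V' \<psi> assume "(P, \<Phi>) \<in> product_atlas A B" and V': "(V', \<psi>) \<in> B"
    then obtain U \<phi> V \<phi>' where P: "P = U \<times> V" "\<Phi> = map_prod \<phi> \<phi>'" and U: "(U, \<phi>) \<in> A" and V: "(V, \<phi>') \<in> B"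
      by (auto simp: product_atlas_def)
    have im: "\<Phi> ` (P \<inter> UNIV \<inter> snd -` V') = \<phi> ` U \<times> \<phi>' ` (V \<inter> V')"
      using map_prod_image_Int[of \<phi> \<phi>' U V U V']
      by (simp add: P vimage_snd Times_Int_Times)
    have op: "open (\<phi>' ` (V \<inter> V'))" "open (\<phi> ` U \<times> \<phi>' ` (V \<inter> V'))"
      using chart_open_image_Int[OF B V chart_open[OF B V']] chart_open_image[OF A U] by (auto intro: open_Times)
    have "smooth_on (\<phi> ` U \<times> \<phi>' ` (V \<inter> V')) (\<lambda>w. \<psi> (inv_into V \<phi>' (snd w)))"
      by (rule smooth_on_compose[OF chart_transition[OF B V V'] smooth_on_snd[OF op(2) smooth_on_id[OF op(2)]] op(2,1)]) auto
    then show "smooth_on (\<Phi> ` (P \<inter> UNIV \<inter> snd -` V')) (\<lambda>y. \<psi> (snd (inv_into P \<Phi> y)))"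
      unfolding im
      by (subst smooth_on_cong[OF op(2), where g="\<lambda>w. \<psi> (inv_into V \<phi>' (snd w))"])
        (use chart_inj[OF A U] chart_inj[OF B V] in \<open>auto simp: P inv_into_map_prod\<close>)
  qed
qed auto

lemma smooth_map_on_Pair:
  assumes A: "smooth_manifold A" and B: "smooth_manifold B" and C: "smooth_manifold C"
    and F: "smooth_map_on A B W F" and G: "smooth_map_on A C W G" and "open W"
  shows "smooth_map_on A (product_atlas B C) W (\<lambda>x. (F x, G x))"
proof (rule smooth_map_onI)
  show "continuous_on W (\<lambda>x. (F x, G x))"
    using F G by (intro continuous_on_Pair smooth_map_on_continuous)
  fix U \<phi> P \<Psi> assume U: "(U, \<phi>) \<in> A" and "(P, \<Psi>) \<in> product_atlas B C"
  then obtain V \<psi> V' \<psi>' where P: "P = V \<times> V'" "\<Psi> = map_prod \<psi> \<psi>'" and V: "(V, \<psi>) \<in> B" and V': "(V', \<psi>') \<in> C"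
    by (auto simp: product_atlas_def)
  let ?T = "\<phi> ` (U \<inter> W \<inter> (\<lambda>x. (F x, G x)) -` P)"
  have "open (W \<inter> F -` V)" "open (W \<inter> G -` V')"
    using continuous_open_preimage[OF smooth_map_on_continuous[OF F] \<open>open W\<close> chart_open[OF B V]]
      continuous_open_preimage[OF smooth_map_on_continuous[OF G] \<open>open W\<close> chart_open[OF C V']] by auto
  then have "open (\<phi> ` (U \<inter> ((W \<inter> F -` V) \<inter> (W \<inter> G -` V'))))"
    by (intro chart_open_image_Int[OF A U open_Int])
  moreover have "U \<inter> ((W \<inter> F -` V) \<inter> (W \<inter> G -` V')) = U \<inter> W \<inter> (\<lambda>x. (F x, G x)) -` P"
    by (auto simp: P)
  ultimately have oT: "open ?T" by simp
  have "smooth_on ?T (\<lambda>y. (\<psi> (F (inv_into U \<phi> y)), \<psi>' (G (inv_into U \<phi> y))))"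
    by (rule smooth_on_Pair[OF oT smooth_on_subset[OF smooth_map_on_chart[OF F U V]]
          smooth_on_subset[OF smooth_map_on_chart[OF G U V']]]) (auto simp: P)
  then show "smooth_on ?T (\<lambda>y. \<Psi> (F (inv_into U \<phi> y), G (inv_into U \<phi> y)))"
    by (simp add: P)
qed

section \<open>Maps into Euclidean spaces and the algebra of smooth functions\<close>

abbreviation smooth_euclidean_on ::
    "('m::topological_space, 'd::euclidean_space) atlas \<Rightarrow> 'm set \<Rightarrow> ('m \<Rightarrow> 'e::euclidean_space) \<Rightarrow> bool"
  where "smooth_euclidean_on A W f \<equiv> smooth_map_on A euclidean_atlas W f"

lemma smooth_euclidean_on_chart:
  assumes "smooth_euclidean_on A W f" "(U, \<phi>) \<in> A"
  shows "smooth_on (\<phi> ` (U \<inter> W)) (\<lambda>y. f (inv_into U \<phi> y))"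
  using smooth_map_on_chart[OF assms, of UNIV id] by (simp add: euclidean_atlas_def)

lemma smooth_euclidean_onI:
  assumes A: "smooth_manifold A" and "open W"
    and sm: "\<And>U \<phi>. (U, \<phi>) \<in> A \<Longrightarrow> smooth_on (\<phi> ` (U \<inter> W)) (\<lambda>y. f (inv_into U \<phi> y))"
  shows "smooth_euclidean_on A W f"
proof (rule smooth_map_onI)
  show "continuous_on W f"
  proof (rule continuous_at_imp_continuous_on, rule ballI)
    fix x assume x: "x \<in> W"
    obtain U \<phi> where U: "(U, \<phi>) \<in> A" "x \<in> U" using chart_exists[OF A] by blast
    have "continuous_on (U \<inter> W) (\<lambda>x. f (inv_into U \<phi> (\<phi> x)))"
      by (rule continuous_on_compose2[OF smooth_on_imp_continuous_on[OF sm[OF U(1)]]])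
        (use chart_continuous[OF A U(1)] in \<open>auto intro: continuous_on_subset\<close>)
    then have "continuous_on (U \<inter> W) f"
      by (rule continuous_on_eq) (use chart_inv[OF A U(1)] in auto)
    then show "isCont f x"
      using chart_open[OF A U(1)] U x \<open>open W\<close> by (simp add: continuous_on_eq_continuous_at open_Int)
  qed
qed (use sm in \<open>auto simp: euclidean_atlas_def\<close>)

lemma smooth_euclidean_on_compose:
  assumes A: "smooth_manifold A" and "open W" and f: "smooth_euclidean_on A W f"
    and g: "smooth_on T g" and "open T" "\<And>x. x \<in> W \<Longrightarrow> f x \<in> T"
  shows "smooth_euclidean_on A W (\<lambda>x. g (f x))"
proof (rule smooth_euclidean_onI[OF A assms(2)])
  fix U \<phi> assume U: "(U, \<phi>) \<in> A"
  show "smooth_on (\<phi> ` (U \<inter> W)) (\<lambda>y. g (f (inv_into U \<phi> y)))"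
    by (rule smooth_on_compose[OF g smooth_euclidean_on_chart[OF f U]])
      (use assms chart_open_image_Int[OF A U] chart_inv[OF A U] in auto)
qed

lemma smooth_euclidean_on_Pair:
  assumes A: "smooth_manifold A" and "open W" and f: "smooth_euclidean_on A W f" and g: "smooth_euclidean_on A W g"
  shows "smooth_euclidean_on A W (\<lambda>x. (f x, g x))"
proof (rule smooth_euclidean_onI[OF A assms(2)])
  fix U \<phi> assume U: "(U, \<phi>) \<in> A"
  show "smooth_on (\<phi> ` (U \<inter> W)) (\<lambda>y. (f (inv_into U \<phi> y), g (inv_into U \<phi> y)))"
    by (rule smooth_on_Pair[OF chart_open_image_Int[OF A U assms(2)]
          smooth_euclidean_on_chart[OF f U] smooth_euclidean_on_chart[OF g U]])
qed

lemma smooth_euclidean_on_bilinear: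
  assumes A: "smooth_manifold A" and "open W" and l: "bounded_bilinear l"
    and f: "smooth_euclidean_on A W f" and g: "smooth_euclidean_on A W g"
  shows "smooth_euclidean_on A W (\<lambda>x. l (f x) (g x))"
proof (rule smooth_euclidean_onI[OF A assms(2)])
  fix U \<phi> assume U: "(U, \<phi>) \<in> A"
  show "smooth_on (\<phi> ` (U \<inter> W)) (\<lambda>y. l (f (inv_into U \<phi> y)) (g (inv_into U \<phi> y)))"
    by (rule smooth_on_bounded_bilinear[OF l chart_open_image_Int[OF A U assms(2)]
          smooth_euclidean_on_chart[OF f U] smooth_euclidean_on_chart[OF g U]])
qed

lemma smooth_euclidean_on_add:
  assumes A: "smooth_manifold A" and "open W" and f: "smooth_euclidean_on A W f" and g: "smooth_euclidean_on A W g"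
  shows "smooth_euclidean_on A W (\<lambda>x. f x + g x)"
proof (rule smooth_euclidean_onI[OF A assms(2)])
  fix U \<phi> assume U: "(U, \<phi>) \<in> A"
  show "smooth_on (\<phi> ` (U \<inter> W)) (\<lambda>y. f (inv_into U \<phi> y) + g (inv_into U \<phi> y))"
    by (rule smooth_on_add[OF chart_open_image_Int[OF A U assms(2)]
          smooth_euclidean_on_chart[OF f U] smooth_euclidean_on_chart[OF g U]])
qed

lemmas smooth_euclidean_on_mult = smooth_euclidean_on_bilinear[OF _ _ bounded_bilinear_mult]
lemmas smooth_euclidean_on_scaleR = smooth_euclidean_on_bilinear[OF _ _ bounded_bilinear_scaleR]

lemma smooth_euclidean_on_sum:
  assumes A: "smooth_manifold A" and "open W" and "\<And>i. i \<in> I \<Longrightarrow> smooth_euclidean_on A W (f i)"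
  shows "smooth_euclidean_on A W (\<lambda>x. \<Sum>i\<in>I. f i x)"
proof (cases "finite I")
  case True
  then show ?thesis using assms(3)
    by (induction I) (auto intro: smooth_map_on_const[OF A] smooth_euclidean_on_add[OF A assms(2)])
qed (auto intro: smooth_map_on_const[OF A])

lemma smooth_functions_iff: "f \<in> smooth_functions A \<longleftrightarrow> smooth_euclidean_on A UNIV f"
  by (simp add: smooth_functions_def)

lemma smooth_functions_const [simp]: "smooth_manifold A \<Longrightarrow> (\<lambda>x. c) \<in> smooth_functions A"
  by (simp add: smooth_functions_iff smooth_map_on_const)

lemma smooth_functions_add:
  "smooth_manifold A \<Longrightarrow> f \<in> smooth_functions A \<Longrightarrow> g \<in> smooth_functions A \<Longrightarrow> (\<lambda>x. f x + g x) \<in> smooth_functions A"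
  by (simp add: smooth_functions_iff smooth_euclidean_on_add)

lemma smooth_functions_mult:
  "smooth_manifold A \<Longrightarrow> f \<in> smooth_functions A \<Longrightarrow> g \<in> smooth_functions A \<Longrightarrow> (\<lambda>x. f x * g x) \<in> smooth_functions A"
  by (simp add: smooth_functions_iff smooth_euclidean_on_mult)

lemma smooth_functions_uminus:
  "smooth_manifold A \<Longrightarrow> f \<in> smooth_functions A \<Longrightarrow> (\<lambda>x. - f x) \<in> smooth_functions A"
  using smooth_functions_mult[of A "\<lambda>x. - 1" f] by simp

lemma smooth_functions_diff:
  "smooth_manifold A \<Longrightarrow> f \<in> smooth_functions A \<Longrightarrow> g \<in> smooth_functions A \<Longrightarrow> (\<lambda>x. f x - g x) \<in> smooth_functions A"
  using smooth_functions_add[of A f "\<lambda>x. - g x"] smooth_functions_uminus[of A g] by simp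

lemma smooth_functions_sum:
  "smooth_manifold A \<Longrightarrow> (\<And>i. i \<in> I \<Longrightarrow> f i \<in> smooth_functions A) \<Longrightarrow> (\<lambda>x. \<Sum>i\<in>I. f i x) \<in> smooth_functions A"
  by (simp add: smooth_functions_iff smooth_euclidean_on_sum)

lemma smooth_functions_power:
  "smooth_manifold A \<Longrightarrow> f \<in> smooth_functions A \<Longrightarrow> (\<lambda>x. (f x) ^ n) \<in> smooth_functions A"
  by (induction n) (auto intro: smooth_functions_mult)

lemma smooth_functions_prod:
  "smooth_manifold A \<Longrightarrow> (\<And>i. i \<in> I \<Longrightarrow> f i \<in> smooth_functions A) \<Longrightarrow> (\<lambda>x. \<Prod>i\<in>I. f i x) \<in> smooth_functions A"
  by (induction I rule: infinite_finite_induct) (auto intro: smooth_functions_mult)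

lemma smooth_functions_compose:
  assumes "smooth_manifold A" "f \<in> smooth_functions A" "smooth_on T g" "open T" "\<And>x. f x \<in> T"
  shows "(\<lambda>x. g (f x)) \<in> smooth_functions A"
  using smooth_euclidean_on_compose[OF assms(1) open_UNIV _ assms(3,4)] assms by (simp add: smooth_functions_iff)

lemma smooth_functions_flat:
  "smooth_manifold A \<Longrightarrow> f \<in> smooth_functions A \<Longrightarrow> (\<lambda>x. flat (f x)) \<in> smooth_functions A"
  by (rule smooth_functions_compose[OF _ _ smooth_flat]) auto

lemma smooth_functions_inverse:
  assumes "smooth_manifold A" "f \<in> smooth_functions A" "\<And>x. f x \<noteq> 0"
  shows "(\<lambda>x. inverse (f x)) \<in> smooth_functions A"
  by (rule smooth_functions_compose[OF assms(1,2), of "- {0}"])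
    (use assms(3) in \<open>auto simp: smooth_on_def C_k_on_inverse\<close>)

lemma smooth_functions_continuous: "f \<in> smooth_functions A \<Longrightarrow> continuous_on UNIV f"
  by (simp add: smooth_functions_iff smooth_map_on_continuous)

lemma smooth_functions_pullback:
  assumes "smooth_manifold A" "smooth_manifold B" "smooth_map A B F" "f \<in> smooth_functions B"
  shows "(\<lambda>x. f (F x)) \<in> smooth_functions A"
  using assms smooth_map_on_compose[OF assms(1,2) smooth_manifold_euclidean, of UNIV f UNIV F]
  by (simp add: smooth_functions_iff)

lemma smooth_functions_local:
  assumes A: "smooth_manifold A"
    and loc: "\<And>x. \<exists>T g. open T \<and> x \<in> T \<and> g \<in> smooth_functions A \<and> (\<forall>y\<in>T. f y = g y)"
  shows "f \<in> smooth_functions A"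
  unfolding smooth_functions_iff
proof (rule smooth_map_on_local[OF A smooth_manifold_euclidean])
  fix x
  obtain T g where T: "open T" "x \<in> T" "g \<in> smooth_functions A" "\<And>y. y \<in> T \<Longrightarrow> f y = g y" using loc by metis
  have "smooth_euclidean_on A T f"
    by (rule smooth_map_on_cong[OF A smooth_manifold_euclidean smooth_map_on_subset])
      (use T in \<open>auto simp: smooth_functions_iff\<close>)
  then show "\<exists>T. open T \<and> x \<in> T \<and> smooth_euclidean_on A T f" using T by blast
qed

text \<open>The product is smooth on \<open>W\<close>, and it is zero on the complement of
  \<open>K\<close>, which is open because \<open>K\<close> is closed in the whole manifold. The two
  sets cover, whatever the values of \<open>f\<close> off \<open>W\<close>.\<close>

lemma smooth_functions_extend:
  assumes A: "smooth_manifold A" and "\<beta> \<in> smooth_functions A" and f: "smooth_euclidean_on A W f"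
    and "open W" "closed K" "K \<subseteq> W" and zero: "\<And>x. x \<notin> K \<Longrightarrow> \<beta> x = 0"
  shows "(\<lambda>x. \<beta> x * f x) \<in> smooth_functions A"
  unfolding smooth_functions_iff
proof (rule smooth_map_on_local[OF A smooth_manifold_euclidean])
  fix x
  have "smooth_euclidean_on A W (\<lambda>x. \<beta> x * f x)"
    using assms smooth_map_on_subset[of A _ UNIV \<beta> W]
    by (intro smooth_euclidean_on_mult[OF A]) (auto simp: smooth_functions_iff)
  moreover have "smooth_euclidean_on A (- K) (\<lambda>x. \<beta> x * f x)"
    by (rule smooth_map_on_cong[OF A smooth_manifold_euclidean smooth_map_on_const[OF A, of _ _ 0]])
      (use assms in auto)
  moreover have "x \<in> W \<or> x \<in> - K" using assms by auto
  ultimately show "\<exists>T. open T \<and> x \<in> T \<and> smooth_euclidean_on A T (\<lambda>x. \<beta> x * f x)"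
    using assms open_Compl by blast
qed

section \<open>Tangent vectors in charts\<close>

text \<open>Coordinates around \<open>p\<close> with room to cut off: the bump is supported in the
  closed ball of radius \<open>e\<close>, while functions on \<open>W\<close> can be read in the
  ball of radius \<open>2 * e\<close>.\<close>

locale chart_ball =
  fixes A :: "('n::{t2_space,second_countable_topology}, 'a::euclidean_space) atlas" and p :: 'n and W :: "'n set"
    and U :: "'n set" and \<phi> :: "'n \<Rightarrow> 'a" and e :: real
  assumes A: "smooth_manifold A" and U: "(U, \<phi>) \<in> A" and pU: "p \<in> U" and W: "open W"
    and e: "e > 0" and ball: "ball (\<phi> p) (2 * e) \<subseteq> \<phi> ` (U \<inter> W)"
begin

text \<open>Equal to 1 at \<open>p\<close>, but on no neighbourhood of \<open>p\<close>. Global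
  identities therefore carry powers of \<open>bump\<close>; derivations at \<open>p\<close> ignore
  them on functions that vanish at \<open>p\<close>.\<close>

definition bump :: "'n \<Rightarrow> real"
  where "bump x = (if x \<in> U then flat (e\<^sup>2 - (norm (\<phi> x - \<phi> p))\<^sup>2) / flat (e\<^sup>2) else 0)"

definition bump_support :: "'n set"
  where "bump_support = inv_into U \<phi> ` cball (\<phi> p) e"

definition coord :: "'a \<Rightarrow> 'n \<Rightarrow> real"
  where "coord b x = bump x * ((\<phi> x - \<phi> p) \<bullet> b)"

definition partial :: "'a \<Rightarrow> ('n \<Rightarrow> real) \<Rightarrow> real"
  where "partial b f = (if f \<in> smooth_functions A then frechet_derivative (\<lambda>y. f (inv_into U \<phi> y)) (at (\<phi> p)) b else 0)"

text \<open>Hadamard's coefficient of \<open>F\<close> in the first variable, cut off so as to be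
  defined on the whole product; the second variable is a parameter in another manifold.\<close>

definition quotient :: "('n \<times> 'q \<Rightarrow> real) \<Rightarrow> 'a \<Rightarrow> 'n \<times> 'q \<Rightarrow> real"
  where "quotient F b w = bump (fst w) * hadamard_quotient (\<lambda>y. F (inv_into U \<phi> y, snd w)) (\<phi> p) (\<phi> (fst w)) b"

lemma smooth_chart: "smooth_euclidean_on A U \<phi>"
proof (rule smooth_euclidean_onI[OF A chart_open[OF A U]])
  show "smooth_on (\<psi> ` (V \<inter> U)) (\<lambda>y. \<phi> (inv_into V \<psi> y))" if "(V, \<psi>) \<in> A" for V \<psi>
    by (rule chart_transition[OF A that U])
qed

text \<open>The support is the image of a compact ball, hence compact, and closed in the whole
  manifold because that is Hausdorff. Closedness in \<open>U\<close> alone would not allow extension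
  by zero.\<close>

lemma closed_bump_support: "closed bump_support"
  and bump_support_subset: "bump_support \<subseteq> U \<inter> W \<inter> \<phi> -` ball (\<phi> p) (2 * e)"
  and bump_eq_0: "x \<notin> bump_support \<Longrightarrow> bump x = 0"
proof -
  have sub: "cball (\<phi> p) e \<subseteq> ball (\<phi> p) (2 * e)" using e by auto
  then have sub': "cball (\<phi> p) e \<subseteq> \<phi> ` (U \<inter> W)" using ball by (rule order_trans)
  have "continuous_on (\<phi> ` U) (inv_into U \<phi>)" using chart_homeomorphism[OF A U] by (simp add: homeomorphism_def)
  then have "continuous_on (cball (\<phi> p) e) (inv_into U \<phi>)" by (rule continuous_on_subset) (use sub' in auto)
  then have "compact bump_support" unfolding bump_support_def by (rule compact_continuous_image) simp
  then show "closed bump_support" by (rule compact_imp_closed)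
  show "bump_support \<subseteq> U \<inter> W \<inter> \<phi> -` ball (\<phi> p) (2 * e)"
  proof
    fix x assume "x \<in> bump_support"
    then obtain y where y: "y \<in> cball (\<phi> p) e" "x = inv_into U \<phi> y" by (auto simp: bump_support_def)
    then obtain z where z: "z \<in> U" "z \<in> W" "y = \<phi> z" using sub' by auto
    then have "x = z" using y chart_inv[OF A U] by simp
    then show "x \<in> U \<inter> W \<inter> \<phi> -` ball (\<phi> p) (2 * e)" using z y sub by auto
  qed
  show "bump x = 0" if "x \<notin> bump_support"
  proof (rule ccontr)
    assume "bump x \<noteq> 0"
    then have x: "x \<in> U" "e\<^sup>2 - (norm (\<phi> x - \<phi> p))\<^sup>2 > 0"
      by (auto simp: bump_def flat_eq_0_iff split: if_splits)
    then have "norm (\<phi> x - \<phi> p) < e" using e by (simp add: power2_less_imp_less)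
    then have "\<phi> x \<in> cball (\<phi> p) e" by (simp add: dist_norm norm_minus_commute)
    then have "inv_into U \<phi> (\<phi> x) \<in> bump_support" by (simp add: bump_support_def)
    then show False using that x chart_inv[OF A U] by simp
  qed
qed

lemma bump_p: "bump p = 1"
proof -
  have "flat (e\<^sup>2) \<noteq> 0" using e by (simp add: flat_eq_0_iff)
  then show ?thesis using pU by (simp add: bump_def)
qed

lemma smooth_norm_sq: "smooth_on UNIV (\<lambda>y::'a. e\<^sup>2 - (norm (y - \<phi> p))\<^sup>2)"
proof -
  have 1: "smooth_on UNIV (\<lambda>y::'a. y - \<phi> p)" by (intro smooth_on_diff smooth_on_id smooth_on_const) auto
  have "smooth_on UNIV (\<lambda>y::'a. e\<^sup>2 - (y - \<phi> p) \<bullet> (y - \<phi> p))"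
    by (rule smooth_on_diff[OF open_UNIV smooth_on_const smooth_on_inner[OF open_UNIV 1 1]])
  then show ?thesis by (simp add: power2_norm_eq_inner)
qed

lemma bump_smooth: "bump \<in> smooth_functions A"
  unfolding smooth_functions_iff
proof (rule smooth_map_on_local[OF A smooth_manifold_euclidean])
  fix x
  have sm: "smooth_on UNIV (\<lambda>y::'a. flat (e\<^sup>2 - (norm (y - \<phi> p))\<^sup>2) * inverse (flat (e\<^sup>2)))"
    by (rule smooth_on_mult[OF open_UNIV smooth_on_flat[OF open_UNIV smooth_norm_sq] smooth_on_const])
  have "smooth_euclidean_on A U (\<lambda>x. flat (e\<^sup>2 - (norm (\<phi> x - \<phi> p))\<^sup>2) * inverse (flat (e\<^sup>2)))"
    by (rule smooth_euclidean_on_compose[OF A chart_open[OF A U] smooth_chart sm]) auto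
  then have 1: "smooth_euclidean_on A U bump"
    by (rule smooth_map_on_cong[OF A smooth_manifold_euclidean _ chart_open[OF A U]])
      (simp add: bump_def divide_inverse)
  have 2: "smooth_euclidean_on A (- bump_support) bump"
    by (rule smooth_map_on_cong[OF A smooth_manifold_euclidean smooth_map_on_const[OF A, of _ _ 0]])
      (use closed_bump_support bump_eq_0 in auto)
  have "x \<in> U \<or> x \<in> - bump_support" using bump_support_subset by auto
  then show "\<exists>T. open T \<and> x \<in> T \<and> smooth_euclidean_on A T bump"
    using 1 2 chart_open[OF A U] closed_bump_support open_Compl by metis
qed

lemma coord_smooth: "coord b \<in> smooth_functions A"
  unfolding coord_def
proof (rule smooth_functions_extend[OF A bump_smooth _ chart_open[OF A U] closed_bump_support])
  have "smooth_on UNIV (\<lambda>y::'a. (y - \<phi> p) \<bullet> b)"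
    by (intro smooth_on_inner_left smooth_on_diff smooth_on_id smooth_on_const) auto
  then show "smooth_euclidean_on A U (\<lambda>x. (\<phi> x - \<phi> p) \<bullet> b)"
    by (rule smooth_euclidean_on_compose[OF A chart_open[OF A U] smooth_chart]) auto
qed (use bump_support_subset bump_eq_0 in auto)

lemma coord_p: "coord b p = 0"
  by (simp add: coord_def)

lemma smooth_in_charts:
  fixes F :: "'n \<times> 'q::{t2_space,second_countable_topology} \<Rightarrow> real" and B :: "('q, 'b::euclidean_space) atlas"
  assumes B: "smooth_manifold B" and F: "smooth_euclidean_on (product_atlas A B) (W \<times> UNIV) F" and V: "(V, \<psi>) \<in> B"
  shows "smooth_on (ball (\<phi> p) (2 * e) \<times> \<psi> ` V) (\<lambda>w. F (inv_into U \<phi> (fst w), inv_into V \<psi> (snd w)))"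
proof -
  have UV: "(U \<times> V, map_prod \<phi> \<psi>) \<in> product_atlas A B" using U V by (auto simp: product_atlas_def)
  have im: "map_prod \<phi> \<psi> ` ((U \<times> V) \<inter> (W \<times> UNIV)) = \<phi> ` (U \<inter> W) \<times> \<psi> ` V"
    using map_prod_image_Int[of \<phi> \<psi> U V W UNIV] by simp
  have "open (ball (\<phi> p) (2 * e) \<times> \<psi> ` V)" (is "open ?S")
    using chart_open_image[OF B V] by (simp add: open_Times)
  moreover have "smooth_on ?S (\<lambda>y. F (inv_into (U \<times> V) (map_prod \<phi> \<psi>) y))"
    by (rule smooth_on_subset[OF smooth_euclidean_on_chart[OF F UV]]) (use ball in \<open>auto simp: im\<close>)
  moreover have "F (inv_into (U \<times> V) (map_prod \<phi> \<psi>) w) = F (inv_into U \<phi> (fst w), inv_into V \<psi> (snd w))"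
    if "w \<in> ?S" for w
    using that ball inv_into_map_prod[OF chart_inj[OF A U] chart_inj[OF B V], of "fst w" "snd w"] by force
  ultimately show ?thesis
    using smooth_on_cong[of ?S "\<lambda>y. F (inv_into (U \<times> V) (map_prod \<phi> \<psi>) y)"
        "\<lambda>w. F (inv_into U \<phi> (fst w), inv_into V \<psi> (snd w))"] by blast
qed

text \<open>A chart \<open>\<psi>\<close> of the parameter manifold serves to quote the Euclidean
  statement; the function itself does not depend on it, so the local statements glue. The factor
  \<open>bump\<close> extends the result beyond the chart ball.\<close>

lemma quotient_smooth:
  fixes F :: "'n \<times> 'q::{t2_space,second_countable_topology} \<Rightarrow> real" and B :: "('q, 'b::euclidean_space) atlas"
  assumes B: "smooth_manifold B" and F: "smooth_euclidean_on (product_atlas A B) (W \<times> UNIV) F"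
  shows "quotient F b \<in> smooth_functions (product_atlas A B)"
proof -
  note AB = smooth_manifold_product[OF A B]
  let ?N = "U \<inter> \<phi> -` ball (\<phi> p) (2 * e)"
  have oN: "open ?N"
    using continuous_open_preimage[OF chart_continuous[OF A U] chart_open[OF A U] open_ball] .
  let ?h = "\<lambda>w. hadamard_quotient (\<lambda>y. F (inv_into U \<phi> y, snd w)) (\<phi> p) (\<phi> (fst w)) b"
  have 1: "smooth_euclidean_on (product_atlas A B) (?N \<times> UNIV) ?h"
  proof (rule smooth_map_on_local[OF AB smooth_manifold_euclidean])
    fix w assume w: "w \<in> ?N \<times> (UNIV :: 'q set)"
    obtain V \<psi> where V: "(V, \<psi>) \<in> B" "snd w \<in> V" using chart_exists[OF B] .
    let ?S = "ball (\<phi> p) (2 * e) \<times> \<psi> ` V"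
    have oNV: "open (?N \<times> V)" using oN chart_open[OF B V(1)] by (rule open_Times)
    have oS: "open ?S" using chart_open_image[OF B V(1)] by (simp add: open_Times)
    have sm: "smooth_on ?S (\<lambda>w. hadamard_quotient (\<lambda>y. F (inv_into U \<phi> y, inv_into V \<psi> (snd w))) (\<phi> p) (fst w) b)"
      using smooth_on_hadamard_quotient[OF smooth_in_charts[OF B F V(1)] chart_open_image[OF B V(1)]] by simp
    have "smooth_euclidean_on (product_atlas A B) (?N \<times> V) (\<lambda>w. (\<phi> (fst w), \<psi> (snd w)))"
    proof (rule smooth_euclidean_on_Pair[OF AB oNV])
      show "smooth_euclidean_on (product_atlas A B) (?N \<times> V) (\<lambda>w. \<phi> (fst w))"
        by (rule smooth_map_on_compose[OF AB A smooth_manifold_euclidean smooth_chart smooth_map_on_fst[OF A B] oNV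
              chart_open[OF A U]]) auto
      have "smooth_euclidean_on B V \<psi>"
        by (rule smooth_euclidean_onI[OF B chart_open[OF B V(1)]]) (rule chart_transition[OF B _ V(1)])
      then show "smooth_euclidean_on (product_atlas A B) (?N \<times> V) (\<lambda>w. \<psi> (snd w))"
        by (rule smooth_map_on_compose[OF AB B smooth_manifold_euclidean _ smooth_map_on_snd[OF A B] oNV
              chart_open[OF B V(1)]]) auto
    qed
    from smooth_euclidean_on_compose[OF AB oNV this sm oS]
    have "smooth_euclidean_on (product_atlas A B) (?N \<times> V)
        (\<lambda>w. hadamard_quotient (\<lambda>y. F (inv_into U \<phi> y, inv_into V \<psi> (\<psi> (snd w)))) (\<phi> p) (\<phi> (fst w)) b)"
      by auto
    then have "smooth_euclidean_on (product_atlas A B) (?N \<times> V) ?h"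
      by (rule smooth_map_on_cong[OF AB smooth_manifold_euclidean _ oNV]) (use chart_inv[OF B V(1)] in auto)
    then show "\<exists>T. open T \<and> w \<in> T \<and> smooth_euclidean_on (product_atlas A B) T ?h"
      using oNV w V by (intro exI[of _ "?N \<times> V"]) (auto simp: mem_Times_iff)
  qed
  have "(\<lambda>w. bump (fst w) * ?h w) \<in> smooth_functions (product_atlas A B)"
  proof (rule smooth_functions_extend[OF AB _ 1])
    show "(\<lambda>w. bump (fst w)) \<in> smooth_functions (product_atlas A B)"
      by (rule smooth_functions_pullback[OF AB A smooth_map_on_fst[OF A B] bump_smooth])
    show "open (?N \<times> (UNIV :: 'q set))" using oN by (simp add: open_Times)
    show "closed (bump_support \<times> (UNIV :: 'q set))" using closed_bump_support by (simp add: closed_Times)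
    show "bump (fst w) = 0" if "w \<notin> bump_support \<times> (UNIV :: 'q set)" for w
      using that bump_eq_0[of "fst w"] by (simp add: mem_Times_iff)
  qed (use bump_support_subset in auto)
  then show ?thesis by (simp add: quotient_def[abs_def])
qed

text \<open>One factor \<open>bump\<close> belongs to \<open>coord\<close> and one to
  \<open>quotient\<close>, whence the square. Off the support both sides vanish, so the expansion
  holds globally.\<close>

lemma quotient_expansion:
  fixes F :: "'n \<times> 'q::{t2_space,second_countable_topology} \<Rightarrow> real" and B :: "('q, 'b::euclidean_space) atlas"
  assumes B: "smooth_manifold B" and F: "smooth_euclidean_on (product_atlas A B) (W \<times> UNIV) F"
  shows "(bump x)\<^sup>2 * (F (x, q) - F (p, q)) = (\<Sum>b\<in>Basis. coord b x * quotient F b (x, q))"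
proof (cases "x \<in> bump_support")
  case True
  then have x: "x \<in> U" "\<phi> x \<in> ball (\<phi> p) (2 * e)" using bump_support_subset by auto
  obtain V \<psi> where V: "(V, \<psi>) \<in> B" "q \<in> V" using chart_exists[OF B] .
  have "F (x, q) - F (p, q) =
      (\<Sum>b\<in>Basis. ((\<phi> x - \<phi> p) \<bullet> b) * hadamard_quotient (\<lambda>y. F (inv_into U \<phi> y, q)) (\<phi> p) (\<phi> x) b)"
    using hadamard_expansion[OF smooth_in_charts[OF B F V(1)] chart_open_image[OF B V(1)] x(2), of "\<psi> q"]
      V x chart_inv[OF A U] pU chart_inv[OF B V(1)] by simp
  then show ?thesis
    by (simp add: sum_distrib_left quotient_def coord_def power2_eq_square mult_ac)
next
  case False
  then show ?thesis by (simp add: bump_eq_0 coord_def)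
qed

lemma quotient_p:
  "(\<lambda>x. F (x, q)) \<in> smooth_functions A \<Longrightarrow> quotient F b (p, q) = partial b (\<lambda>x. F (x, q))"
  by (simp add: quotient_def bump_p hadamard_quotient_center partial_def)

end

lemma chart_ball_exists:
  assumes A: "smooth_manifold A" and "open W" "p \<in> W"
  obtains U \<phi> e where "chart_ball A p W U \<phi> e"
proof -
  obtain U \<phi> where U: "(U, \<phi>) \<in> A" "p \<in> U" using chart_exists[OF A] .
  have "open (\<phi> ` (U \<inter> W))" by (rule chart_open_image_Int[OF A U(1) assms(2)])
  then obtain d where "d > 0" "ball (\<phi> p) d \<subseteq> \<phi> ` (U \<inter> W)"
    using U assms(3) openE[of "\<phi> ` (U \<inter> W)" "\<phi> p"] by blast
  then have "chart_ball A p W U \<phi> (d / 2)"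
    using A U assms(2) by unfold_locales auto
  then show ?thesis using that by blast
qed

section \<open>Derivations at a point\<close>

lemma tangent_spaceD:
  assumes "v \<in> tangent_space A p"
  shows tangent_outside: "f \<notin> smooth_functions A \<Longrightarrow> v f = 0"
    and tangent_add: "f \<in> smooth_functions A \<Longrightarrow> g \<in> smooth_functions A \<Longrightarrow> v (\<lambda>x. f x + g x) = v f + v g"
    and tangent_cmult: "f \<in> smooth_functions A \<Longrightarrow> v (\<lambda>x. c * f x) = c * v f"
    and tangent_mult: "f \<in> smooth_functions A \<Longrightarrow> g \<in> smooth_functions A \<Longrightarrow>
      v (\<lambda>x. f x * g x) = v f * g p + f p * v g"
  using assms unfolding tangent_space_def by auto

lemma tangent_spaceI:
  assumes "\<And>f. f \<notin> smooth_functions A \<Longrightarrow> v f = 0"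
    "\<And>f g. f \<in> smooth_functions A \<Longrightarrow> g \<in> smooth_functions A \<Longrightarrow> v (\<lambda>x. f x + g x) = v f + v g"
    "\<And>c f. f \<in> smooth_functions A \<Longrightarrow> v (\<lambda>x. c * f x) = c * v f"
    "\<And>f g. f \<in> smooth_functions A \<Longrightarrow> g \<in> smooth_functions A \<Longrightarrow> v (\<lambda>x. f x * g x) = v f * g p + f p * v g"
  shows "v \<in> tangent_space A p"
  using assms unfolding tangent_space_def by auto

text \<open>The product rule for 1 * 1 gives v 1 = 2 * v 1.\<close>

lemma tangent_const:
  assumes A: "smooth_manifold A" and v: "v \<in> tangent_space A p"
  shows "v (\<lambda>x. c) = 0"
  using tangent_mult[OF v, of "\<lambda>x. 1" "\<lambda>x. 1"] tangent_cmult[OF v, of "\<lambda>x. 1" c] A by simp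

lemma tangent_zero: "v \<in> tangent_space A p \<Longrightarrow> smooth_manifold A \<Longrightarrow> v (\<lambda>x. 0) = 0"
  by (rule tangent_const)

lemma tangent_diff:
  assumes A: "smooth_manifold A" and v: "v \<in> tangent_space A p"
    and f: "f \<in> smooth_functions A" and g: "g \<in> smooth_functions A"
  shows "v (\<lambda>x. f x - g x) = v f - v g"
  using tangent_add[OF v f smooth_functions_uminus[OF A g]] tangent_cmult[OF v g, of "- 1"] by simp

lemma tangent_sum:
  assumes A: "smooth_manifold A" and v: "v \<in> tangent_space A p"
    and f: "\<And>i. i \<in> I \<Longrightarrow> f i \<in> smooth_functions A"
  shows "v (\<lambda>x. \<Sum>i\<in>I. f i x) = (\<Sum>i\<in>I. v (f i))"
  using f
proof (induction I rule: infinite_finite_induct)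
  case (insert i I)
  then have "v (\<lambda>x. f i x + (\<Sum>i\<in>I. f i x)) = v (f i) + v (\<lambda>x. \<Sum>i\<in>I. f i x)"
    by (intro tangent_add[OF v] smooth_functions_sum[OF A]) auto
  then show ?case using insert by simp
qed (auto simp: tangent_zero[OF v A])

lemma subspace_tangent_space: "subspace (tangent_space A p)"
proof (rule subspaceI)
  fix v w c assume v: "v \<in> tangent_space A p" and w: "w \<in> tangent_space A p"
  show "v + w \<in> tangent_space A p"
    by (rule tangent_spaceI)
      (simp_all add: tangent_spaceD[OF v] tangent_spaceD[OF w] algebra_simps)
  show "c *\<^sub>R v \<in> tangent_space A p"
    by (rule tangent_spaceI)
      (simp_all add: scaleR_fun_def tangent_spaceD[OF v] algebra_simps)
next
  show "0 \<in> tangent_space A p" by (rule tangent_spaceI) simp_all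
qed

lemma tangent_vanishing_mult:
  assumes v: "v \<in> tangent_space A p" and "f \<in> smooth_functions A" "g \<in> smooth_functions A" "f p = 0"
  shows "v (\<lambda>x. f x * g x) = v f * g p"
  using tangent_mult[OF assms(1-3)] assms(4) by simp

context chart_ball
begin

lemma partial_tangent: "partial b \<in> tangent_space A p"
proof -
  have d: "((\<lambda>y. f (inv_into U \<phi> y)) has_derivative frechet_derivative (\<lambda>y. f (inv_into U \<phi> y)) (at (\<phi> p))) (at (\<phi> p))"
    if "f \<in> smooth_functions A" for f
    by (rule smooth_on_has_derivative[OF smooth_euclidean_on_chart[OF that[unfolded smooth_functions_iff] U]])
      (use pU in simp)
  note inv = chart_inv[OF A U pU]
  show ?thesis
  proof (rule tangent_spaceI)
    fix f g assume f: "f \<in> smooth_functions A" and g: "g \<in> smooth_functions A"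
    show "partial b (\<lambda>x. f x + g x) = partial b f + partial b g"
      using has_derivative_eq_frechet[OF has_derivative_add[OF d[OF f] d[OF g]]] f g smooth_functions_add[OF A f g]
      by (simp add: partial_def)
    show "partial b (\<lambda>x. f x * g x) = partial b f * g p + f p * partial b g"
      using has_derivative_eq_frechet[OF has_derivative_mult[OF d[OF f] d[OF g]]] f g smooth_functions_mult[OF A f g] inv
      by (simp add: partial_def)
    show "partial b (\<lambda>x. c * f x) = c * partial b f" for c
      using has_derivative_eq_frechet[OF has_derivative_mult_right[OF d[OF f]]] f
        smooth_functions_mult[OF A smooth_functions_const[OF A] f]
      by (simp add: partial_def)
  qed (simp add: partial_def)
qed

lemma tangent_bump_sq:
  assumes v: "v \<in> tangent_space A p" and f: "f \<in> smooth_functions A" "f p = 0"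
  shows "v (\<lambda>x. (bump x)\<^sup>2 * f x) = v f"
  using tangent_mult[OF v smooth_functions_power[OF A bump_smooth, of 2] f(1)] f(2) bump_p by simp

text \<open>By Hadamard, \<open>f - f p\<close> times the squared bump is a sum of products with
  factors \<open>coord b\<close>, which vanish at \<open>p\<close>. The product rule then keeps only
  \<open>v (coord b)\<close> times the value of the coefficient at \<open>p\<close>, a partial
  derivative.\<close>

lemma tangent_partial:
  assumes v: "v \<in> tangent_space A p" and f: "f \<in> smooth_functions A" and WU: "W = UNIV"
  shows "v f = (\<Sum>b\<in>Basis. v (coord b) * partial b f)"
proof -
  \<comment> \<open>The Hadamard coefficients are set up for functions with a parameter; here the
    parameter runs over the manifold itself and \<open>?F\<close> is constant in it.\<close>
  let ?F = "\<lambda>w :: 'n \<times> 'n. f (fst w)"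
  have F: "smooth_euclidean_on (product_atlas A A) (W \<times> UNIV) ?F"
    using smooth_functions_pullback[OF smooth_manifold_product[OF A A] A smooth_map_on_fst[OF A A] f]
    by (simp add: smooth_functions_iff WU)
  have q: "(\<lambda>x. quotient ?F b (x, p)) \<in> smooth_functions A" for b
    by (rule smooth_functions_pullback[OF A smooth_manifold_product[OF A A] _ quotient_smooth[OF A F]])
      (intro smooth_map_on_Pair A smooth_map_on_id smooth_map_on_const open_UNIV)
  have fp: "(\<lambda>x. f x - f p) \<in> smooth_functions A" by (rule smooth_functions_diff[OF A f smooth_functions_const[OF A]])
  have "v f = v (\<lambda>x. f x - f p)"
    using tangent_diff[OF A v f smooth_functions_const[OF A]] tangent_const[OF A v] by simp
  also have "\<dots> = v (\<lambda>x. (bump x)\<^sup>2 * (f x - f p))" using tangent_bump_sq[OF v fp] by simp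
  also have "\<dots> = v (\<lambda>x. \<Sum>b\<in>Basis. coord b x * quotient ?F b (x, p))"
    using quotient_expansion[OF A F, of _ p] by simp
  also have "\<dots> = (\<Sum>b\<in>Basis. v (\<lambda>x. coord b x * quotient ?F b (x, p)))"
    by (rule tangent_sum[OF A v smooth_functions_mult[OF A coord_smooth q]])
  also have "\<dots> = (\<Sum>b\<in>Basis. v (coord b) * partial b f)"
    using tangent_vanishing_mult[OF v coord_smooth q coord_p] quotient_p[of ?F p] f by simp
  finally show ?thesis .
qed

end

section \<open>Differentials and derivations with parameters\<close>

lemma tangent_map_smooth: "f \<in> smooth_functions B \<Longrightarrow> tangent_map B F v f = v (\<lambda>x. f (F x))"
  by (simp add: tangent_map_def comp_def)

lemma tangent_map_nonsmooth: "f \<notin> smooth_functions B \<Longrightarrow> tangent_map B F v f = 0"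
  by (simp add: tangent_map_def)

lemma tangent_map_in_tangent_space:
  assumes A: "smooth_manifold A" and B: "smooth_manifold B" and F: "smooth_map A B F" and v: "v \<in> tangent_space A p"
  shows "tangent_map B F v \<in> tangent_space B (F p)"
proof (rule tangent_spaceI)
  note pb = smooth_functions_pullback[OF A B F]
  show "tangent_map B F v (\<lambda>x. f x + g x) = tangent_map B F v f + tangent_map B F v g"
    and "tangent_map B F v (\<lambda>x. f x * g x) = tangent_map B F v f * g (F p) + f (F p) * tangent_map B F v g"
    if f: "f \<in> smooth_functions B" and g: "g \<in> smooth_functions B" for f g
    using tangent_add[OF v pb[OF f] pb[OF g]] tangent_mult[OF v pb[OF f] pb[OF g]] f g
      smooth_functions_add[OF B f g] smooth_functions_mult[OF B f g]
    by (simp_all add: tangent_map_smooth)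
  show "tangent_map B F v (\<lambda>x. c * f x) = c * tangent_map B F v f" if f: "f \<in> smooth_functions B" for c f
    using tangent_cmult[OF v pb[OF f]] f smooth_functions_mult[OF B smooth_functions_const[OF B] f]
    by (simp add: tangent_map_smooth)
qed (simp add: tangent_map_nonsmooth)

text \<open>In \<open>tangent_partial\<close> the numbers \<open>v (coord b)\<close> do not depend
  on the parameter, and the partial derivatives at \<open>p\<close> are values of the jointly smooth
  Hadamard coefficients.\<close>

lemma tangent_parameter_smooth:
  assumes A: "smooth_manifold (A :: ('n::{t2_space,second_countable_topology}, 'a::euclidean_space) atlas)"
    and B: "smooth_manifold (B :: ('q::{t2_space,second_countable_topology}, 'b::euclidean_space) atlas)"
    and F: "F \<in> smooth_functions (product_atlas A B)" and v: "v \<in> tangent_space A p"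
  shows "(\<lambda>y. v (\<lambda>x. F (x, y))) \<in> smooth_functions B"
proof -
  obtain U \<phi> e where "chart_ball A p UNIV U \<phi> e" using chart_ball_exists[OF A open_UNIV UNIV_I] .
  then interpret chart_ball A p UNIV U \<phi> e .
  have F': "smooth_euclidean_on (product_atlas A B) (UNIV \<times> UNIV) F" using F by (simp add: smooth_functions_iff)
  have slice: "(\<lambda>x. F (x, y)) \<in> smooth_functions A" for y
    by (rule smooth_functions_pullback[OF A smooth_manifold_product[OF A B] _ F])
      (intro smooth_map_on_Pair A B smooth_map_on_id smooth_map_on_const open_UNIV)
  have "(\<lambda>y. quotient F b (p, y)) \<in> smooth_functions B" for b
    by (rule smooth_functions_pullback[OF B smooth_manifold_product[OF A B] _ quotient_smooth[OF B F']])
      (intro smooth_map_on_Pair A B smooth_map_on_id smooth_map_on_const open_UNIV)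
  then have "(\<lambda>y. \<Sum>b\<in>Basis. v (coord b) * quotient F b (p, y)) \<in> smooth_functions B"
    by (intro smooth_functions_sum smooth_functions_mult smooth_functions_const B)
  moreover have "v (\<lambda>x. F (x, y)) = (\<Sum>b\<in>Basis. v (coord b) * quotient F b (p, y))" for y
    using tangent_partial[OF v slice] quotient_p[of F, OF slice] by simp
  ultimately show ?thesis by simp
qed

text \<open>Both sides are read off from the Hadamard expansion of \<open>F\<close> in the first factor, so the symmetry of second
  derivatives is not needed.\<close>

lemma tangent_interchange:
  assumes A: "smooth_manifold (A :: ('n::{t2_space,second_countable_topology}, 'a::euclidean_space) atlas)"
    and B: "smooth_manifold (B :: ('q::{t2_space,second_countable_topology}, 'b::euclidean_space) atlas)"
    and F: "F \<in> smooth_functions (product_atlas A B)" and v: "v \<in> tangent_space A p" and w: "w \<in> tangent_space B q"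
  shows "v (\<lambda>x. w (\<lambda>y. F (x, y))) = w (\<lambda>y. v (\<lambda>x. F (x, y)))"
proof -
  obtain U \<phi> e where "chart_ball A p UNIV U \<phi> e" using chart_ball_exists[OF A open_UNIV UNIV_I] .
  then interpret chart_ball A p UNIV U \<phi> e .
  note AB = smooth_manifold_product[OF A B] and BA = smooth_manifold_product[OF B A]
  have F': "smooth_euclidean_on (product_atlas A B) (UNIV \<times> UNIV) F" using F by (simp add: smooth_functions_iff)
  have swap: "smooth_map (product_atlas B A) (product_atlas A B) (\<lambda>z. (snd z, fst z))"
    by (intro smooth_map_on_Pair BA A B smooth_map_on_snd smooth_map_on_fst open_UNIV)
  have slice1: "(\<lambda>x. H (x, y)) \<in> smooth_functions A" and slice2: "(\<lambda>y. H (x, y)) \<in> smooth_functions B"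
    and w_smooth: "(\<lambda>x. w (\<lambda>y. H (x, y))) \<in> smooth_functions A"
    if H: "H \<in> smooth_functions (product_atlas A B)" for H x y
  proof -
    show "(\<lambda>x. H (x, y)) \<in> smooth_functions A"
      by (rule smooth_functions_pullback[OF A AB _ H])
        (intro smooth_map_on_Pair A B smooth_map_on_id smooth_map_on_const open_UNIV)
    show "(\<lambda>y. H (x, y)) \<in> smooth_functions B"
      by (rule smooth_functions_pullback[OF B AB _ H])
        (intro smooth_map_on_Pair A B smooth_map_on_id smooth_map_on_const open_UNIV)
    have "(\<lambda>z. H (snd z, fst z)) \<in> smooth_functions (product_atlas B A)"
      by (rule smooth_functions_pullback[OF BA AB swap H])
    from tangent_parameter_smooth[OF B A this w] show "(\<lambda>x. w (\<lambda>y. H (x, y))) \<in> smooth_functions A" by simp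
  qed
  note Q = quotient_smooth[OF B F']
  let ?wF = "\<lambda>x. w (\<lambda>y. F (x, y))"
  \<comment> \<open>\<open>w\<close> acts on the parameter alone, so \<open>bump\<close> and
    \<open>coord\<close> are constants for it. The result is a Hadamard expansion of
    \<open>?wF\<close> whose coefficients are \<open>w\<close> applied to those of
    \<open>F\<close>.\<close>
  have expand: "(bump x)\<^sup>2 * (?wF x - ?wF p) = (\<Sum>b\<in>Basis. coord b x * w (\<lambda>y. quotient F b (x, y)))" for x
  proof -
    have "(bump x)\<^sup>2 * (?wF x - ?wF p) = w (\<lambda>y. (bump x)\<^sup>2 * (F (x, y) - F (p, y)))"
      using tangent_diff[OF B w slice2[OF F] slice2[OF F]]
        tangent_cmult[OF w smooth_functions_diff[OF B slice2[OF F] slice2[OF F]]] by simp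
    also have "\<dots> = w (\<lambda>y. \<Sum>b\<in>Basis. coord b x * quotient F b (x, y))"
      using quotient_expansion[OF B F'] by simp
    also have "\<dots> = (\<Sum>b\<in>Basis. w (\<lambda>y. coord b x * quotient F b (x, y)))"
      by (rule tangent_sum[OF B w smooth_functions_mult[OF B smooth_functions_const[OF B] slice2[OF Q]]])
    also have "\<dots> = (\<Sum>b\<in>Basis. coord b x * w (\<lambda>y. quotient F b (x, y)))"
      by (simp add: tangent_cmult[OF w slice2[OF Q]])
    finally show ?thesis .
  qed
  have wF: "?wF \<in> smooth_functions A" by (rule w_smooth[OF F])
  have d: "(\<lambda>x. ?wF x - ?wF p) \<in> smooth_functions A"
    by (rule smooth_functions_diff[OF A wF smooth_functions_const[OF A]])
  have "v ?wF = v (\<lambda>x. (bump x)\<^sup>2 * (?wF x - ?wF p))"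
    using tangent_diff[OF A v wF smooth_functions_const[OF A]] tangent_const[OF A v] tangent_bump_sq[OF v d] by simp
  also have "\<dots> = v (\<lambda>x. \<Sum>b\<in>Basis. coord b x * w (\<lambda>y. quotient F b (x, y)))"
    unfolding expand ..
  also have "\<dots> = (\<Sum>b\<in>Basis. v (\<lambda>x. coord b x * w (\<lambda>y. quotient F b (x, y))))"
    by (rule tangent_sum[OF A v smooth_functions_mult[OF A coord_smooth w_smooth[OF Q]]])
  also have "\<dots> = (\<Sum>b\<in>Basis. v (coord b) * w (\<lambda>y. quotient F b (p, y)))"
    by (simp add: tangent_vanishing_mult[OF v coord_smooth w_smooth[OF Q] coord_p])
  also have "\<dots> = w (\<lambda>y. \<Sum>b\<in>Basis. v (coord b) * quotient F b (p, y))"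
  proof -
    have "w (\<lambda>y. \<Sum>b\<in>Basis. v (coord b) * quotient F b (p, y)) =
        (\<Sum>b\<in>Basis. w (\<lambda>y. v (coord b) * quotient F b (p, y)))"
      by (rule tangent_sum[OF B w smooth_functions_mult[OF B smooth_functions_const[OF B] slice2[OF Q]]])
    then show ?thesis by (simp add: tangent_cmult[OF w slice2[OF Q]])
  qed
  also have "\<dots> = w (\<lambda>y. v (\<lambda>x. F (x, y)))"
    using tangent_partial[OF v slice1[OF F]] quotient_p[of F, OF slice1[OF F]] by simp
  finally show ?thesis .
qed

section \<open>Sections of the adjoint bundle\<close>

locale principal =
  fixes G :: "'g::{t2_space,second_countable_topology} monoid" (structure)
    and AG :: "('g, 'eg::euclidean_space) atlas"
    and AP :: "('p::{t2_space,second_countable_topology}, 'ep::euclidean_space) atlas"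
    and AM :: "('m::{t2_space,second_countable_topology}, 'em::euclidean_space) atlas"
    and act :: "'p \<Rightarrow> 'g \<Rightarrow> 'p"
    and pr :: "'p \<Rightarrow> 'm"
  assumes principal: "principal_bundle G AG AP AM act pr"
begin

lemma AG: "smooth_manifold AG" and AP: "smooth_manifold AP" and AM: "smooth_manifold AM"
  and group: "group G" and carrier [simp]: "carrier G = UNIV"
  and pr_smooth: "smooth_map AP AM pr"
  and act_smooth: "smooth_map (product_atlas AP AG) AP (\<lambda>(u, g). act u g)"
  and mult_smooth: "smooth_map (product_atlas AG AG) AG (\<lambda>(g, h). g \<otimes> h)"
  and act_one [simp]: "act u \<one> = u"
  and act_act: "act (act u g) h = act u (g \<otimes> h)"
  using principal by (simp_all add: principal_bundle_def lie_group_def)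

lemma group_simps [simp]: "\<one> \<otimes> g = g" "g \<otimes> \<one> = g" "inv g \<otimes> g = \<one>" "g \<otimes> inv g = \<one>"
  "(g \<otimes> h) \<otimes> k = g \<otimes> (h \<otimes> k)" "inv g \<otimes> (g \<otimes> h) = h" "g \<otimes> (inv g \<otimes> h) = h"
proof -
  interpret group G by (rule group)
  show "\<one> \<otimes> g = g" "g \<otimes> \<one> = g" "inv g \<otimes> g = \<one>" "g \<otimes> inv g = \<one>"
    "(g \<otimes> h) \<otimes> k = g \<otimes> (h \<otimes> k)" by (simp_all add: m_assoc)
  then show "inv g \<otimes> (g \<otimes> h) = h" "g \<otimes> (inv g \<otimes> h) = h"
    by (metis carrier UNIV_I l_one l_inv r_inv m_assoc)+
qed

lemma smooth_map_act:
  assumes B: "smooth_manifold B" and "open W" and F: "smooth_map_on B AP W F" and H: "smooth_map_on B AG W H"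
  shows "smooth_map_on B AP W (\<lambda>x. act (F x) (H x))"
  using smooth_map_on_compose[OF B smooth_manifold_product[OF AP AG] AP act_smooth
      smooth_map_on_Pair[OF B AP AG F H assms(2)] assms(2) open_UNIV] by simp

lemma smooth_map_mult:
  assumes B: "smooth_manifold B" and "open W" and F: "smooth_map_on B AG W F" and H: "smooth_map_on B AG W H"
  shows "smooth_map_on B AG W (\<lambda>x. F x \<otimes> H x)"
  using smooth_map_on_compose[OF B smooth_manifold_product[OF AG AG] AG mult_smooth
      smooth_map_on_Pair[OF B AG AG F H assms(2)] assms(2) open_UNIV] by simp

lemma orbit_smooth: "smooth_map AG AP (\<lambda>g. act u g)"
  by (rule smooth_map_act[OF AG open_UNIV smooth_map_on_const[OF AG] smooth_map_on_id[OF AG]])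

lemma right_smooth: "smooth_map AP AP (\<lambda>w. act w g)"
  by (rule smooth_map_act[OF AP open_UNIV smooth_map_on_id[OF AP] smooth_map_on_const[OF AP]])

lemmas orbit_pullback = smooth_functions_pullback[OF AG AP orbit_smooth]
lemmas right_pullback = smooth_functions_pullback[OF AP AP right_smooth]
lemmas base_pullback = smooth_functions_pullback[OF AP AM pr_smooth]

text \<open>A local trivialization in terms of its section \<open>\<sigma> x = \<psi> (x, 1)\<close> and its group component \<open>\<tau>\<close>.\<close>

definition trivializes :: "'m set \<Rightarrow> ('m \<Rightarrow> 'p) \<Rightarrow> ('p \<Rightarrow> 'g) \<Rightarrow> bool"
  where "trivializes U \<sigma> \<tau> \<longleftrightarrow> open U \<and> smooth_map_on AM AP U \<sigma> \<and> smooth_map_on AP AG (pr -` U) \<tau> \<and>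
    (\<forall>x\<in>U. pr (\<sigma> x) = x) \<and> (\<forall>w. pr w \<in> U \<longrightarrow> act (\<sigma> (pr w)) (\<tau> w) = w) \<and> (\<forall>x\<in>U. \<forall>g. \<tau> (act (\<sigma> x) g) = g) \<and>
    (\<forall>x\<in>U. \<forall>g. pr (act (\<sigma> x) g) = x)"

lemma open_fibers: "open U \<Longrightarrow> open (pr -` U)"
  using continuous_open_preimage[OF smooth_map_on_continuous[OF pr_smooth] open_UNIV] by simp

lemma closed_fibers: "closed U \<Longrightarrow> closed (pr -` U)"
  using open_fibers[of "- U"] by (simp add: closed_def vimage_Compl)

text \<open>The given trivialization is translated by the group component \<open>g0\<close> of
  \<open>u\<close>, so that its section passes through the prescribed point. Statements at
  \<open>u\<close> then become statements at the unit of the group.\<close>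

lemma trivializes_exists:
  obtains U \<sigma> \<tau> where "trivializes U \<sigma> \<tau>" "pr u \<in> U" "\<sigma> (pr u) = u"
proof -
  obtain U \<psi> where U: "open U" "pr u \<in> U" and lt: "local_trivialization G AG AP AM act pr U \<psi>"
    using principal unfolding principal_bundle_def by metis
  have bij: "bij_betw \<psi> (U \<times> UNIV) (pr -` U)"
    and \<psi>: "smooth_map_on (product_atlas AM AG) AP (U \<times> UNIV) \<psi>"
    and inv\<psi>: "smooth_map_on AP (product_atlas AM AG) (pr -` U) (inv_into (U \<times> UNIV) \<psi>)"
    and pr\<psi>: "\<And>x g. x \<in> U \<Longrightarrow> pr (\<psi> (x, g)) = x"
    and act\<psi>: "\<And>x g h. x \<in> U \<Longrightarrow> \<psi> (x, g \<otimes> h) = act (\<psi> (x, g)) h"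
    using lt unfolding local_trivialization_def by simp_all
  define \<iota> where "\<iota> = inv_into (U \<times> UNIV) \<psi>"
  have \<iota>: "\<iota> (\<psi> (x, g)) = (x, g)" if "x \<in> U" for x g
    using bij that unfolding \<iota>_def by (simp add: bij_betw_inv_into_left)
  have \<psi>\<iota>: "\<psi> (pr w, snd (\<iota> w)) = w" if "pr w \<in> U" for w
  proof -
    have "w \<in> \<psi> ` (U \<times> UNIV)" using bij that by (simp add: bij_betw_def)
    then obtain x g where "x \<in> U" "w = \<psi> (x, g)" by auto
    then show ?thesis using \<iota> pr\<psi> by simp
  qed
  define g0 where "g0 = snd (\<iota> u)"
  define \<sigma> where "\<sigma> x = \<psi> (x, g0)" for x
  define \<tau> where "\<tau> w = inv g0 \<otimes> snd (\<iota> w)" for w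
  have act\<sigma>: "act (\<sigma> x) g = \<psi> (x, g0 \<otimes> g)" if "x \<in> U" for x g
    using act\<psi>[OF that, of g0 g] by (simp add: \<sigma>_def)
  have "trivializes U \<sigma> \<tau>"
    unfolding trivializes_def
  proof (intro conjI ballI allI impI)
    show "open U" by fact
    show "smooth_map_on AM AP U \<sigma>" unfolding \<sigma>_def
      by (rule smooth_map_on_compose[OF AM smooth_manifold_product[OF AM AG] AP \<psi>])
        (auto intro!: smooth_map_on_Pair AM AG smooth_map_on_id smooth_map_on_const U open_Times)
    have "smooth_map_on AP AG (pr -` U) (\<lambda>w. snd (\<iota> w))"
      by (rule smooth_map_on_compose[OF AP smooth_manifold_product[OF AM AG] AG smooth_map_on_snd[OF AM AG, of UNIV]])
        (use inv\<psi> open_fibers[OF U(1)] in \<open>auto simp: \<iota>_def\<close>)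
    then show "smooth_map_on AP AG (pr -` U) \<tau>" unfolding \<tau>_def
      by (rule smooth_map_mult[OF AP open_fibers[OF U(1)] smooth_map_on_const[OF AP]])
    show "pr (\<sigma> x) = x" if "x \<in> U" for x using pr\<psi>[OF that] by (simp add: \<sigma>_def)
    show "act (\<sigma> (pr w)) (\<tau> w) = w" if "pr w \<in> U" for w
      using act\<sigma>[OF that] \<psi>\<iota>[OF that] by (simp add: \<tau>_def)
    show "\<tau> (act (\<sigma> x) g) = g" if "x \<in> U" for x g
      using act\<sigma>[OF that] \<iota>[OF that] by (simp add: \<tau>_def)
    show "pr (act (\<sigma> x) g) = x" if "x \<in> U" for x g
      using act\<sigma>[OF that] pr\<psi>[OF that] by simp
  qed
  moreover have "\<sigma> (pr u) = u" using \<psi>\<iota>[OF U(2)] by (simp add: \<sigma>_def g0_def)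
  ultimately show ?thesis using that U(2) by blast
qed

lemma trivializesD:
  assumes "trivializes U \<sigma> \<tau>"
  shows "open U" "smooth_map_on AM AP U \<sigma>" "smooth_map_on AP AG (pr -` U) \<tau>"
    "x \<in> U \<Longrightarrow> pr (\<sigma> x) = x" "pr w \<in> U \<Longrightarrow> act (\<sigma> (pr w)) (\<tau> w) = w" "x \<in> U \<Longrightarrow> \<tau> (act (\<sigma> x) g) = g"
    "x \<in> U \<Longrightarrow> pr (act (\<sigma> x) g) = x"
  using assms unfolding trivializes_def by blast+

text \<open>That the action preserves fibers is not an axiom of \<open>principal_bundle\<close>; it
  comes from a local trivialization, where right translation changes only the group
  component.\<close>

lemma pr_act [simp]: "pr (act u g) = pr u"
proof -
  obtain U \<sigma> \<tau> where t: "trivializes U \<sigma> \<tau>" "pr u \<in> U" "\<sigma> (pr u) = u" by (rule trivializes_exists)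
  show ?thesis using trivializesD(7)[OF t(1,2), of g] t(3) by simp
qed

lemma fiber_transitive:
  assumes "pr u = pr w"
  obtains g where "w = act u g"
proof -
  obtain U \<sigma> \<tau> where t: "trivializes U \<sigma> \<tau>" "pr u \<in> U" "\<sigma> (pr u) = u" by (rule trivializes_exists)
  have "w = act u (\<tau> w)" using trivializesD(5)[OF t(1), of w] t assms by auto
  then show ?thesis by (rule that)
qed

lemma trivial_tau_act:
  assumes t: "trivializes U \<sigma> \<tau>" and "pr w \<in> U"
  shows "\<tau> (act w g) = \<tau> w \<otimes> g"
proof -
  have "act w g = act (\<sigma> (pr w)) (\<tau> w \<otimes> g)" using trivializesD(5)[OF t assms(2)] by (metis act_act)
  then show ?thesis using trivializesD(6)[OF t assms(2)] by simp
qed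

lemma cutoff_exists:
  assumes "open U" "x \<in> U"
  obtains \<beta> K where "\<beta> \<in> smooth_functions AM" "\<beta> x = 1" "closed K" "K \<subseteq> U" "\<And>y. y \<notin> K \<Longrightarrow> \<beta> y = 0"
proof -
  obtain V \<phi> e where "chart_ball AM x U V \<phi> e" using chart_ball_exists[OF AM assms] .
  then interpret chart_ball AM x U V \<phi> e .
  show ?thesis
    by (rule that[OF bump_smooth bump_p closed_bump_support _ bump_eq_0]) (use bump_support_subset in auto)
qed

lemma fiber_extend:
  assumes t: "trivializes U \<sigma> \<tau>" and \<beta>: "\<beta> \<in> smooth_functions AM" "closed K" "K \<subseteq> U" "\<And>y. y \<notin> K \<Longrightarrow> \<beta> y = 0"
    and f: "smooth_euclidean_on AP (pr -` U) f"
  shows "(\<lambda>w. \<beta> (pr w) * f w) \<in> smooth_functions AP"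
  by (rule smooth_functions_extend[OF AP base_pullback[OF \<beta>(1)] f open_fibers[OF trivializesD(1)[OF t]]
        closed_fibers[OF \<beta>(2)]]) (use \<beta> in auto)

text \<open>The extension is a function of the group component times a cutoff on the base. The
  cutoff is constant along fibers, so it equals 1 on the whole orbit of \<open>u\<close>.\<close>

lemma orbit_function_extend:
  assumes "a \<in> smooth_functions AG"
  shows "\<exists>f\<in>smooth_functions AP. \<forall>g. f (act u g) = a g"
proof -
  obtain U \<sigma> \<tau> where t: "trivializes U \<sigma> \<tau>" "pr u \<in> U" "\<sigma> (pr u) = u" by (rule trivializes_exists)
  obtain \<beta> K where \<beta>: "\<beta> \<in> smooth_functions AM" "\<beta> (pr u) = 1" "closed K" "K \<subseteq> U" "\<And>y. y \<notin> K \<Longrightarrow> \<beta> y = 0"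
    by (rule cutoff_exists[OF trivializesD(1)[OF t(1)] t(2)]) blast
  have "smooth_euclidean_on AP (pr -` U) (\<lambda>w. a (\<tau> w))"
    by (rule smooth_map_on_compose[OF AP AG smooth_manifold_euclidean assms[unfolded smooth_functions_iff]
          trivializesD(3)[OF t(1)] open_fibers[OF trivializesD(1)[OF t(1)]] open_UNIV]) simp
  from fiber_extend[OF t(1) \<beta>(1,3,4,5) this]
  have "(\<lambda>w. \<beta> (pr w) * a (\<tau> w)) \<in> smooth_functions AP" .
  moreover have "\<beta> (pr (act u g)) * a (\<tau> (act u g)) = a g" for g
    using trivializesD(6)[OF t(1,2), of g] t(3) \<beta>(2) by simp
  ultimately show ?thesis by (intro bexI[of _ "\<lambda>w. \<beta> (pr w) * a (\<tau> w)"]) simp_all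
qed

abbreviation "LG \<equiv> tangent_space AG \<one>"

text \<open>\<open>h\<close> is obtained by letting \<open>X\<close> act on functions of the group component alone. No other function is needed:
  by Hadamard's lemma in the base directions, the difference lies in the ideal generated by functions on the base
  that vanish at \<open>pr u\<close>, and \<open>X\<close> kills functions on the base.\<close>

lemma vertical_vector:
  assumes X: "X \<in> tangent_space AP u" and vert: "tangent_map AM pr X = 0"
  obtains h where "h \<in> LG" "\<And>f. f \<in> smooth_functions AP \<Longrightarrow> X f = h (\<lambda>g. f (act u g))"
proof -
  obtain U \<sigma> \<tau> where t: "trivializes U \<sigma> \<tau>" "pr u \<in> U" "\<sigma> (pr u) = u" by (rule trivializes_exists)
  have oU: "open U" by (rule trivializesD(1)[OF t(1)])
  obtain V \<phi> e where "chart_ball AM (pr u) U V \<phi> e" using chart_ball_exists[OF AM oU t(2)] .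
  then interpret chart_ball AM "pr u" U V \<phi> e .
  have X_base: "X (\<lambda>w. f (pr w)) = 0" if "f \<in> smooth_functions AM" for f
    using fun_cong[OF vert, of f] that by (simp add: tangent_map_smooth)
  have X_base_mult: "X (\<lambda>w. f (pr w) * c w) = f (pr u) * X c"
    if "f \<in> smooth_functions AM" "c \<in> smooth_functions AP" for f c
    using tangent_mult[OF X base_pullback[OF that(1)] that(2)] X_base[OF that(1)] by simp
  have ext: "(\<lambda>w. bump (pr w) * f w) \<in> smooth_functions AP" if "smooth_euclidean_on AP (pr -` U) f" for f
    by (rule fiber_extend[OF t(1) bump_smooth closed_bump_support _ bump_eq_0 that]) (use bump_support_subset in auto)
  define E where "E a w = bump (pr w) * a (\<tau> w)" for a :: "'g \<Rightarrow> real" and w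
  have E: "E a \<in> smooth_functions AP" if "a \<in> smooth_functions AG" for a
    unfolding E_def
    by (rule ext, rule smooth_map_on_compose[OF AP AG smooth_manifold_euclidean that[unfolded smooth_functions_iff]
          trivializesD(3)[OF t(1)] open_fibers[OF oU] open_UNIV]) simp
  have E_u: "E a u = a \<one>" for a
    using trivializesD(6)[OF t(1,2), of \<one>] t(3) bump_p by (simp add: E_def)
  define h where "h a = (if a \<in> smooth_functions AG then X (E a) else 0)" for a
  have "h \<in> LG"
  proof (rule tangent_spaceI)
    fix a b assume a: "a \<in> smooth_functions AG" and b: "b \<in> smooth_functions AG"
    have "E (\<lambda>x. a x + b x) = (\<lambda>w. E a w + E b w)" by (auto simp: E_def algebra_simps)
    then show "h (\<lambda>x. a x + b x) = h a + h b"
      using tangent_add[OF X E[OF a] E[OF b]] a b smooth_functions_add[OF AG a b] by (simp add: h_def)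
    have ab: "(\<lambda>x. a x * b x) \<in> smooth_functions AG" by (rule smooth_functions_mult[OF AG a b])
    \<comment> \<open>The product contains the cutoff twice. \<open>X\<close> treats functions
      pulled back from the base as constants, and \<open>bump\<close> is 1 at \<open>pr u\<close>,
      so the surplus factor disappears.\<close>
    have "(\<lambda>w. E a w * E b w) = (\<lambda>w. bump (pr w) * E (\<lambda>x. a x * b x) w)"
      by (auto simp: E_def mult_ac)
    then have "X (\<lambda>w. E a w * E b w) = X (E (\<lambda>x. a x * b x))"
      using X_base_mult[OF bump_smooth E[OF ab]] bump_p by simp
    then show "h (\<lambda>x. a x * b x) = h a * b \<one> + a \<one> * h b"
      using tangent_mult[OF X E[OF a] E[OF b]] a b ab by (simp add: h_def E_u)
    have "E (\<lambda>x. c * a x) = (\<lambda>w. c * E a w)" for c by (auto simp: E_def)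
    then show "h (\<lambda>x. c * a x) = c * h a" for c
      using tangent_cmult[OF X E[OF a]] a smooth_functions_mult[OF AG smooth_functions_const[OF AG] a]
      by (simp add: h_def)
  qed (simp add: h_def)
  moreover have "X f = h (\<lambda>g. f (act u g))" if f: "f \<in> smooth_functions AP" for f
  proof -
    \<comment> \<open>\<open>f\<close> read in the trivialization as a function on base times group;
      Hadamard's lemma is applied in the base with the group as parameter space.\<close>
    let ?F = "\<lambda>z. f (act (\<sigma> (fst z)) (snd z))"
    have oU': "open (U \<times> (UNIV :: 'g set))" using oU by (simp add: open_Times)
    have F: "smooth_euclidean_on (product_atlas AM AG) (U \<times> UNIV) ?F"
    proof (rule smooth_map_on_compose[OF smooth_manifold_product[OF AM AG] AP smooth_manifold_euclidean
          f[unfolded smooth_functions_iff] smooth_map_act[OF smooth_manifold_product[OF AM AG] oU'] oU' open_UNIV])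
      show "smooth_map_on (product_atlas AM AG) AP (U \<times> UNIV) (\<lambda>z. \<sigma> (fst z))"
        by (rule smooth_map_on_compose[OF smooth_manifold_product[OF AM AG] AM AP trivializesD(2)[OF t(1)]
              smooth_map_on_fst[OF AM AG] oU' oU]) auto
    qed (auto intro: smooth_map_on_snd[OF AM AG])
    let ?a = "\<lambda>g. f (act u g)"
    have a: "?a \<in> smooth_functions AG" by (rule orbit_pullback[OF f])
    define R where "R b w = bump (pr w) * quotient ?F b (pr w, \<tau> w)" for b w
    have R: "R b \<in> smooth_functions AP" for b
      unfolding R_def
    proof (rule ext, rule smooth_map_on_compose[OF AP smooth_manifold_product[OF AM AG] smooth_manifold_euclidean
          quotient_smooth[OF AG F, unfolded smooth_functions_iff]])
      show "smooth_map_on AP (product_atlas AM AG) (pr -` U) (\<lambda>w. (pr w, \<tau> w))"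
        by (rule smooth_map_on_Pair[OF AP AM AG smooth_map_on_subset[OF pr_smooth] trivializesD(3)[OF t(1)]
              open_fibers[OF oU]]) simp
    qed (use open_fibers[OF oU] in auto)
    \<comment> \<open>The expansion supplies the square of \<open>bump\<close>; one further factor
      makes \<open>R b\<close> a global function on the bundle, and it is also the one contained in
      \<open>E ?a\<close>. Hence the third power.\<close>
    have eq: "bump (pr w) ^ 3 * f w - (bump (pr w))\<^sup>2 * E ?a w = (\<Sum>b\<in>Basis. coord b (pr w) * R b w)" for w
    proof (cases "pr w \<in> U")
      case True
      have "(bump (pr w))\<^sup>2 * (f w - ?a (\<tau> w)) = (\<Sum>b\<in>Basis. coord b (pr w) * quotient ?F b (pr w, \<tau> w))"
        using quotient_expansion[OF AG F, of "pr w" "\<tau> w"] trivializesD(5)[OF t(1) True] t(3) by simp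
      then have "bump (pr w) * ((bump (pr w))\<^sup>2 * (f w - ?a (\<tau> w))) =
          (\<Sum>b\<in>Basis. coord b (pr w) * R b w)"
        by (simp add: R_def sum_distrib_left mult_ac)
      then show ?thesis by (simp add: E_def power2_eq_square power3_eq_cube algebra_simps)
    next
      case False
      then have "bump (pr w) = 0" using bump_eq_0 bump_support_subset by auto
      then show ?thesis by (simp add: coord_def)
    qed
    have p: "(\<lambda>x. bump x ^ n) \<in> smooth_functions AM" for n by (rule smooth_functions_power[OF AM bump_smooth])
    have "X (\<lambda>w. bump (pr w) ^ 3 * f w - (bump (pr w))\<^sup>2 * E ?a w) = X f - X (E ?a)"
      using tangent_diff[OF AP X smooth_functions_mult[OF AP base_pullback[OF p[of 3]] f]
          smooth_functions_mult[OF AP base_pullback[OF p[of 2]] E[OF a]]]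
        X_base_mult[OF p[of 3] f] X_base_mult[OF p[of 2] E[OF a]] bump_p by simp
    moreover have "X (\<lambda>w. \<Sum>b\<in>Basis. coord b (pr w) * R b w) = 0"
    proof -
      have "X (\<lambda>w. \<Sum>b\<in>Basis. coord b (pr w) * R b w) = (\<Sum>b\<in>Basis. X (\<lambda>w. coord b (pr w) * R b w))"
        by (rule tangent_sum[OF AP X smooth_functions_mult[OF AP base_pullback[OF coord_smooth] R]])
      then show ?thesis using X_base_mult[OF coord_smooth R] coord_p by simp
    qed
    ultimately show ?thesis using a by (simp add: eq h_def)
  qed
  ultimately show ?thesis using that by blast
qed

end

lemma sum_fun_apply: "(\<Sum>i\<in>I. f i) x = (\<Sum>i\<in>I. f i x)"
  by (induction I rule: infinite_finite_induct) auto

context principal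
begin

section \<open>The kernel as a module of invariant vertical fields\<close>

abbreviation "K \<equiv> atiyah_kernel AP AM act pr"

lemma
  assumes "k \<in> K"
  shows kernel_tangent: "k u \<in> tangent_space AP u"
    and kernel_smooth: "f \<in> smooth_functions AP \<Longrightarrow> (\<lambda>u. k u f) \<in> smooth_functions AP"
    and kernel_invariant: "k (act u g) = tangent_map AP (\<lambda>w. act w g) (k u)"
    and kernel_vertical: "tangent_map AM pr (k u) = 0"
  using assms unfolding atiyah_kernel_def atiyah_sections_def smooth_vector_fields_def by blast+

lemma kernel_act: "k \<in> K \<Longrightarrow> f \<in> smooth_functions AP \<Longrightarrow> k (act u g) f = k u (\<lambda>w. f (act w g))"
  by (simp add: kernel_invariant tangent_map_smooth)

lemma kernel_base:
  assumes "k \<in> K" "f \<in> smooth_functions AM"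
  shows "k u (\<lambda>w. f (pr w)) = 0"
  using fun_cong[OF kernel_vertical[OF assms(1), of u], of f] assms(2) by (simp add: tangent_map_smooth)

text \<open>Invariance and verticality need testing on smooth functions only, because tangent
  vectors are zero on all other functions.\<close>

lemma kernelI:
  assumes t: "\<And>u. k u \<in> tangent_space AP u"
    and s: "\<And>f. f \<in> smooth_functions AP \<Longrightarrow> (\<lambda>u. k u f) \<in> smooth_functions AP"
    and i: "\<And>u g f. f \<in> smooth_functions AP \<Longrightarrow> k (act u g) f = k u (\<lambda>w. f (act w g))"
    and v: "\<And>u f. f \<in> smooth_functions AM \<Longrightarrow> k u (\<lambda>w. f (pr w)) = 0"
  shows "k \<in> K"
  unfolding atiyah_kernel_def atiyah_sections_def smooth_vector_fields_def
proof (intro CollectI conjI allI ballI)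
  show "k (act u g) = tangent_map AP (\<lambda>w. act w g) (k u)" for u g
  proof
    show "k (act u g) f = tangent_map AP (\<lambda>w. act w g) (k u) f" for f
      using i tangent_outside[OF t] by (cases "f \<in> smooth_functions AP") (auto simp: tangent_map_def comp_def)
  qed
  show "tangent_map AM pr (k u) = 0" for u
    using v by (auto simp: tangent_map_def comp_def)
qed (use t s in auto)

lemma kernel_scale:
  assumes f: "f \<in> smooth_functions AM" and k: "k \<in> K"
  shows "(\<lambda>u. f (pr u) *\<^sub>R k u) \<in> K"
proof (rule kernelI)
  show "f (pr u) *\<^sub>R k u \<in> tangent_space AP u" for u
    by (rule subspace_scale[OF subspace_tangent_space kernel_tangent[OF k]])
  show "(\<lambda>u. (f (pr u) *\<^sub>R k u) \<phi>) \<in> smooth_functions AP" if "\<phi> \<in> smooth_functions AP" for \<phi>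
    using smooth_functions_mult[OF AP base_pullback[OF f] kernel_smooth[OF k that]] by (simp add: scaleR_fun_def)
qed (simp_all add: scaleR_fun_def kernel_act[OF k] kernel_base[OF k])

lemma subspace_kernel: "subspace K"
proof (rule subspaceI)
  show "0 \<in> K"
    by (rule kernelI) (auto simp: AP subspace_0[OF subspace_tangent_space])
  show "k + l \<in> K" if k: "k \<in> K" and l: "l \<in> K" for k l
  proof (rule kernelI)
    show "(k + l) u \<in> tangent_space AP u" for u
      using subspace_add[OF subspace_tangent_space kernel_tangent[OF k] kernel_tangent[OF l]] by simp
    show "(\<lambda>u. (k + l) u f) \<in> smooth_functions AP" if "f \<in> smooth_functions AP" for f
      using smooth_functions_add[OF AP kernel_smooth[OF k that] kernel_smooth[OF l that]] by simp
  qed (simp_all add: kernel_act[OF k] kernel_base[OF k] kernel_act[OF l] kernel_base[OF l])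
  show "c *\<^sub>R k \<in> K" if k: "k \<in> K" for c k
    using kernel_scale[OF smooth_functions_const[OF AM, of c] k] by (simp add: scaleR_fun_def)
qed

text \<open>The index set of the sum varies with the point. Near any point it may be replaced by one
  finite set, at the cost of zero summands, and then smoothness is that of a finite sum.\<close>

lemma kernel_locally_finite_sum:
  fixes \<rho> :: "nat \<Rightarrow> 'm \<Rightarrow> real"
  assumes \<rho>: "\<And>n. \<rho> n \<in> smooth_functions AM" and k: "\<And>n. k n \<in> K"
    and fin: "\<And>x. \<exists>T. open T \<and> x \<in> T \<and> finite {n. \<exists>y\<in>T. \<rho> n y \<noteq> 0}"
  shows "(\<lambda>u. \<Sum>n | \<rho> n (pr u) \<noteq> 0. \<rho> n (pr u) *\<^sub>R k n u) \<in> K"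
proof (rule kernelI)
  show "(\<Sum>n | \<rho> n (pr u) \<noteq> 0. \<rho> n (pr u) *\<^sub>R k n u) \<in> tangent_space AP u" for u
    by (intro subspace_sum subspace_scale subspace_tangent_space kernel_tangent k)
  show "(\<lambda>u. (\<Sum>n | \<rho> n (pr u) \<noteq> 0. \<rho> n (pr u) *\<^sub>R k n u) f) \<in> smooth_functions AP"
    if f: "f \<in> smooth_functions AP" for f
  proof (rule smooth_functions_local[OF AP])
    fix u
    obtain T where T: "open T" "pr u \<in> T" "finite {n. \<exists>y\<in>T. \<rho> n y \<noteq> 0}" using fin[of "pr u"] by auto
    let ?N = "{n. \<exists>y\<in>T. \<rho> n y \<noteq> 0}" and ?g = "\<lambda>w. \<Sum>n | \<exists>y\<in>T. \<rho> n y \<noteq> 0. \<rho> n (pr w) * k n w f"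
    have "?g \<in> smooth_functions AP"
      by (rule smooth_functions_sum[OF AP smooth_functions_mult[OF AP base_pullback[OF \<rho>] kernel_smooth[OF k f]]])
    moreover have "(\<Sum>n | \<rho> n (pr w) \<noteq> 0. \<rho> n (pr w) *\<^sub>R k n w) f = ?g w" if "w \<in> pr -` T" for w
    proof -
      have "(\<Sum>n | \<rho> n (pr w) \<noteq> 0. \<rho> n (pr w) * k n w f) = ?g w"
        by (rule sum.mono_neutral_left) (use T that in auto)
      then show ?thesis by (simp add: sum_fun_apply scaleR_fun_def)
    qed
    ultimately show "\<exists>T g. open T \<and> u \<in> T \<and> g \<in> smooth_functions AP \<and>
        (\<forall>w\<in>T. (\<Sum>n | \<rho> n (pr w) \<noteq> 0. \<rho> n (pr w) *\<^sub>R k n w) f = g w)"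
      using T open_fibers by (intro exI[of _ "pr -` T"] exI[of _ ?g]) simp
  qed
qed (simp_all add: sum_fun_apply scaleR_fun_def kernel_act[OF k] kernel_base[OF k])

section \<open>Values of fields in the Lie algebra of the group\<close>

definition orbit_ext :: "'p \<Rightarrow> ('g \<Rightarrow> real) \<Rightarrow> 'p \<Rightarrow> real"
  where "orbit_ext u a = (SOME f. f \<in> smooth_functions AP \<and> (\<forall>g. f (act u g) = a g))"

text \<open>The inverse of the identification of \<open>\<gg>\<close> with the vertical vectors at \<open>u\<close>. The choice in
  \<^const>\<open>orbit_ext\<close> does not matter on \<open>K\<close>, and makes the map linear everywhere.\<close>

definition ev :: "'p \<Rightarrow> 'p vfield \<Rightarrow> ('g \<Rightarrow> real) \<Rightarrow> real"
  where "ev u k a = (if a \<in> smooth_functions AG then k u (orbit_ext u a) else 0)"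

lemma orbit_ext:
  assumes "a \<in> smooth_functions AG"
  shows "orbit_ext u a \<in> smooth_functions AP" "orbit_ext u a (act u g) = a g"
  using someI_ex[of "\<lambda>f. f \<in> smooth_functions AP \<and> (\<forall>g. f (act u g) = a g)"] orbit_function_extend[OF assms, of u]
  unfolding orbit_ext_def by blast+

lemma linear_ev: "linear (ev u)"
  by (rule linearI) (auto simp: ev_def scaleR_fun_def)

lemma ev_cong: "k u = l u \<Longrightarrow> ev u k = ev u l"
  by (auto simp: ev_def)

lemma ev_eqI:
  assumes h: "h \<in> LG" and eq: "\<And>f. f \<in> smooth_functions AP \<Longrightarrow> k u f = h (\<lambda>g. f (act u g))"
  shows "ev u k = h"
proof
  show "ev u k a = h a" for a
    using eq[OF orbit_ext(1)[of a u]] orbit_ext(2)[of a u] tangent_outside[OF h, of a] by (simp add: ev_def)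
qed

text \<open>By \<open>vertical_vector\<close>, \<open>k u f\<close> depends on \<open>f\<close> only
  through its restriction to the orbit of \<open>u\<close>; hence \<open>ev\<close> does not depend
  on the extension chosen.\<close>

lemma
  assumes k: "k \<in> K"
  shows ev_in: "ev u k \<in> LG" and ev_apply: "f \<in> smooth_functions AP \<Longrightarrow> k u f = ev u k (\<lambda>g. f (act u g))"
proof -
  obtain h where h: "h \<in> LG" "\<And>f. f \<in> smooth_functions AP \<Longrightarrow> k u f = h (\<lambda>g. f (act u g))"
    using vertical_vector[OF kernel_tangent[OF k] kernel_vertical[OF k]] by blast
  have "ev u k = h" by (rule ev_eqI) (use h in auto)
  then show "ev u k \<in> LG" "f \<in> smooth_functions AP \<Longrightarrow> k u f = ev u k (\<lambda>g. f (act u g))" using h by auto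
qed

lemma kernel_eq_outside: "k \<in> K \<Longrightarrow> f \<notin> smooth_functions AP \<Longrightarrow> k u f = 0"
  using tangent_outside[OF kernel_tangent] .

lemma ev_inj:
  assumes k: "k \<in> K" and l: "l \<in> K" and "ev u k = ev u l"
  shows "k u = l u"
proof
  show "k u f = l u f" for f
    using assms(3) ev_apply[OF k, of f u] ev_apply[OF l, of f u] kernel_eq_outside[OF k, of f u]
      kernel_eq_outside[OF l, of f u]
    by (cases "f \<in> smooth_functions AP") simp_all
qed

lemma kernel_fiber_eq:
  assumes k: "k \<in> K" and l: "l \<in> K" and "k u = l u" "pr u = pr w"
  shows "k w = l w"
proof -
  obtain g where "w = act u g" using fiber_transitive[OF assms(4)] .
  then show ?thesis using kernel_invariant[OF k] kernel_invariant[OF l] assms(3) by simp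
qed

lemma ev_kernel_scale: "ev u (\<lambda>u. f (pr u) *\<^sub>R k u) = f (pr u) *\<^sub>R ev u k"
  by (auto simp: ev_def scaleR_fun_def)

lemma ev_sum: "ev u (\<lambda>u. \<Sum>i\<in>I u. c i u *\<^sub>R k i u) = (\<Sum>i\<in>I u. c i u *\<^sub>R ev u (k i))"
  by (auto simp: ev_def sum_fun_apply scaleR_fun_def)

text \<open>The varying h is inserted to the left of \<open>\<tau> w\<close>. In the trivialization
  this is the right-invariant field with value \<open>v\<close> at the unit, as invariance under the
  right action on the bundle demands; \<open>\<beta>\<close> cuts it off.\<close>

definition local_field ::
    "('m \<Rightarrow> 'p) \<Rightarrow> ('p \<Rightarrow> 'g) \<Rightarrow> ('m \<Rightarrow> real) \<Rightarrow> (('g \<Rightarrow> real) \<Rightarrow> real) \<Rightarrow> 'p vfield"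
  where "local_field \<sigma> \<tau> \<beta> v w = \<beta> (pr w) *\<^sub>R tangent_map AP (\<lambda>h. act (\<sigma> (pr w)) (h \<otimes> \<tau> w)) v"

lemma
  assumes t: "trivializes U \<sigma> \<tau>" and \<beta>: "\<beta> \<in> smooth_functions AM" "closed C" "C \<subseteq> U" "\<And>y. y \<notin> C \<Longrightarrow> \<beta> y = 0"
    and v: "v \<in> LG"
  shows local_field_kernel: "local_field \<sigma> \<tau> \<beta> v \<in> K"
    and ev_local_field: "x \<in> U \<Longrightarrow> ev (\<sigma> x) (local_field \<sigma> \<tau> \<beta> v) = \<beta> x *\<^sub>R v"
proof -
  have apply_eq: "local_field \<sigma> \<tau> \<beta> v w f = \<beta> (pr w) * v (\<lambda>h. f (act (\<sigma> (pr w)) (h \<otimes> \<tau> w)))"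
    if "f \<in> smooth_functions AP" for w f
    using that by (simp add: local_field_def scaleR_fun_def tangent_map_smooth)
  have zero: "\<beta> y = 0" if "y \<notin> U" for y using \<beta>(3,4) that by auto
  have sm: "smooth_map AG AP (\<lambda>h. act u (h \<otimes> g))" for u g
    by (intro smooth_map_act smooth_map_mult AG open_UNIV smooth_map_on_const smooth_map_on_id)
  show "local_field \<sigma> \<tau> \<beta> v \<in> K"
  proof (rule kernelI)
    show "local_field \<sigma> \<tau> \<beta> v w \<in> tangent_space AP w" for w
    proof (cases "pr w \<in> U")
      case True
      have "act (\<sigma> (pr w)) (\<one> \<otimes> \<tau> w) = w" using trivializesD(5)[OF t True] by simp
      then have "tangent_map AP (\<lambda>h. act (\<sigma> (pr w)) (h \<otimes> \<tau> w)) v \<in> tangent_space AP w"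
        using tangent_map_in_tangent_space[OF AG AP sm v] by metis
      then show ?thesis unfolding local_field_def by (rule subspace_scale[OF subspace_tangent_space])
    next
      case False
      then show ?thesis using zero by (simp add: local_field_def subspace_0[OF subspace_tangent_space])
    qed
    show "(\<lambda>w. local_field \<sigma> \<tau> \<beta> v w f) \<in> smooth_functions AP" if f: "f \<in> smooth_functions AP" for f
    proof -
      \<comment> \<open>Applying the field to \<open>f\<close> means applying \<open>v\<close> to
        the first variable of \<open>?F\<close>. Once cut off, \<open>?F\<close> is smooth on all of
        group times bundle, and \<open>tangent_parameter_smooth\<close> gives smoothness in the
        remaining variable.\<close>
      let ?F = "\<lambda>z. f (act (\<sigma> (pr (snd z))) (fst z \<otimes> \<tau> (snd z)))"
      note GP = smooth_manifold_product[OF AG AP]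
      have oU: "open U" by (rule trivializesD(1)[OF t])
      have oW: "open ((UNIV :: 'g set) \<times> pr -` U)" using open_fibers[OF oU] by (simp add: open_Times)
      have pr_snd: "smooth_map_on (product_atlas AG AP) AM W (\<lambda>z. pr (snd z))" for W
        by (rule smooth_map_on_subset[OF smooth_map_on_compose[OF GP AP AM pr_smooth smooth_map_on_snd[OF AG AP]
                open_UNIV open_UNIV]]) simp_all
      have F: "smooth_euclidean_on (product_atlas AG AP) (UNIV \<times> pr -` U) ?F"
      proof (rule smooth_map_on_compose[OF GP AP smooth_manifold_euclidean f[unfolded smooth_functions_iff] _ oW open_UNIV],
          rule smooth_map_act[OF GP oW _ smooth_map_mult[OF GP oW smooth_map_on_fst[OF AG AP]]])
        show "smooth_map_on (product_atlas AG AP) AP (UNIV \<times> pr -` U) (\<lambda>z. \<sigma> (pr (snd z)))"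
          by (rule smooth_map_on_compose[OF GP AM AP trivializesD(2)[OF t] pr_snd oW oU]) auto
        show "smooth_map_on (product_atlas AG AP) AG (UNIV \<times> pr -` U) (\<lambda>z. \<tau> (snd z))"
          by (rule smooth_map_on_compose[OF GP AP AG trivializesD(3)[OF t] smooth_map_on_snd[OF AG AP] oW
                open_fibers[OF oU]]) auto
      qed simp
      have "(\<lambda>z. \<beta> (pr (snd z)) * ?F z) \<in> smooth_functions (product_atlas AG AP)"
      proof (rule smooth_functions_extend[OF GP _ F oW])
        show "(\<lambda>z. \<beta> (pr (snd z))) \<in> smooth_functions (product_atlas AG AP)"
          by (rule smooth_functions_pullback[OF GP AM pr_snd \<beta>(1)])
        show "closed ((UNIV :: 'g set) \<times> pr -` C)" using closed_fibers[OF \<beta>(2)] by (simp add: closed_Times)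
        show "UNIV \<times> pr -` C \<subseteq> UNIV \<times> pr -` U" using \<beta>(3) by auto
        show "\<beta> (pr (snd z)) = 0" if "z \<notin> UNIV \<times> pr -` C" for z :: "'g \<times> 'p"
          using \<beta>(4) that by (cases z) auto
      qed
      from tangent_parameter_smooth[OF AG AP this v]
      have 1: "(\<lambda>w. v (\<lambda>h. \<beta> (pr w) * f (act (\<sigma> (pr w)) (h \<otimes> \<tau> w)))) \<in> smooth_functions AP" by simp
      have "v (\<lambda>h. \<beta> (pr w) * f (act (\<sigma> (pr w)) (h \<otimes> \<tau> w))) = local_field \<sigma> \<tau> \<beta> v w f" for w
        unfolding apply_eq[OF f] by (rule tangent_cmult[OF v smooth_functions_pullback[OF AG AP sm f]])
      then show ?thesis using 1 by simp
    qed
    show "local_field \<sigma> \<tau> \<beta> v (act u g) f = local_field \<sigma> \<tau> \<beta> v u (\<lambda>w. f (act w g))"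
      if "f \<in> smooth_functions AP" for u g f
      using that zero trivial_tau_act[OF t, of u g] right_pullback[OF that]
      by (cases "pr u \<in> U") (simp_all add: apply_eq act_act)
    show "local_field \<sigma> \<tau> \<beta> v u (\<lambda>w. f (pr w)) = 0" if "f \<in> smooth_functions AM" for u f
      using base_pullback[OF that] tangent_const[OF AG v] by (simp add: apply_eq)
  qed
  show "ev (\<sigma> x) (local_field \<sigma> \<tau> \<beta> v) = \<beta> x *\<^sub>R v" if x: "x \<in> U"
  proof (rule ev_eqI)
    show "\<beta> x *\<^sub>R v \<in> LG" by (rule subspace_scale[OF subspace_tangent_space v])
    have "\<tau> (\<sigma> x) = \<one>" using trivializesD(6)[OF t x, of \<one>] by simp
    then show "local_field \<sigma> \<tau> \<beta> v (\<sigma> x) f = (\<beta> x *\<^sub>R v) (\<lambda>g. f (act (\<sigma> x) g))"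
      if "f \<in> smooth_functions AP" for f
      using that trivializesD(4)[OF t x] by (simp add: apply_eq scaleR_fun_def)
  qed
qed

lemma ev_surj:
  assumes v: "v \<in> LG"
  obtains k where "k \<in> K" "ev u k = v"
proof -
  obtain U \<sigma> \<tau> where t: "trivializes U \<sigma> \<tau>" "pr u \<in> U" "\<sigma> (pr u) = u" by (rule trivializes_exists)
  obtain \<beta> C where \<beta>: "\<beta> \<in> smooth_functions AM" "\<beta> (pr u) = 1" "closed C" "C \<subseteq> U" "\<And>y. y \<notin> C \<Longrightarrow> \<beta> y = 0"
    by (rule cutoff_exists[OF trivializesD(1)[OF t(1)] t(2)]) blast
  show ?thesis
    using that[OF local_field_kernel[OF t(1) \<beta>(1,3,4,5) v]] ev_local_field[OF t(1) \<beta>(1,3,4,5) v t(2)] t(3) \<beta>(2)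
    by simp
qed

text \<open>The coefficient of \<open>k\<close> with respect to the frame is read off by applying \<open>k\<close> to coordinates along the
  fibers, cut off by \<open>\<beta>\<close>; the frame and the product with \<open>\<beta>\<close> contribute two more factors \<open>\<beta>\<close>.\<close>

lemma kernel_frame:
  obtains \<beta> e where "\<beta> \<in> smooth_functions AM" "\<beta> x0 \<noteq> 0" "\<And>b :: 'eg. e b \<in> K"
    "\<And>k. k \<in> K \<Longrightarrow> \<exists>f. (\<forall>b. f b \<in> smooth_functions AM) \<and> (\<forall>u. k u = 0 \<longrightarrow> (\<forall>b. f b (pr u) = 0)) \<and>
      (\<forall>u. \<beta> (pr u) *\<^sub>R k u = (\<Sum>b\<in>Basis. f b (pr u) *\<^sub>R e b u))"
proof -
  obtain U0 \<psi> where "principal_bundle G AG AP AM act pr" "x0 \<in> U0" "local_trivialization G AG AP AM act pr U0 \<psi>"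
    using principal unfolding principal_bundle_def by metis
  then have "pr (\<psi> (x0, \<one>)) = x0" unfolding local_trivialization_def by simp
  then obtain u0 where u0: "pr u0 = x0" by blast
  obtain U \<sigma> \<tau> where t: "trivializes U \<sigma> \<tau>" "pr u0 \<in> U" "\<sigma> (pr u0) = u0" by (rule trivializes_exists)
  obtain \<beta> C where \<beta>: "\<beta> \<in> smooth_functions AM" "\<beta> (pr u0) = 1" "closed C" "C \<subseteq> U" "\<And>y. y \<notin> C \<Longrightarrow> \<beta> y = 0"
    by (rule cutoff_exists[OF trivializesD(1)[OF t(1)] t(2)]) blast
  have zero: "\<beta> y = 0" if "y \<notin> U" for y using \<beta>(4,5) that by auto
  have oU: "open U" by (rule trivializesD(1)[OF t(1)])
  obtain V \<phi> r where "chart_ball AG \<one> UNIV V \<phi> r" using chart_ball_exists[OF AG open_UNIV UNIV_I] .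
  then interpret chart_ball AG \<one> UNIV V \<phi> r .
  define e where "e b = local_field \<sigma> \<tau> \<beta> (partial b)" for b
  note cut = t(1) \<beta>(1,3,4,5)
  have e: "e b \<in> K" for b unfolding e_def by (rule local_field_kernel[OF cut partial_tangent])
  define \<theta> where "\<theta> b w = \<beta> (pr w) * coord b (\<tau> w)" for b w
  have \<theta>: "\<theta> b \<in> smooth_functions AP" for b
  proof -
    have "smooth_euclidean_on AP (pr -` U) (\<lambda>w. coord b (\<tau> w))"
      by (rule smooth_map_on_compose[OF AP AG smooth_manifold_euclidean
          coord_smooth[unfolded smooth_functions_iff] trivializesD(3)[OF t(1)] open_fibers[OF oU] open_UNIV]) simp
    from fiber_extend[OF cut this] show ?thesis by (simp add: \<theta>_def[abs_def])
  qed
  define \<gamma> where "\<gamma> k b x = \<beta> x * k (\<sigma> x) (\<theta> b)" for k b x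
  have \<gamma>: "\<gamma> k b \<in> smooth_functions AM" if k: "k \<in> K" for k b
    unfolding \<gamma>_def
    by (rule smooth_functions_extend[OF AM \<beta>(1) _ oU \<beta>(3,4,5)],
        rule smooth_map_on_compose[OF AM AP smooth_manifold_euclidean
          kernel_smooth[OF k \<theta>, unfolded smooth_functions_iff] trivializesD(2)[OF t(1)] oU open_UNIV]) simp_all
  \<comment> \<open>The coefficient is computed at \<open>\<sigma> (pr u)\<close> and not at
    \<open>u\<close>; invariance carries the zero of \<open>k\<close> along the fiber.\<close>
  have \<gamma>_0: "\<gamma> k b (pr u) = 0" if k: "k \<in> K" and "k u = 0" for k b u
  proof (cases "pr u \<in> U")
    case True
    have "k (\<sigma> (pr u)) = (0 :: 'p vfield) (\<sigma> (pr u))"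
      by (rule kernel_fiber_eq[OF k subspace_0[OF subspace_kernel], of u]) (use that trivializesD(4)[OF t(1) True] in auto)
    then show ?thesis by (simp add: \<gamma>_def)
  qed (simp add: \<gamma>_def zero)
  have expand: "\<beta> (pr u) ^ 3 *\<^sub>R k u = (\<Sum>b\<in>Basis. \<gamma> k b (pr u) *\<^sub>R e b u)" if k: "k \<in> K" for k u
  proof (cases "pr u \<in> U")
    case True
    let ?l = "\<lambda>u. (\<beta> (pr u) ^ 3) *\<^sub>R k u" and ?r = "\<lambda>u. \<Sum>b\<in>Basis. \<gamma> k b (pr u) *\<^sub>R e b u"
    let ?u = "\<sigma> (pr u)"
    have l: "?l \<in> K" by (rule kernel_scale[OF smooth_functions_power[OF AM \<beta>(1)] k])
    have "(\<Sum>b\<in>Basis. (\<lambda>u. \<gamma> k b (pr u) *\<^sub>R e b u)) \<in> K"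
      by (intro subspace_sum[OF subspace_kernel] kernel_scale \<gamma> k e)
    moreover have "(\<Sum>b\<in>Basis. (\<lambda>u. \<gamma> k b (pr u) *\<^sub>R e b u)) = ?r"
      by (rule ext) (simp add: sum_fun_apply)
    ultimately have r: "?r \<in> K" by simp
    have pu: "pr ?u = pr u" by (rule trivializesD(4)[OF t(1) True])
    have g: "\<gamma> k b (pr u) = (\<beta> (pr u))\<^sup>2 * ev ?u k (coord b)" for b
    proof -
      have "k ?u (\<theta> b) = ev ?u k (\<lambda>g. \<beta> (pr u) * coord b g)"
        using ev_apply[OF k \<theta>, of ?u] trivializesD(6)[OF t(1) True] pu by (simp add: \<theta>_def)
      then show ?thesis
        using tangent_cmult[OF ev_in[OF k] coord_smooth] by (simp add: \<gamma>_def power2_eq_square)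
    qed
    have "ev ?u ?r = (\<Sum>b\<in>Basis. \<gamma> k b (pr u) *\<^sub>R \<beta> (pr u) *\<^sub>R partial b)"
      using ev_sum[where I="\<lambda>_. Basis" and u="?u" and c="\<lambda>b u. \<gamma> k b (pr u)" and k=e]
        ev_local_field[OF cut partial_tangent True] pu
      by (simp add: e_def)
    also have "\<dots> = (\<beta> (pr u) ^ 3) *\<^sub>R (\<Sum>b\<in>Basis. ev ?u k (coord b) *\<^sub>R partial b)"
      by (simp add: g scaleR_sum_right power3_eq_cube power2_eq_square mult_ac)
    also have "(\<Sum>b\<in>Basis. ev ?u k (coord b) *\<^sub>R partial b) = ev ?u k"
    proof
      show "(\<Sum>b\<in>Basis. ev ?u k (coord b) *\<^sub>R partial b) a = ev ?u k a" for a
        using tangent_partial[OF ev_in[OF k], of a] tangent_outside[OF ev_in[OF k], of a ?u]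
          tangent_outside[OF partial_tangent, of a]
        by (cases "a \<in> smooth_functions AG") (simp_all add: sum_fun_apply scaleR_fun_def)
    qed
    finally have "ev ?u ?l = ev ?u ?r" using ev_kernel_scale[of ?u "\<lambda>x. \<beta> x ^ 3" k] pu by simp
    then have "?l ?u = ?r ?u" by (rule ev_inj[OF l r])
    then show ?thesis using kernel_fiber_eq[OF l r _ pu] by simp
  next
    case False
    then show ?thesis by (simp add: zero \<gamma>_def)
  qed
  show ?thesis
  proof (rule that[of "\<lambda>x. \<beta> x ^ 3" e])
    show "\<exists>f. (\<forall>b. f b \<in> smooth_functions AM) \<and> (\<forall>u. k u = 0 \<longrightarrow> (\<forall>b. f b (pr u) = 0)) \<and>
      (\<forall>u. \<beta> (pr u) ^ 3 *\<^sub>R k u = (\<Sum>b\<in>Basis. f b (pr u) *\<^sub>R e b u))" if "k \<in> K" for k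
      using \<gamma>[OF that] \<gamma>_0[OF that] expand[OF that] by (intro exI[of _ "\<gamma> k"]) simp
  qed (use smooth_functions_power[OF AM \<beta>(1)] \<beta>(2) u0 e in auto)
qed

section \<open>Brackets of fields and of the Lie algebra\<close>

abbreviation "brG \<equiv> lie_algebra_bracket G AG"

lemma mult_pullback:
  assumes "a \<in> smooth_functions AG"
  shows "(\<lambda>z. a (fst z \<otimes> snd z)) \<in> smooth_functions (product_atlas AG AG)"
  by (rule smooth_functions_pullback[OF smooth_manifold_product[OF AG AG] AG
        smooth_map_mult[OF smooth_manifold_product[OF AG AG] open_UNIV smooth_map_on_fst[OF AG AG] smooth_map_on_snd[OF AG AG]]
        assms])

lemma right_derivative_smooth:
  assumes v: "v \<in> LG" and a: "a \<in> smooth_functions AG"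
  shows "(\<lambda>g. v (\<lambda>h. a (g \<otimes> h))) \<in> smooth_functions AG" "(\<lambda>g. v (\<lambda>h. a (h \<otimes> g))) \<in> smooth_functions AG"
proof -
  note GG = smooth_manifold_product[OF AG AG]
  have "(\<lambda>z. a (snd z \<otimes> fst z)) \<in> smooth_functions (product_atlas AG AG)"
    by (rule smooth_functions_pullback[OF GG AG
        smooth_map_mult[OF GG open_UNIV smooth_map_on_snd[OF AG AG] smooth_map_on_fst[OF AG AG]] a])
  from tangent_parameter_smooth[OF AG AG this v] show "(\<lambda>g. v (\<lambda>h. a (g \<otimes> h))) \<in> smooth_functions AG" by simp
  from tangent_parameter_smooth[OF AG AG mult_pullback[OF a] v]
  show "(\<lambda>g. v (\<lambda>h. a (h \<otimes> g))) \<in> smooth_functions AG" by simp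
qed

lemma brG_apply:
  assumes v: "v \<in> LG" and w: "w \<in> LG" and a: "a \<in> smooth_functions AG"
  shows "brG v w a = v (\<lambda>g. w (\<lambda>h. a (g \<otimes> h))) - w (\<lambda>g. v (\<lambda>h. a (g \<otimes> h)))"
  using a right_derivative_smooth(1)[OF v a] right_derivative_smooth(1)[OF w a]
  by (simp add: lie_algebra_bracket_def vfield_bracket_def left_invariant_field_def tangent_map_smooth)

lemma brG_outside:
  assumes v: "v \<in> LG" and w: "w \<in> LG" and a: "a \<notin> smooth_functions AG"
  shows "brG v w a = 0"
  using a tangent_const[OF AG v] tangent_const[OF AG w] AG
  by (simp add: lie_algebra_bracket_def vfield_bracket_def left_invariant_field_def tangent_map_nonsmooth tangent_map_smooth)

lemma kernel_bracket:
  assumes k: "k \<in> K" and l: "l \<in> K"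
  shows "vfield_bracket k l \<in> K"
proof (rule kernelI)
  note s = kernel_smooth[OF k] kernel_smooth[OF l]
  note t = kernel_tangent[OF k] kernel_tangent[OF l]
  show "vfield_bracket k l u \<in> tangent_space AP u" for u
  proof (rule tangent_spaceI)
    fix f g assume f: "f \<in> smooth_functions AP" and g: "g \<in> smooth_functions AP"
    show "vfield_bracket k l u (\<lambda>x. f x + g x) = vfield_bracket k l u f + vfield_bracket k l u g"
      using tangent_add[OF t(1) f g] tangent_add[OF t(2) f g] tangent_add[OF t(1) s(2)[OF f] s(2)[OF g], of u]
        tangent_add[OF t(2) s(1)[OF f] s(1)[OF g], of u]
      by (simp add: vfield_bracket_def)
    show "vfield_bracket k l u (\<lambda>x. c * f x) = c * vfield_bracket k l u f" for c
      using tangent_cmult[OF t(1) f] tangent_cmult[OF t(2) f] tangent_cmult[OF t(1) s(2)[OF f], of u]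
        tangent_cmult[OF t(2) s(1)[OF f], of u]
      by (simp add: vfield_bracket_def algebra_simps)
    \<comment> \<open>The two mixed terms are symmetric in \<open>X\<close> and \<open>Y\<close> and
      cancel in the commutator, which is therefore again a derivation.\<close>
    have second: "X u (\<lambda>q. Y q (\<lambda>x. f x * g x)) =
        X u (\<lambda>q. Y q f) * g u + Y u f * X u g + X u f * Y u g + f u * X u (\<lambda>q. Y q g)"
      if X: "X \<in> K" and Y: "Y \<in> K" for X Y
    proof -
      note sY = kernel_smooth[OF Y] and tX = kernel_tangent[OF X, of u]
      have "X u (\<lambda>q. Y q (\<lambda>x. f x * g x)) = X u (\<lambda>q. Y q f * g q + f q * Y q g)"
        by (simp add: tangent_mult[OF kernel_tangent[OF Y] f g])
      also have "\<dots> = X u (\<lambda>q. Y q f * g q) + X u (\<lambda>q. f q * Y q g)"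
        by (rule tangent_add[OF tX smooth_functions_mult[OF AP sY[OF f] g] smooth_functions_mult[OF AP f sY[OF g]]])
      finally show ?thesis
        using tangent_mult[OF tX sY[OF f] g] tangent_mult[OF tX f sY[OF g]] by simp
    qed
    show "vfield_bracket k l u (\<lambda>x. f x * g x) = vfield_bracket k l u f * g u + f u * vfield_bracket k l u g"
      using second[OF k l] second[OF l k] by (simp add: vfield_bracket_def algebra_simps)
  next
    show "vfield_bracket k l u f = 0" if "f \<notin> smooth_functions AP" for f
      using kernel_eq_outside[OF k that] kernel_eq_outside[OF l that] tangent_const[OF AP t(1), of u]
        tangent_const[OF AP t(2), of u]
      by (simp add: vfield_bracket_def)
  qed
  show "(\<lambda>u. vfield_bracket k l u f) \<in> smooth_functions AP" if f: "f \<in> smooth_functions AP" for f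
    unfolding vfield_bracket_def by (rule smooth_functions_diff[OF AP s(1)[OF s(2)[OF f]] s(2)[OF s(1)[OF f]]])
  show "vfield_bracket k l (act u g) f = vfield_bracket k l u (\<lambda>w. f (act w g))" if f: "f \<in> smooth_functions AP" for u g f
    using kernel_act[OF k s(2)[OF f]] kernel_act[OF l s(1)[OF f]] kernel_act[OF k f] kernel_act[OF l f]
    by (simp add: vfield_bracket_def)
  show "vfield_bracket k l u (\<lambda>w. f (pr w)) = 0" if "f \<in> smooth_functions AM" for u f
    using kernel_base[OF k that] kernel_base[OF l that] tangent_const[OF AP t(1), of u] tangent_const[OF AP t(2), of u]
    by (simp add: vfield_bracket_def)
qed

text \<open>In a trivialization the fields of the kernel are right invariant, while \<open>\<gg>\<close> carries the bracket of left
  invariant fields: hence the sign.\<close>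

lemma ev_bracket:
  assumes k: "k \<in> K" and l: "l \<in> K"
  shows "ev u (vfield_bracket k l) = - brG (ev u k) (ev u l)"
proof
  fix a
  let ?v = "ev u k" and ?w = "ev u l"
  note v = ev_in[OF k, of u] and w = ev_in[OF l, of u]
  show "ev u (vfield_bracket k l) a = (- brG ?v ?w) a"
  proof (cases "a \<in> smooth_functions AG")
    case True
    let ?f = "orbit_ext u a"
    note f = orbit_ext(1)[OF True, of u]
    have second: "X u (\<lambda>q. Y q ?f) = ev u Y (\<lambda>h. ev u X (\<lambda>g. a (h \<otimes> g)))" if X: "X \<in> K" and Y: "Y \<in> K" for X Y
    proof -
      \<comment> \<open>Invariance moves \<open>Y\<close> back to \<open>u\<close> at the price of a
        right translation of \<open>?f\<close>, so the variable of \<open>Y\<close> stands to the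
        left of g. After the interchange \<open>Y\<close> is the outer derivation, the reverse of
        the order in \<open>brG_apply\<close>.\<close>
      have "Y (act u g) ?f = ev u Y (\<lambda>h. a (h \<otimes> g))" for g
        using kernel_act[OF Y f] ev_apply[OF Y right_pullback[OF f]] orbit_ext(2)[OF True]
        by (simp add: act_act)
      then have "X u (\<lambda>q. Y q ?f) = ev u X (\<lambda>g. ev u Y (\<lambda>h. a (h \<otimes> g)))"
        using ev_apply[OF X kernel_smooth[OF Y f]] by simp
      also have "\<dots> = ev u Y (\<lambda>h. ev u X (\<lambda>g. a (h \<otimes> g)))"
        using tangent_interchange[OF AG AG mult_pullback[OF True] ev_in[OF Y] ev_in[OF X]] by simp
      finally show ?thesis .
    qed
    have "ev u (vfield_bracket k l) a = vfield_bracket k l u ?f" using True by (simp add: ev_def)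
    then show ?thesis
      using second[OF k l] second[OF l k] brG_apply[OF v w True] by (simp add: vfield_bracket_def)
  next
    case False
    then show ?thesis using brG_outside[OF v w] by (simp add: ev_def)
  qed
qed

lemma brG_add_left:
  assumes v: "v \<in> LG" and w: "w \<in> LG" and x: "x \<in> LG"
  shows "brG (v + w) x = brG v x + brG w x"
proof
  fix a
  have vw: "v + w \<in> LG" by (rule subspace_add[OF subspace_tangent_space v w])
  show "brG (v + w) x a = (brG v x + brG w x) a"
    using brG_apply[OF vw x] brG_apply[OF v x] brG_apply[OF w x] brG_outside[OF vw x] brG_outside[OF v x] brG_outside[OF w x]
      tangent_add[OF x right_derivative_smooth(1)[OF v] right_derivative_smooth(1)[OF w]]
    by (cases "a \<in> smooth_functions AG") simp_all
qed

lemma brG_scale_left: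
  assumes v: "v \<in> LG" and x: "x \<in> LG"
  shows "brG (c *\<^sub>R v) x = c *\<^sub>R brG v x"
proof
  fix a
  have cv: "c *\<^sub>R v \<in> LG" by (rule subspace_scale[OF subspace_tangent_space v])
  show "brG (c *\<^sub>R v) x a = (c *\<^sub>R brG v x) a"
    using brG_apply[OF cv x] brG_apply[OF v x] brG_outside[OF cv x] brG_outside[OF v x]
      tangent_cmult[OF x right_derivative_smooth(1)[OF v]]
    by (cases "a \<in> smooth_functions AG") (simp_all add: scaleR_fun_def right_diff_distrib)
qed

lemma brG_skew:
  assumes v: "v \<in> LG" and w: "w \<in> LG"
  shows "brG v w = - brG w v"
proof
  show "brG v w a = (- brG w v) a" for a
    using brG_apply[OF v w] brG_apply[OF w v] brG_outside[OF v w] brG_outside[OF w v]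
    by (cases "a \<in> smooth_functions AG") simp_all
qed

end

section \<open>Partitions and negligible images\<close>

definition locally_finite_family :: "(nat \<Rightarrow> 'm::topological_space \<Rightarrow> real) \<Rightarrow> bool"
  where "locally_finite_family h \<longleftrightarrow> (\<forall>x. \<exists>T. open T \<and> x \<in> T \<and> finite {n. \<exists>y\<in>T. h n y \<noteq> 0})"

lemma locally_finite_familyE:
  assumes "locally_finite_family h"
  obtains T where "open T" "x \<in> T" "finite {n. \<exists>y\<in>T. h n y \<noteq> 0}"
  using assms[unfolded locally_finite_family_def, rule_format, of x] by auto

lemma locally_finite_family_finite:
  assumes "locally_finite_family h"
  shows "finite {n. h n x \<noteq> 0}"
proof -
  obtain T where T: "x \<in> T" "finite {n. \<exists>y\<in>T. h n y \<noteq> 0}"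
    by (rule locally_finite_familyE[OF assms])
  show ?thesis by (rule finite_subset[OF _ T(2)]) (use T(1) in auto)
qed

lemma locally_finite_family_subset:
  assumes "locally_finite_family h" "\<And>n x. h' n x \<noteq> 0 \<Longrightarrow> h n x \<noteq> 0"
  shows "locally_finite_family h'"
  unfolding locally_finite_family_def
proof
  fix x
  obtain T where T: "open T" "x \<in> T" "finite {n. \<exists>y\<in>T. h n y \<noteq> 0}"
    by (rule locally_finite_familyE[OF assms(1)])
  have "finite {n. \<exists>y\<in>T. h' n y \<noteq> 0}" by (rule finite_subset[OF _ T(3)]) (use assms(2) in auto)
  then show "\<exists>T. open T \<and> x \<in> T \<and> finite {n. \<exists>y\<in>T. h' n y \<noteq> 0}" using T by auto
qed

lemma smooth_functions_locally_finite_sum: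
  assumes A: "smooth_manifold A" and h: "\<And>n. h n \<in> smooth_functions A" and f: "\<And>n. f n \<in> smooth_functions A"
    and lf: "locally_finite_family h"
  shows "(\<lambda>x. \<Sum>n | h n x \<noteq> 0. h n x * f n x) \<in> smooth_functions A"
proof (rule smooth_functions_local[OF A])
  fix x
  obtain T where T: "open T" "x \<in> T" "finite {n. \<exists>y\<in>T. h n y \<noteq> 0}"
    by (rule locally_finite_familyE[OF lf])
  let ?g = "\<lambda>w. \<Sum>n | \<exists>y\<in>T. h n y \<noteq> 0. h n w * f n w"
  have "?g \<in> smooth_functions A"
    by (rule smooth_functions_sum[OF A smooth_functions_mult[OF A h f]])
  moreover have "(\<Sum>n | h n w \<noteq> 0. h n w * f n w) = ?g w" if "w \<in> T" for w
    by (rule sum.mono_neutral_left) (use T that in auto)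
  ultimately show "\<exists>T g. open T \<and> x \<in> T \<and> g \<in> smooth_functions A \<and>
      (\<forall>y\<in>T. (\<Sum>n | h n y \<noteq> 0. h n y * f n y) = g y)"
    using T by (intro exI[of _ T] exI[of _ ?g]) simp
qed

text \<open>The nonvanishing sets are open and cover, and second countability extracts a countable
  subcover. This serves for the domains of frames, for multipliers into a submodule, and for an
  ideal of functions without common zero.\<close>

lemma smooth_functions_countable_cover:
  fixes Q :: "('m::{t2_space,second_countable_topology} \<Rightarrow> real) set"
  assumes Q: "Q \<subseteq> smooth_functions A" and cover: "\<And>x. \<exists>f\<in>Q. f x \<noteq> 0"
  obtains g :: "nat \<Rightarrow> 'm \<Rightarrow> real" where "\<And>n. g n \<in> Q" "\<And>x. \<exists>n. g n x \<noteq> 0"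
proof -
  let ?F = "(\<lambda>f. {x. f x \<noteq> 0}) ` Q"
  have "open S" if S: "S \<in> ?F" for S
  proof -
    obtain f where f: "f \<in> Q" "S = {x. f x \<noteq> 0}" using S by auto
    have "continuous_on UNIV f" by (rule smooth_functions_continuous) (use f Q in auto)
    then have "open (f -` (- {0}))" using continuous_open_preimage[of UNIV f "- {0}"] by auto
    moreover have "f -` (- {0}) = S" using f by auto
    ultimately show ?thesis by simp
  qed
  then obtain F' where F': "F' \<subseteq> ?F" "countable F'" "\<Union>F' = \<Union>?F" using Lindelof by metis
  have U: "\<Union>F' = UNIV" using cover F'(3) by fastforce
  then have "F' \<noteq> {}" by auto
  have "\<exists>f\<in>Q. from_nat_into F' n = {x. f x \<noteq> 0}" for n
    using from_nat_into[OF \<open>F' \<noteq> {}\<close>, of n] F'(1) by auto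
  then obtain g where g: "\<And>n. g n \<in> Q" "\<And>n. from_nat_into F' n = {x. g n x \<noteq> 0}" by metis
  have "\<exists>n. g n x \<noteq> 0" for x
  proof -
    have "x \<in> \<Union>F'" using U by simp
    then obtain S where "S \<in> F'" "x \<in> S" by (rule UnionE)
    then obtain n where "from_nat_into F' n = S" using from_nat_into_surj[OF F'(2)] by blast
    then show ?thesis using g(2)[of n] \<open>x \<in> S\<close> by auto
  qed
  then show ?thesis using g(1) by (rule that[rotated])
qed

text \<open>Near a point where \<open>(g j)\<^sup>2 > \<epsilon>\<close>, the factor with \<open>i = j\<close> kills \<open>h n\<close> as soon as \<open>1 / (n + 1) < \<epsilon>\<close>; no
  factor vanishes at a point where \<open>g n\<close> is the first nonzero function. No compactness is involved.\<close>

lemma smooth_functions_locally_finite_refinement: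
  assumes A: "smooth_manifold A" and g: "\<And>n. g n \<in> smooth_functions A" and cover: "\<And>x. \<exists>n. g n x \<noteq> 0"
  obtains h where "\<And>n. h n \<in> smooth_functions A" "\<And>n x. h n x \<ge> 0" "\<And>n x. h n x \<noteq> 0 \<Longrightarrow> g n x \<noteq> 0"
    "\<And>x. \<exists>n. h n x \<noteq> 0" "locally_finite_family h"
proof -
  define h where "h n x = flat ((g n x)\<^sup>2) * (\<Prod>i<n. flat (1 / real (Suc n) - (g i x)\<^sup>2))" for n x
  have g2: "(\<lambda>x. (g n x)\<^sup>2) \<in> smooth_functions A" for n by (rule smooth_functions_power[OF A g])
  have 1: "h n \<in> smooth_functions A" for n
    unfolding h_def
    by (rule smooth_functions_mult[OF A smooth_functions_flat[OF A g2] smooth_functions_prod[OF A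
            smooth_functions_flat[OF A smooth_functions_diff[OF A smooth_functions_const[OF A] g2]]]])
  have 2: "h n x \<ge> 0" for n x unfolding h_def by (intro mult_nonneg_nonneg prod_nonneg) (simp_all add: flat_nonneg)
  have 3: "g n x \<noteq> 0" if "h n x \<noteq> 0" for n x using that by (auto simp: h_def flat_eq_0_iff)
  have 4: "\<exists>n. h n x \<noteq> 0" for x
  proof -
    obtain n where n: "g n x \<noteq> 0" "\<And>i. i < n \<Longrightarrow> g i x = 0"
      using exists_least_iff[of "\<lambda>n. g n x \<noteq> 0"] cover[of x] by blast
    have "(\<Prod>i<n. flat (1 / real (Suc n) - (g i x)\<^sup>2)) = (\<Prod>i<n. flat (1 / real (Suc n)))"
      by (rule prod.cong) (simp_all add: n(2))
    also have "\<dots> \<noteq> 0" by (simp add: flat_eq_0_iff not_le)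
    finally have "h n x \<noteq> 0" using n(1) by (simp add: h_def flat_eq_0_iff)
    then show ?thesis by blast
  qed
  have 5: "locally_finite_family h"
    unfolding locally_finite_family_def
  proof
    fix x
    obtain j where j: "g j x \<noteq> 0" using cover by blast
    \<comment> \<open>Half of the squared value at \<open>x\<close>, so that the open set where
      \<open>(g j)\<^sup>2\<close> exceeds \<epsilon> contains \<open>x\<close>.\<close>
    define \<epsilon> where "\<epsilon> = (g j x)\<^sup>2 / 2"
    have \<epsilon>: "\<epsilon> > 0" using j by (simp add: \<epsilon>_def)
    let ?T = "(\<lambda>y. (g j y)\<^sup>2) -` {\<epsilon><..}"
    have "open ?T"
      using continuous_open_preimage[OF smooth_functions_continuous[OF g2] open_UNIV open_greaterThan] by simp
    moreover have "x \<in> ?T" using j by (simp add: \<epsilon>_def)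
    moreover have "{n. \<exists>y\<in>?T. h n y \<noteq> 0} \<subseteq> {..max j (nat \<lceil>1 / \<epsilon>\<rceil>)}"
    proof
      fix n assume "n \<in> {n. \<exists>y\<in>?T. h n y \<noteq> 0}"
      then obtain y where y: "(g j y)\<^sup>2 > \<epsilon>" "h n y \<noteq> 0" by auto
      have "n \<le> nat \<lceil>1 / \<epsilon>\<rceil>" if "n > j"
      proof -
        have "flat (1 / real (Suc n) - (g j y)\<^sup>2) \<noteq> 0" using y(2) that by (auto simp: h_def)
        then have "\<epsilon> < 1 / real (Suc n)" using y(1) by (simp add: flat_eq_0_iff)
        then have "real (Suc n) < 1 / \<epsilon>" using \<epsilon> by (simp add: field_simps)
        then show ?thesis by linarith
      qed
      then show "n \<in> {..max j (nat \<lceil>1 / \<epsilon>\<rceil>)}" by (cases "n > j") auto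
    qed
    then have "finite {n. \<exists>y\<in>?T. h n y \<noteq> 0}" by (rule finite_subset) simp
    ultimately show "\<exists>T. open T \<and> x \<in> T \<and> finite {n. \<exists>y\<in>T. h n y \<noteq> 0}" by (intro exI[of _ ?T]) simp
  qed
  show ?thesis by (rule that[OF 1 2 3 4 5])
qed

text \<open>Each chart contributes the differentiable image of a set in a space of smaller
  dimension, which is null, and countably many charts suffice. This is the elementary case of Sard's
  theorem.\<close>

lemma negligible_smooth_image:
  fixes A :: "('n::{t2_space,second_countable_topology}, 'a::euclidean_space) atlas" and F :: "'n \<Rightarrow> 'd::euclidean_space"
  assumes A: "smooth_manifold A" and F: "smooth_euclidean_on A W F" and "open W" and dim: "DIM('a) < DIM('d)"
  shows "negligible (F ` W)"
proof -
  have "open S" if "S \<in> fst ` A" for S using that chart_open[OF A] by auto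
  then obtain C where C: "C \<subseteq> fst ` A" "countable C" "\<Union>C = \<Union>(fst ` A)" using Lindelof by metis
  have "\<exists>\<phi>. (U, \<phi>) \<in> A" if "U \<in> C" for U
  proof -
    have "U \<in> fst ` A" using that C(1) by (rule subsetD[rotated])
    then show ?thesis by auto
  qed
  then obtain \<phi> where \<phi>: "\<And>U. U \<in> C \<Longrightarrow> (U, \<phi> U) \<in> A" by metis
  have "negligible (\<Union>U\<in>C. (\<lambda>y. F (inv_into U (\<phi> U) y)) ` (\<phi> U ` (U \<inter> W)))"
  proof (rule negligible_countable_Union)
    show "countable ((\<lambda>U. (\<lambda>y. F (inv_into U (\<phi> U) y)) ` (\<phi> U ` (U \<inter> W))) ` C)" using C(2) by simp
    fix S assume "S \<in> (\<lambda>U. (\<lambda>y. F (inv_into U (\<phi> U) y)) ` (\<phi> U ` (U \<inter> W))) ` C"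
    then obtain U where U: "U \<in> C" "S = (\<lambda>y. F (inv_into U (\<phi> U) y)) ` (\<phi> U ` (U \<inter> W))" by auto
    have "(\<lambda>y. F (inv_into U (\<phi> U) y)) differentiable_on (\<phi> U ` (U \<inter> W))"
      unfolding differentiable_on_def differentiable_def
      using smooth_on_has_derivative[OF smooth_euclidean_on_chart[OF F \<phi>[OF U(1)]]] has_derivative_at_withinI by blast
    then show "negligible S" unfolding U(2) by (rule negligible_differentiable_image_lowdim[OF dim])
  qed
  moreover have "F ` W \<subseteq> (\<Union>U\<in>C. (\<lambda>y. F (inv_into U (\<phi> U) y)) ` (\<phi> U ` (U \<inter> W)))"
  proof
    fix z assume "z \<in> F ` W"
    then obtain x where x: "x \<in> W" "z = F x" by auto
    obtain V \<psi> where "(V, \<psi>) \<in> A" "x \<in> V" using chart_exists[OF A] .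
    then have "x \<in> \<Union>C" using C(3) by force
    then obtain U where U: "U \<in> C" "x \<in> U" by auto
    then have "z = F (inv_into U (\<phi> U) (\<phi> U x))" using x chart_inv[OF A \<phi>[OF U(1)] U(2)] by simp
    then show "z \<in> (\<Union>U\<in>C. (\<lambda>y. F (inv_into U (\<phi> U) y)) ` (\<phi> U ` (U \<inter> W)))" using U x by auto
  qed
  ultimately show ?thesis by (rule negligible_subset)
qed

text \<open>The values to be excluded for each \<open>a b\<close> form a smooth image of lower dimension.\<close>

lemma generic_independent:
  fixes A :: "('m::{t2_space,second_countable_topology}, 'em::euclidean_space) atlas"
    and \<tau> :: "'eg::euclidean_space \<Rightarrow> 'm \<Rightarrow> 'd::euclidean_space"
  assumes A: "smooth_manifold A" and dim: "DIM('em) + DIM('eg) < DIM('d)"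
    and q: "q \<in> smooth_functions A" and \<tau>: "\<And>b. smooth_euclidean_on A UNIV (\<tau> b)" and "B \<subseteq> Basis"
  shows "\<exists>a. \<forall>x c. q x \<noteq> 0 \<longrightarrow> (\<Sum>b\<in>B. c b *\<^sub>R (\<tau> b x + q x *\<^sub>R a b)) = 0 \<longrightarrow> (\<forall>b\<in>B. c b = 0)"
proof -
  have "finite B" using assms(5) finite_Basis finite_subset by blast
  then show ?thesis using assms(5)
  proof (induction B)
    case empty
    then show ?case by simp
  next
    case (insert b B)
    then obtain a where a: "\<And>x c. q x \<noteq> 0 \<Longrightarrow> (\<Sum>b\<in>B. c b *\<^sub>R (\<tau> b x + q x *\<^sub>R a b)) = 0 \<Longrightarrow> (\<forall>b\<in>B. c b = 0)"
      by auto
    let ?E = "euclidean_atlas :: ('eg, 'eg) atlas"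
    let ?AE = "product_atlas A ?E"
    note E = smooth_manifold_euclidean[where 'e='eg]
    note AE = smooth_manifold_product[OF A E]
    let ?W = "{x. q x \<noteq> 0} \<times> (UNIV :: 'eg set)"
    have "{x. q x \<noteq> 0} = q -` (- {0})" by auto
    then have "open {x. q x \<noteq> 0}"
      using continuous_open_preimage[OF smooth_functions_continuous[OF q] open_UNIV, of "- {0}"] by auto
    then have oW: "open ?W" by (rule open_Times[OF _ open_UNIV])
    \<comment> \<open>A relation involving the vector of index \<open>b\<close> is solved for the
      unknown \<open>a b\<close>: every bad choice is a value of \<open>?F\<close> at a point where
      \<open>q\<close> is nonzero, together with coefficients of the other vectors. These are stored
      as one vector of the type of \<open>b\<close>, which accounts for DIM('eg) in the dimension
      count.\<close>
    let ?F = "\<lambda>w. inverse (q (fst w)) *\<^sub>R ((\<Sum>l\<in>B. (snd w \<bullet> l) *\<^sub>R (\<tau> l (fst w) + q (fst w) *\<^sub>R a l)) + (- 1) *\<^sub>R \<tau> b (fst w))"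
    have pull: "smooth_euclidean_on ?AE ?W (\<lambda>w. f (fst w))" if "smooth_euclidean_on A UNIV f" for f :: "'m \<Rightarrow> 'x::euclidean_space"
      by (rule smooth_map_on_compose[OF AE A smooth_manifold_euclidean that smooth_map_on_fst[OF A E] oW open_UNIV]) simp
    note q' = q[unfolded smooth_functions_iff]
    have "smooth_on UNIV (\<lambda>y::'eg. y \<bullet> l)" for l
      by (rule smooth_on_inner_left[OF open_UNIV smooth_on_id[OF open_UNIV]])
    then have inner: "smooth_euclidean_on ?AE ?W (\<lambda>w. snd w \<bullet> l)" for l
      by (rule smooth_euclidean_on_compose[OF AE oW smooth_map_on_snd[OF A E] _ open_UNIV UNIV_I])
    have invq: "smooth_euclidean_on ?AE ?W (\<lambda>w. inverse (q (fst w)))"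
      by (rule smooth_euclidean_on_compose[OF AE oW pull[OF q'], of "- {0}"])
        (auto simp: smooth_on_def C_k_on_inverse)
    have "smooth_euclidean_on ?AE ?W ?F"
      by (rule smooth_euclidean_on_scaleR[OF AE oW invq smooth_euclidean_on_add[OF AE oW
              smooth_euclidean_on_sum[OF AE oW smooth_euclidean_on_scaleR[OF AE oW inner
                smooth_euclidean_on_add[OF AE oW pull[OF \<tau>]
                  smooth_euclidean_on_scaleR[OF AE oW pull[OF q'] smooth_map_on_const[OF AE]]]]]
              smooth_euclidean_on_scaleR[OF AE oW smooth_map_on_const[OF AE] pull[OF \<tau>]]]])
    then have "negligible (?F ` ?W)" by (rule negligible_smooth_image[OF AE _ oW]) (use dim in simp)
    then have "?F ` ?W \<noteq> UNIV" by auto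
    then obtain v where v: "v \<notin> ?F ` ?W" by blast
    have "\<forall>x c. q x \<noteq> 0 \<longrightarrow> (\<Sum>l\<in>insert b B. c l *\<^sub>R (\<tau> l x + q x *\<^sub>R (a(b := v)) l)) = 0 \<longrightarrow>
        (\<forall>l\<in>insert b B. c l = 0)"
    proof (intro allI impI)
      fix x and c :: "'eg \<Rightarrow> real"
      assume qx: "q x \<noteq> 0" and "(\<Sum>l\<in>insert b B. c l *\<^sub>R (\<tau> l x + q x *\<^sub>R (a(b := v)) l)) = 0"
      moreover have "(\<Sum>l\<in>B. c l *\<^sub>R (\<tau> l x + q x *\<^sub>R (a(b := v)) l)) = (\<Sum>l\<in>B. c l *\<^sub>R (\<tau> l x + q x *\<^sub>R a l))"
        by (rule sum.cong) (use insert in auto)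
      ultimately have 0: "c b *\<^sub>R (\<tau> b x + q x *\<^sub>R v) + (\<Sum>l\<in>B. c l *\<^sub>R (\<tau> l x + q x *\<^sub>R a l)) = 0"
        using insert by simp
      have "c b = 0"
      proof (rule ccontr)
        assume cb: "c b \<noteq> 0"
        define c' where "c' = (\<Sum>l\<in>B. (- c l / c b) *\<^sub>R l)"
        have c': "c' \<bullet> l = - c l / c b" if "l \<in> B" for l
        proof -
          have "c' \<bullet> l = (\<Sum>i\<in>B. (- c i / c b) * (i \<bullet> l))" by (simp add: c'_def inner_sum_left)
          also have "\<dots> = (\<Sum>i\<in>B. if i = l then - c i / c b else 0)"
            by (rule sum.cong) (use insert that in \<open>auto simp: inner_Basis subset_iff\<close>)
          finally show ?thesis using insert that by simp
        qed
        have "(\<Sum>l\<in>B. (c' \<bullet> l) *\<^sub>R (\<tau> l x + q x *\<^sub>R a l)) =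
            (- 1 / c b) *\<^sub>R (\<Sum>l\<in>B. c l *\<^sub>R (\<tau> l x + q x *\<^sub>R a l))"
          by (simp add: c' scaleR_sum_right)
        also have "(\<Sum>l\<in>B. c l *\<^sub>R (\<tau> l x + q x *\<^sub>R a l)) = - (c b *\<^sub>R (\<tau> b x + q x *\<^sub>R v))"
          using 0 by (metis add.inverse_unique)
        finally have "(\<Sum>l\<in>B. (c' \<bullet> l) *\<^sub>R (\<tau> l x + q x *\<^sub>R a l)) = \<tau> b x + q x *\<^sub>R v"
          using cb by simp
        then have "v = ?F (x, c')" using qx by simp
        then show False using v qx by blast
      qed
      moreover from this have "\<forall>l\<in>B. c l = 0" using a[OF qx] 0 by simp
      ultimately show "\<forall>l\<in>insert b B. c l = 0" by simp
    qed
    then show ?case by blast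
  qed
qed

text \<open>Independence makes the map \<open>T\<close> from coefficients to combinations injective.
  A linear left inverse recovers the coefficients, and \<open>w j\<close> represents its j-th
  component through the inner product.\<close>

lemma independent_dual_vectors:
  fixes v :: "'eg::euclidean_space \<Rightarrow> 'd::euclidean_space"
  assumes "\<And>c. (\<Sum>b\<in>Basis. c b *\<^sub>R v b) = 0 \<Longrightarrow> (\<forall>b\<in>Basis. c b = 0)"
  obtains w where "\<And>b j. b \<in> Basis \<Longrightarrow> j \<in> Basis \<Longrightarrow> v b \<bullet> w j = (if b = j then 1 else 0)"
proof -
  define T where "T c = (\<Sum>b\<in>Basis. (c \<bullet> b) *\<^sub>R v b)" for c :: 'eg
  have "linear T" unfolding T_def
    by (intro linearI) (simp_all add: inner_add_left scaleR_add_left sum.distrib scaleR_sum_right)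
  moreover have "inj T"
  proof (rule linear_injective_0[THEN iffD2, rule_format, OF \<open>linear T\<close>])
    fix c assume "T c = 0"
    then show "c = 0" using assms[of "\<lambda>b. c \<bullet> b"] by (simp add: T_def euclidean_all_zero_iff)
  qed
  ultimately obtain g where g: "linear g" "g \<circ> T = id" using linear_injective_left_inverse by blast
  define w where "w j = (\<Sum>d\<in>Basis. (g d \<bullet> j) *\<^sub>R d)" for j
  have "v b \<bullet> w j = (if b = j then 1 else 0)" if b: "b \<in> Basis" and j: "j \<in> Basis" for b j
  proof -
    have "v b = T b" using b by (simp add: T_def inner_Basis if_distrib[of "\<lambda>x. x *\<^sub>R _"] cong: if_cong)
    then have "g (v b) = b" using g(2) by (metis comp_apply id_apply)
    moreover have "g (v b) = (\<Sum>d\<in>Basis. (v b \<bullet> d) *\<^sub>R g d)"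
    proof -
      have "g (v b) = g (\<Sum>d\<in>Basis. (v b \<bullet> d) *\<^sub>R d)" by (simp add: euclidean_representation)
      also have "\<dots> = (\<Sum>d\<in>Basis. (v b \<bullet> d) *\<^sub>R g d)" by (simp add: linear_sum[OF g(1)] linear_cmul[OF g(1)])
      finally show ?thesis .
    qed
    ultimately have "b \<bullet> j = (\<Sum>d\<in>Basis. (v b \<bullet> d) *\<^sub>R g d) \<bullet> j" by simp
    then have "b \<bullet> j = v b \<bullet> w j" by (simp add: w_def inner_sum_left inner_sum_right mult.commute)
    then show ?thesis using b j by (simp add: inner_Basis)
  qed
  then show ?thesis by (rule that)
qed

section \<open>Ideals of algebras of sections\<close>

lemma lie_idealD:
  assumes "lie_ideal L br I"
  shows "subspace I" "I \<subseteq> L" "x \<in> L \<Longrightarrow> y \<in> I \<Longrightarrow> br x y \<in> I"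
  using assms unfolding lie_ideal_def by auto

text \<open>The span of the brackets is an ideal because it contains all brackets, and it is nonzero
  because a simple algebra is by definition not abelian.\<close>

lemma simple_lie_algebra_perfect:
  assumes simple: "simple_lie_algebra I br" and cl: "\<And>x y. x \<in> I \<Longrightarrow> y \<in> I \<Longrightarrow> br x y \<in> I" and I: "subspace I"
  shows "span {br x y | x y. x \<in> I \<and> y \<in> I} = I"
proof -
  let ?D = "span {br x y | x y. x \<in> I \<and> y \<in> I}"
  have sub: "?D \<subseteq> I" by (rule span_minimal[OF _ I]) (use cl in auto)
  have "lie_ideal I br ?D"
    unfolding lie_ideal_def
  proof (intro conjI ballI)
    fix x y assume "x \<in> I" "y \<in> ?D"
    then have "br x y \<in> {br x y | x y. x \<in> I \<and> y \<in> I}" using sub by auto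
    then show "br x y \<in> ?D" by (rule span_base)
  qed (use sub in auto)
  moreover obtain x y where xy: "x \<in> I" "y \<in> I" "br x y \<noteq> 0"
    using simple unfolding simple_lie_algebra_def by auto
  have "br x y \<in> ?D" by (rule span_base) (use xy in auto)
  then have "?D \<noteq> {0}" using xy(3) by auto
  ultimately show ?thesis using simple unfolding simple_lie_algebra_def by auto
qed

text \<open>Each simple ideal of the decomposition is spanned by its own brackets. Semisimplicity of
  the group enters the proof through this consequence.\<close>

lemma semisimple_lie_algebra_perfect:
  assumes "semisimple_lie_algebra L br"
  shows "L \<subseteq> span {br x y | x y. x \<in> L \<and> y \<in> L}"
proof -
  obtain S where S: "\<And>I. I \<in> S \<Longrightarrow> lie_ideal L br I \<and> simple_lie_algebra I br" "L = span (\<Union>S)"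
    using assms unfolding semisimple_lie_algebra_def by metis
  have "I \<subseteq> span {br x y | x y. x \<in> L \<and> y \<in> L}" if "I \<in> S" for I
  proof -
    have I: "lie_ideal L br I" "simple_lie_algebra I br" using S(1)[OF that] by auto
    have "br x y \<in> I" if "x \<in> I" "y \<in> I" for x y
      using lie_idealD(3)[OF I(1), of x y] lie_idealD(2)[OF I(1)] that by auto
    then have "I = span {br x y | x y. x \<in> I \<and> y \<in> I}"
      using simple_lie_algebra_perfect[OF I(2) _ lie_idealD(1)[OF I(1)]] by simp
    also have "\<dots> \<subseteq> span {br x y | x y. x \<in> L \<and> y \<in> L}"
      by (rule span_mono) (use lie_idealD(2)[OF I(1)] in auto)
    finally show ?thesis .
  qed
  then have "span (\<Union>S) \<subseteq> span {br x y | x y. x \<in> L \<and> y \<in> L}"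
    by (intro span_minimal) auto
  then show ?thesis using S(2) by simp
qed

lemma finite_codim_mono: "finite_codim L I \<Longrightarrow> I \<subseteq> J \<Longrightarrow> finite_codim L J"
proof -
  assume "finite_codim L I" "I \<subseteq> J"
  then obtain B where B: "finite B" "B \<subseteq> L" "L \<subseteq> span (I \<union> B)" unfolding finite_codim_def by auto
  have "span (I \<union> B) \<subseteq> span (J \<union> B)" by (rule span_mono) (use \<open>I \<subseteq> J\<close> in auto)
  then show "finite_codim L J" unfolding finite_codim_def using B by (intro exI[of _ B]) auto
qed

text \<open>The induction removes one vector \<open>b\<close> from the spanning set
  \<open>B\<close>: enlarging \<open>I\<close> by \<open>b\<close> yields nontrivial combinations
  lying in \<open>I\<close> up to a multiple of \<open>b\<close>, and two of them over disjoint
  ranges of indices allow \<open>b\<close> to be eliminated.\<close>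

lemma finite_codim_dependence:
  fixes v :: "nat \<Rightarrow> 'v::real_vector"
  assumes "finite B" "subspace I" "\<And>n. v n \<in> span (I \<union> B)"
  shows "\<exists>c N. (\<exists>i<N. c i \<noteq> 0) \<and> (\<Sum>i<N. c i *\<^sub>R v i) \<in> I"
  using assms
proof (induction B arbitrary: I v rule: finite_induct)
  case empty
  then have "v 0 \<in> I" by (simp add: span_eq_iff[THEN iffD2])
  then show ?case by (intro exI[of _ "\<lambda>_. 1"] exI[of _ 1]) simp
next
  case (insert b B)
  let ?I = "span (insert b I)"
  have *: "\<exists>c N t. (\<exists>i<N. c i \<noteq> 0) \<and> (\<Sum>i<N. c i *\<^sub>R w i) - t *\<^sub>R b \<in> I" if "\<And>n. w n \<in> span (I \<union> insert b B)"
    for w :: "nat \<Rightarrow> 'v"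
  proof -
    have "span (I \<union> insert b B) \<subseteq> span (?I \<union> B)"
      by (rule span_mono) (auto intro: span_base)
    then have "w n \<in> span (?I \<union> B)" for n using that by auto
    then obtain c N where "\<exists>i<N. c i \<noteq> 0" "(\<Sum>i<N. c i *\<^sub>R w i) \<in> ?I"
      using insert.IH[of ?I w] by auto
    then show ?thesis using insert.prems(1) by (metis span_breakdown_eq span_eq_iff)
  qed
  obtain c N t where c: "\<exists>i<N. c i \<noteq> 0" "(\<Sum>i<N. c i *\<^sub>R v i) - t *\<^sub>R b \<in> I"
    using *[of v] insert.prems(2) by blast
  show ?case
  proof (cases "t = 0")
    case True
    then show ?thesis using c by auto
  next
    case False
    \<comment> \<open>Shifting the sequence by \<open>N\<close> keeps the two combinations on
      disjoint indices, so a nonzero coefficient of the second one survives the elimination.\<close>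
    obtain c' N' t' where c': "\<exists>i<N'. c' i \<noteq> 0" "(\<Sum>i<N'. c' i *\<^sub>R v (N + i)) - t' *\<^sub>R b \<in> I"
      using *[of "\<lambda>i. v (N + i)"] insert.prems(2) by blast
    define d where "d i = (if i < N then - (t' / t) * c i else c' (i - N))" for i
    have "(\<Sum>i<N + N'. d i *\<^sub>R v i) = (\<Sum>i<N. d i *\<^sub>R v i) + (\<Sum>i<N'. d (N + i) *\<^sub>R v (N + i))"
    proof -
      have "(\<Sum>i<N + N'. d i *\<^sub>R v i) = (\<Sum>i<N. d i *\<^sub>R v i) + (\<Sum>i=N..<N + N'. d i *\<^sub>R v i)"
        by (simp add: sum.atLeastLessThan_concat lessThan_atLeast0)
      also have "(\<Sum>i=N..<N + N'. d i *\<^sub>R v i) = (\<Sum>i<N'. d (N + i) *\<^sub>R v (N + i))"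
        using sum.shift_bounds_nat_ivl[of "\<lambda>i. d i *\<^sub>R v i" 0 N N'] by (simp add: lessThan_atLeast0 add.commute)
      finally show ?thesis .
    qed
    also have "\<dots> = - (t' / t) *\<^sub>R (\<Sum>i<N. c i *\<^sub>R v i) + (\<Sum>i<N'. c' i *\<^sub>R v (N + i))"
      by (simp add: d_def scaleR_sum_right sum_negf)
    also have "\<dots> = - (t' / t) *\<^sub>R ((\<Sum>i<N. c i *\<^sub>R v i) - t *\<^sub>R b) + ((\<Sum>i<N'. c' i *\<^sub>R v (N + i)) - t' *\<^sub>R b)"
      using False by (simp add: algebra_simps)
    also have "\<dots> \<in> I"
      by (rule subspace_add[OF insert.prems(1) subspace_scale[OF insert.prems(1) c(2)] c'(2)])
    finally have "(\<Sum>i<N + N'. d i *\<^sub>R v i) \<in> I" .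
    moreover obtain i where "i < N'" "c' i \<noteq> 0" using c'(1) by blast
    then have "N + i < N + N' \<and> d (N + i) \<noteq> 0" by (simp add: d_def)
    ultimately show ?thesis by blast
  qed
qed

text \<open>Sections are represented by their values in the fixed Lie algebra \<open>L\<close>, without any continuity of the chosen
  identifications of the fibers with \<open>L\<close>; smoothness enters only through the module structure and the frames. The
  parameter \<open>frame_type\<close> fixes the type whose basis indexes the frames.\<close>

locale section_algebra =
  fixes AM :: "('m::{t2_space,second_countable_topology}, 'em::euclidean_space) atlas"
    and K :: "('m \<Rightarrow> 'v::real_vector) set" and L :: "'v set" and br :: "'v \<Rightarrow> 'v \<Rightarrow> 'v"
    and frame_type :: "'eg::euclidean_space itself"
  assumes AM: "smooth_manifold AM" and subspace_K: "subspace K" and subspace_L: "subspace L"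
    and br_add_left: "x \<in> L \<Longrightarrow> y \<in> L \<Longrightarrow> z \<in> L \<Longrightarrow> br (x + y) z = br x z + br y z"
    and br_scale_left: "x \<in> L \<Longrightarrow> z \<in> L \<Longrightarrow> br (c *\<^sub>R x) z = c *\<^sub>R br x z"
    and br_skew: "x \<in> L \<Longrightarrow> y \<in> L \<Longrightarrow> br x y = - br y x"
    and value_in: "k \<in> K \<Longrightarrow> k x0 \<in> L"
    and value_surj: "v \<in> L \<Longrightarrow> \<exists>k\<in>K. k x0 = v"
    and scale: "f \<in> smooth_functions AM \<Longrightarrow> k \<in> K \<Longrightarrow> (\<lambda>x. f x *\<^sub>R k x) \<in> K"
    and bracket: "k \<in> K \<Longrightarrow> l \<in> K \<Longrightarrow> (\<lambda>x. br (k x) (l x)) \<in> K"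
    and locally_finite_sum: "(\<And>n. \<rho> n \<in> smooth_functions AM) \<Longrightarrow> (\<And>n. s n \<in> K) \<Longrightarrow> locally_finite_family \<rho> \<Longrightarrow>
      (\<lambda>x. \<Sum>n | \<rho> n x \<noteq> 0. \<rho> n x *\<^sub>R s n x) \<in> K"
    and frame: "\<exists>\<beta> e. \<beta> \<in> smooth_functions AM \<and> \<beta> x0 \<noteq> 0 \<and> (\<forall>b::'eg. e b \<in> K) \<and>
      (\<forall>k\<in>K. \<exists>f. (\<forall>b. f b \<in> smooth_functions AM) \<and> (\<forall>x. k x = 0 \<longrightarrow> (\<forall>b. f b x = 0)) \<and>
        (\<forall>x. \<beta> x *\<^sub>R k x = (\<Sum>b\<in>Basis. f b x *\<^sub>R e b x)))"
    and perfect: "L \<subseteq> span {br x y | x y. x \<in> L \<and> y \<in> L}"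
begin

section \<open>Frames and finite generation\<close>

abbreviation "C \<equiv> smooth_functions AM"
abbreviation "brK \<equiv> (\<lambda>k l x. br (k x) (l x))"

text \<open>A frame where \<open>\<beta>\<close> is nonzero, expressed by global sections and
  functions with \<open>\<beta>\<close> as common denominator. That the coefficients can be taken to
  vanish wherever \<open>k\<close> does plays the part of linear independence when a value at a
  point is turned into coefficients.\<close>

definition frame_on :: "('m \<Rightarrow> real) \<Rightarrow> ('eg \<Rightarrow> 'm \<Rightarrow> 'v) \<Rightarrow> bool"
  where "frame_on \<beta> e \<longleftrightarrow> \<beta> \<in> C \<and> (\<forall>b. e b \<in> K) \<and>
      (\<forall>k\<in>K. \<exists>f. (\<forall>b. f b \<in> C) \<and> (\<forall>x. k x = 0 \<longrightarrow> (\<forall>b. f b x = 0)) \<and>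
        (\<forall>x. \<beta> x *\<^sub>R k x = (\<Sum>b\<in>Basis. f b x *\<^sub>R e b x)))"

lemma frame_onE:
  assumes "frame_on \<beta> e" "k \<in> K"
  obtains f where "\<And>b. f b \<in> C" "\<And>x b. k x = 0 \<Longrightarrow> f b x = 0"
    "\<And>x. \<beta> x *\<^sub>R k x = (\<Sum>b\<in>Basis. f b x *\<^sub>R e b x)"
proof -
  have "\<exists>f. (\<forall>b. f b \<in> C) \<and> (\<forall>x. k x = 0 \<longrightarrow> (\<forall>b. f b x = 0)) \<and>
        (\<forall>x. \<beta> x *\<^sub>R k x = (\<Sum>b\<in>Basis. f b x *\<^sub>R e b x))"
    using assms unfolding frame_on_def by simp
  then show ?thesis using that by auto
qed

lemma frame_onD: "frame_on \<beta> e \<Longrightarrow> \<beta> \<in> C" "frame_on \<beta> e \<Longrightarrow> e b \<in> K"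
  by (simp_all add: frame_on_def)

lemma frame_at:
  obtains \<beta> e where "frame_on \<beta> e" "\<beta> x0 \<noteq> 0"
proof -
  have "\<exists>\<beta> e. frame_on \<beta> e \<and> \<beta> x0 \<noteq> 0"
    using frame[of x0] unfolding frame_on_def by (elim exE conjE) (intro exI conjI; assumption)
  then show ?thesis using that by auto
qed

lemma value_span_frame:
  assumes fr: "frame_on \<beta> e" and "\<beta> x \<noteq> 0" and S: "subspace S" and e: "\<And>b. b \<in> Basis \<Longrightarrow> e b x \<in> S"
  shows "L \<subseteq> S"
proof
  fix v assume "v \<in> L"
  then obtain k where k: "k \<in> K" "k x = v" using value_surj by blast
  obtain f where "\<beta> x *\<^sub>R k x = (\<Sum>b\<in>Basis. f b x *\<^sub>R e b x)" by (rule frame_onE[OF fr k(1)]) blast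
  then have "\<beta> x *\<^sub>R v \<in> S" using k(2) by (simp add: subspace_sum[OF S] subspace_scale[OF S] e)
  then have "inverse (\<beta> x) *\<^sub>R (\<beta> x *\<^sub>R v) \<in> S" by (rule subspace_scale[OF S])
  then show "v \<in> S" using assms(2) by simp
qed

lemma K_sum: "(\<And>i. i \<in> I \<Longrightarrow> k i \<in> K) \<Longrightarrow> (\<lambda>x. \<Sum>i\<in>I. k i x) \<in> K"
proof -
  assume "\<And>i. i \<in> I \<Longrightarrow> k i \<in> K"
  then have "(\<Sum>i\<in>I. k i) \<in> K" by (rule subspace_sum[OF subspace_K])
  moreover have "(\<Sum>i\<in>I. k i) = (\<lambda>x. \<Sum>i\<in>I. k i x)" by (rule ext) (rule sum_fun_apply)
  ultimately show ?thesis by simp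
qed

lemma K_add: "k \<in> K \<Longrightarrow> l \<in> K \<Longrightarrow> (\<lambda>x. k x + l x) \<in> K"
  using subspace_add[OF subspace_K, of k l] by (simp add: plus_fun_def)

lemma K_scaleR: "k \<in> K \<Longrightarrow> (\<lambda>x. c *\<^sub>R k x) \<in> K"
  using subspace_scale[OF subspace_K, of k c] by (simp add: scaleR_fun_def)

lemma K_zero: "(\<lambda>x. 0) \<in> K"
  using subspace_0[OF subspace_K] by (simp add: zero_fun_def)

lemma br_add_right: "x \<in> L \<Longrightarrow> y \<in> L \<Longrightarrow> z \<in> L \<Longrightarrow> br x (y + z) = br x y + br x z"
  using br_skew[of x "y + z"] br_skew[of x y] br_skew[of x z] br_add_left[of y z x] subspace_add[OF subspace_L] by simp

lemma br_scale_right: "x \<in> L \<Longrightarrow> y \<in> L \<Longrightarrow> br x (c *\<^sub>R y) = c *\<^sub>R br x y"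
  using br_skew[of x "c *\<^sub>R y"] br_skew[of x y] br_scale_left[of y x c] subspace_scale[OF subspace_L] by simp

lemma br_zero_left: "x \<in> L \<Longrightarrow> br 0 x = 0"
  using br_scale_left[of 0 x 0] subspace_0[OF subspace_L] by simp

lemma br_zero_right: "x \<in> L \<Longrightarrow> br x 0 = 0"
  using br_scale_right[of x 0 0] subspace_0[OF subspace_L] by simp

lemma br_sum_right:
  assumes "x \<in> L" "\<And>i. i \<in> I \<Longrightarrow> y i \<in> L"
  shows "br x (\<Sum>i\<in>I. c i *\<^sub>R y i) = (\<Sum>i\<in>I. c i *\<^sub>R br x (y i))"
  using assms(2)
proof (induction I rule: infinite_finite_induct)
  case (insert i I)
  have "(\<Sum>i\<in>I. c i *\<^sub>R y i) \<in> L"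
    by (intro subspace_sum[OF subspace_L] subspace_scale[OF subspace_L]) (use insert in auto)
  moreover have "c i *\<^sub>R y i \<in> L" using insert by (intro subspace_scale[OF subspace_L]) auto
  ultimately show ?case using insert assms(1) by (simp add: br_add_right br_scale_right)
qed (simp_all add: br_zero_right assms(1))

text \<open>The new generators \<open>t + \<rho> e a\<close> have coefficient vectors \<open>(\<tau> + \<beta> \<rho> a) / \<beta>\<close> in the frame, which are
  independent for generic \<open>a\<close>.\<close>

lemma generator_step:
  fixes t :: "'d::euclidean_space \<Rightarrow> 'm \<Rightarrow> 'v"
  assumes dim: "DIM('em) + DIM('eg) < DIM('d)" and fr: "frame_on \<beta> e" and \<rho>: "\<rho> \<in> C" "\<And>x. \<rho> x \<noteq> 0 \<Longrightarrow> \<beta> x \<noteq> 0"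
    and t: "\<And>d. t d \<in> K"
  shows "\<exists>a. \<forall>x. \<rho> x \<noteq> 0 \<longrightarrow> L \<subseteq> span ((\<lambda>d. t d x + \<rho> x *\<^sub>R (\<Sum>b\<in>Basis. (a b \<bullet> d) *\<^sub>R e b x)) ` Basis)"
proof -
  have "\<exists>f. (\<forall>b. f b \<in> C) \<and> (\<forall>x. \<beta> x *\<^sub>R t d x = (\<Sum>b\<in>Basis. f b x *\<^sub>R e b x))" for d
    by (rule frame_onE[OF fr t[of d]]) blast
  then obtain f where f: "\<And>d b. f d b \<in> C" "\<And>d x. \<beta> x *\<^sub>R t d x = (\<Sum>b\<in>Basis. f d b x *\<^sub>R e b x)"
    by metis
  \<comment> \<open>\<open>\<tau> b\<close> gathers the coefficients of the b-th frame element in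
    all generators \<open>t d\<close> into one vector. Generators span a fiber as soon as the
    vectors so formed are independent there.\<close>
  define \<tau> where "\<tau> b x = (\<Sum>d\<in>Basis. f d b x *\<^sub>R d)" for b x
  have \<tau>: "smooth_euclidean_on AM UNIV (\<tau> b)" for b
    unfolding \<tau>_def
    by (rule smooth_euclidean_on_sum[OF AM open_UNIV smooth_euclidean_on_scaleR[OF AM open_UNIV
            f(1)[unfolded smooth_functions_iff] smooth_map_on_const[OF AM]]])
  define q where "q x = \<beta> x * \<rho> x" for x
  have q: "q \<in> C" using smooth_functions_mult[OF AM frame_onD(1)[OF fr] \<rho>(1)] by (simp add: q_def[abs_def])
  obtain a where "\<forall>x c. q x \<noteq> 0 \<longrightarrow> (\<Sum>b\<in>Basis. c b *\<^sub>R (\<tau> b x + q x *\<^sub>R a b)) = 0 \<longrightarrow> (\<forall>b\<in>Basis. c b = 0)"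
    by (rule exE[OF generic_independent[OF AM dim q \<tau> order_refl]])
  then have a: "q x \<noteq> 0 \<Longrightarrow> (\<Sum>b\<in>Basis. c b *\<^sub>R (\<tau> b x + q x *\<^sub>R a b)) = 0 \<Longrightarrow> (\<forall>b\<in>Basis. c b = 0)" for x c
    by simp
  have "L \<subseteq> span ((\<lambda>d. t d x + \<rho> x *\<^sub>R (\<Sum>b\<in>Basis. (a b \<bullet> d) *\<^sub>R e b x)) ` Basis)" (is "L \<subseteq> span (?t ` Basis)")
    if "\<rho> x \<noteq> 0" for x
  proof (rule value_span_frame[OF fr \<rho>(2)[OF that] subspace_span])
    fix j :: 'eg assume j: "j \<in> Basis"
    have "q x \<noteq> 0" using that \<rho>(2) by (simp add: q_def)
    let ?v = "\<lambda>b. \<tau> b x + q x *\<^sub>R a b"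
    \<comment> \<open>A vector dual to the perturbed \<open>?v b\<close> lists the coefficients with
      which the generators, scaled by \<open>\<beta> x\<close>, combine to the single frame element
      \<open>e j\<close>.\<close>
    obtain w where w: "\<And>b j. b \<in> Basis \<Longrightarrow> j \<in> Basis \<Longrightarrow> ?v b \<bullet> w j = (if b = j then 1 else 0)"
      using independent_dual_vectors[of ?v] a[OF \<open>q x \<noteq> 0\<close>] by blast
    have vd: "\<beta> x *\<^sub>R ?t d = (\<Sum>b\<in>Basis. (?v b \<bullet> d) *\<^sub>R e b x)" if d: "d \<in> Basis" for d
    proof -
      have "\<tau> b x \<bullet> d = f d b x" for b
        using d by (simp add: \<tau>_def inner_sum_left inner_Basis if_distrib[of "\<lambda>y. _ * y"] cong: if_cong)
      then show ?thesis
        by (simp add: scaleR_add_right f(2) q_def inner_add_left scaleR_add_left sum.distrib scaleR_sum_right mult_ac)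
    qed
    have "(\<Sum>d\<in>Basis. (w j \<bullet> d) *\<^sub>R (\<beta> x *\<^sub>R ?t d)) = (\<Sum>d\<in>Basis. \<Sum>b\<in>Basis. ((w j \<bullet> d) * (?v b \<bullet> d)) *\<^sub>R e b x)"
      by (rule sum.cong[OF refl], subst vd, assumption) (simp only: scaleR_sum_right scaleR_scaleR)
    also have "\<dots> = (\<Sum>b\<in>Basis. \<Sum>d\<in>Basis. ((w j \<bullet> d) * (?v b \<bullet> d)) *\<^sub>R e b x)" by (rule sum.swap)
    also have "\<dots> = (\<Sum>b\<in>Basis. (?v b \<bullet> w j) *\<^sub>R e b x)"
      by (simp only: scaleR_sum_left[symmetric] euclidean_inner[of "?v _" "w j"] mult.commute)
    also have "\<dots> = (\<Sum>b\<in>Basis. (if b = j then 1 else 0) *\<^sub>R e b x)"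
      by (rule sum.cong[OF refl]) (simp only: w j)
    also have "\<dots> = e j x" using j by (simp add: if_distrib[of "\<lambda>y. y *\<^sub>R _"] cong: if_cong)
    finally have "e j x = (\<Sum>d\<in>Basis. (w j \<bullet> d) *\<^sub>R (\<beta> x *\<^sub>R ?t d))" ..
    also have "\<dots> \<in> span (?t ` Basis)"
      by (intro span_sum span_scale span_base imageI)
    finally show "e j x \<in> span (?t ` Basis)" .
  qed
  then show ?thesis by blast
qed

lemma finitely_many_generators:
  obtains t :: "('em \<times> 'eg \<times> real) \<Rightarrow> 'm \<Rightarrow> 'v" where "\<And>d. t d \<in> K" "\<And>x. L \<subseteq> span ((\<lambda>d. t d x) ` Basis)"
proof -
  \<comment> \<open>The factor \<open>real\<close> provides the one dimension in excess that the
    genericity argument requires.\<close>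
  have dim: "DIM('em) + DIM('eg) < DIM('em \<times> 'eg \<times> real)" by simp
  have cover: "\<exists>\<beta>\<in>{\<beta>. \<exists>e. frame_on \<beta> e}. \<beta> x \<noteq> 0" for x by (rule frame_at[of x]) blast
  have "{\<beta>. \<exists>e. frame_on \<beta> e} \<subseteq> C" using frame_onD(1) by auto
  from smooth_functions_countable_cover[OF this cover]
  obtain g where g: "\<And>n::nat. g n \<in> {\<beta>. \<exists>e. frame_on \<beta> e}" "\<And>x. \<exists>n. g n x \<noteq> 0" by blast
  have "\<exists>e. frame_on (g n) e" for n using g(1)[of n] by simp
  then obtain e where e: "\<And>n. frame_on (g n) (e n)" by metis
  obtain h where h: "\<And>n. h n \<in> C" "\<And>n x. h n x \<ge> 0" "\<And>n x. h n x \<noteq> 0 \<Longrightarrow> g n x \<noteq> 0"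
    "\<And>x. \<exists>n. h n x \<noteq> 0" "locally_finite_family h"
    by (rule smooth_functions_locally_finite_refinement[OF AM frame_onD(1)[OF e] g(2)]) blast
  define good where "good t n a \<longleftrightarrow> (\<forall>x. h n x \<noteq> 0 \<longrightarrow>
      L \<subseteq> span ((\<lambda>d. t d x + h n x *\<^sub>R (\<Sum>b\<in>Basis. (a b \<bullet> d) *\<^sub>R e n b x)) ` Basis))"
    for t :: "('em \<times> 'eg \<times> real) \<Rightarrow> 'm \<Rightarrow> 'v" and n and a :: "'eg \<Rightarrow> 'em \<times> 'eg \<times> real"
  define \<alpha> where "\<alpha> t n = (SOME a. good t n a)" for t n
  have \<alpha>: "L \<subseteq> span ((\<lambda>d. t d x + h n x *\<^sub>R (\<Sum>b\<in>Basis. (\<alpha> t n b \<bullet> d) *\<^sub>R e n b x)) ` Basis)"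
    if t: "\<And>d. t d \<in> K" and x: "h n x \<noteq> 0" for t n x
  proof -
    have "\<exists>a. good t n a"
      unfolding good_def by (rule generator_step[OF dim e h(1) h(3) t])
    then have "good t n (\<alpha> t n)" unfolding \<alpha>_def by (rule someI_ex)
    then show ?thesis using x unfolding good_def by simp
  qed
  \<comment> \<open>The coefficients of step n depend on the previous ones through the partial sum,
    so the generators arise by recursion; the choice operator in \<open>\<alpha>\<close> makes the
    step a function.\<close>
  define T where "T = rec_nat (\<lambda>d x. 0) (\<lambda>n t d x. t d x + h n x *\<^sub>R (\<Sum>b\<in>Basis. (\<alpha> t n b \<bullet> d) *\<^sub>R e n b x))"
  have T_0: "T 0 = (\<lambda>d x. 0)" by (simp add: T_def)
  define \<kappa> where "\<kappa> n d x = (\<Sum>b\<in>Basis. (\<alpha> (T n) n b \<bullet> d) *\<^sub>R e n b x)" for n d x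
  have T_Suc: "T (Suc n) = (\<lambda>d x. T n d x + h n x *\<^sub>R \<kappa> n d x)" for n by (simp add: T_def \<kappa>_def)
  have \<kappa>: "\<kappa> n d \<in> K" for n d unfolding \<kappa>_def by (rule K_sum[OF K_scaleR[OF frame_onD(2)[OF e]]])
  have TK: "T n d \<in> K" for n d
    by (induction n) (auto simp: T_0 T_Suc intro: K_zero K_add scale[OF h(1) \<kappa>])
  have T_sum: "T n d x = (\<Sum>i<n. h i x *\<^sub>R \<kappa> i d x)" for n d x
    by (induction n) (simp_all add: T_0 T_Suc)
  define t where "t d x = (\<Sum>n | h n x \<noteq> 0. h n x *\<^sub>R \<kappa> n d x)" for d x
  have "t d \<in> K" for d unfolding t_def by (rule locally_finite_sum[OF h(1) \<kappa> h(5)])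
  moreover have "L \<subseteq> span ((\<lambda>d. t d x) ` Basis)" for x
  proof -
    let ?N = "{n. h n x \<noteq> 0}"
    have fin: "finite ?N" by (rule locally_finite_family_finite[OF h(5)])
    have ne: "?N \<noteq> {}" using h(4)[of x] by simp
    define p where "p = Max ?N"
    have p: "h p x \<noteq> 0" using Max_in[OF fin ne] by (simp add: p_def)
    have "n < Suc p" if "n \<in> ?N" for n using Max_ge[OF fin that] by (simp add: p_def)
    then have "t d x = T (Suc p) d x" for d
      unfolding t_def T_sum by (intro sum.mono_neutral_left) auto
    then have "(\<lambda>d. t d x) = (\<lambda>d. T p d x + h p x *\<^sub>R (\<Sum>b\<in>Basis. (\<alpha> (T p) p b \<bullet> d) *\<^sub>R e p b x))"
      by (simp add: T_Suc \<kappa>_def)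
    then show ?thesis using \<alpha>[of "T p", OF TK p] by (simp only:)
  qed
  ultimately show ?thesis by (rule that)
qed

text \<open>A form of Nakayama's lemma; the elements of a frame are eliminated one after the other.\<close>

lemma submodule_full_fiber:
  assumes S_add: "\<And>k l. k \<in> S \<Longrightarrow> l \<in> S \<Longrightarrow> (\<lambda>x. k x + l x) \<in> S"
    and S_scale: "\<And>f k. f \<in> C \<Longrightarrow> k \<in> S \<Longrightarrow> (\<lambda>x. f x *\<^sub>R k x) \<in> S"
    and S_zero: "(\<lambda>x. 0) \<in> S" and SK: "S \<subseteq> K" and full: "\<And>v. v \<in> L \<Longrightarrow> \<exists>k\<in>S. k m = v"
  shows "\<exists>\<theta>\<in>C. \<theta> m \<noteq> 0 \<and> (\<forall>k\<in>K. (\<lambda>x. \<theta> x *\<^sub>R k x) \<in> S)"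
proof -
  obtain \<beta> e where fr: "frame_on \<beta> e" and \<beta>m: "\<beta> m \<noteq> 0" by (rule frame_at)
  note \<beta> = frame_onD(1)[OF fr] and e = frame_onD(2)[OF fr]
  have S_sum: "(\<lambda>x. \<Sum>i\<in>I. k i x) \<in> S" if "\<And>i. i \<in> I \<Longrightarrow> k i \<in> S" for I :: "'eg set" and k
    using that by (induction I rule: infinite_finite_induct) (auto intro: S_zero S_add)
  \<comment> \<open>The hypothesis expresses each frame element, up to a multiplier nonzero at
    \<open>m\<close>, by an element of \<open>S\<close> and frame elements with coefficients
    vanishing at \<open>m\<close>. Eliminating one index preserves this form for the others.\<close>
  have elim: "\<exists>\<theta>\<in>C. \<theta> m \<noteq> 0 \<and> (\<forall>b\<in>F. (\<lambda>x. \<theta> x *\<^sub>R e b x) \<in> S)"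
    if "finite F" and "\<And>b. b \<in> F \<Longrightarrow> \<exists>u\<in>C. u m \<noteq> 0 \<and> (\<exists>s\<in>S. \<exists>f. (\<forall>b'. f b' \<in> C \<and> f b' m = 0) \<and>
      (\<forall>x. u x *\<^sub>R e b x = s x + (\<Sum>b'\<in>F. f b' x *\<^sub>R e b' x)))" for F
    using that
  proof (induction F rule: finite_induct)
    case empty
    show ?case by (rule bexI[of _ "\<lambda>x. 1"]) (simp_all add: AM)
  next
    case (insert c F)
    obtain u s f where u: "u \<in> C" "u m \<noteq> 0" and s: "s \<in> S" and f: "\<And>b'. f b' \<in> C" "\<And>b'. f b' m = 0"
      and eq: "\<And>x. u x *\<^sub>R e c x = s x + (\<Sum>b'\<in>insert c F. f b' x *\<^sub>R e b' x)"
      using insert.prems[of c] by auto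
    \<comment> \<open>Collecting the terms with \<open>e c\<close> leaves the multiplier
      \<open>u - f c\<close>, still nonzero at \<open>m\<close> because \<open>f c\<close> vanishes
      there.\<close>
    define w where "w x = u x - f c x" for x
    have w: "w \<in> C" "w m \<noteq> 0" using smooth_functions_diff[OF AM u(1) f(1)] u(2) f(2) by (simp_all add: w_def[abs_def])
    have weq: "w x *\<^sub>R e c x = s x + (\<Sum>b'\<in>F. f b' x *\<^sub>R e b' x)" for x
      using eq[of x] insert.hyps by (simp add: w_def scaleR_diff_left)
    have "\<exists>u\<in>C. u m \<noteq> 0 \<and> (\<exists>s\<in>S. \<exists>f. (\<forall>b'. f b' \<in> C \<and> f b' m = 0) \<and>
        (\<forall>x. u x *\<^sub>R e b x = s x + (\<Sum>b'\<in>F. f b' x *\<^sub>R e b' x)))" if b: "b \<in> F" for b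
    proof -
      obtain u' s' f' where u': "u' \<in> C" "u' m \<noteq> 0" and s': "s' \<in> S" and f': "\<And>b'. f' b' \<in> C" "\<And>b'. f' b' m = 0"
        and eq': "\<And>x. u' x *\<^sub>R e b x = s' x + (\<Sum>b'\<in>insert c F. f' b' x *\<^sub>R e b' x)"
        using insert.prems[of b] b by auto
      let ?u = "\<lambda>x. w x * u' x" and ?s = "\<lambda>x. w x *\<^sub>R s' x + f' c x *\<^sub>R s x"
        and ?f = "\<lambda>b' x. w x * f' b' x + f' c x * f b' x"
      have "?u x *\<^sub>R e b x = ?s x + (\<Sum>b'\<in>F. ?f b' x *\<^sub>R e b' x)" for x
      proof -
        have "?u x *\<^sub>R e b x = w x *\<^sub>R (s' x + (f' c x *\<^sub>R e c x + (\<Sum>b'\<in>F. f' b' x *\<^sub>R e b' x)))"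
          using eq'[of x] insert.hyps by (simp flip: scaleR_scaleR)
        also have "\<dots> = w x *\<^sub>R s' x + f' c x *\<^sub>R (w x *\<^sub>R e c x) + w x *\<^sub>R (\<Sum>b'\<in>F. f' b' x *\<^sub>R e b' x)"
          by (simp add: scaleR_add_right mult.commute)
        also have "\<dots> = ?s x + (\<Sum>b'\<in>F. ?f b' x *\<^sub>R e b' x)"
          by (simp add: weq scaleR_add_right scaleR_add_left scaleR_sum_right sum.distrib)
        finally show ?thesis .
      qed
      moreover have "?u \<in> C" "?u m \<noteq> 0" using smooth_functions_mult[OF AM w(1) u'(1)] w(2) u'(2) by simp_all
      moreover have "?s \<in> S" by (rule S_add[OF S_scale[OF w(1) s'] S_scale[OF f'(1) s]])
      moreover have "?f b' \<in> C \<and> ?f b' m = 0" for b'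
        using smooth_functions_add[OF AM smooth_functions_mult[OF AM w(1) f'(1)] smooth_functions_mult[OF AM f'(1) f(1)]]
          f(2) f'(2) by simp
      ultimately show ?thesis by (intro bexI[of _ ?u] conjI bexI[of _ ?s] exI[of _ ?f]) simp_all
    qed
    then obtain \<theta> where \<theta>: "\<theta> \<in> C" "\<theta> m \<noteq> 0" "\<And>b. b \<in> F \<Longrightarrow> (\<lambda>x. \<theta> x *\<^sub>R e b x) \<in> S"
      using insert.IH by auto
    let ?\<theta> = "\<lambda>x. w x * \<theta> x"
    have "(\<lambda>x. ?\<theta> x *\<^sub>R e b x) \<in> S" if "b \<in> F" for b
      using S_scale[OF w(1) \<theta>(3)[OF that]] by simp
    moreover have "(\<lambda>x. \<theta> x *\<^sub>R s x + (\<Sum>b'\<in>F. f b' x *\<^sub>R (\<theta> x *\<^sub>R e b' x))) \<in> S"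
      by (rule S_add[OF S_scale[OF \<theta>(1) s] S_sum[OF S_scale[OF f(1) \<theta>(3)]]])
    moreover have "\<theta> x *\<^sub>R s x + (\<Sum>b'\<in>F. f b' x *\<^sub>R (\<theta> x *\<^sub>R e b' x)) = ?\<theta> x *\<^sub>R e c x" for x
    proof -
      have "?\<theta> x *\<^sub>R e c x = \<theta> x *\<^sub>R (w x *\<^sub>R e c x)" by (simp add: mult.commute)
      then show ?thesis by (simp add: weq scaleR_add_right scaleR_sum_right mult.commute)
    qed
    ultimately have "\<forall>b\<in>insert c F. (\<lambda>x. ?\<theta> x *\<^sub>R e b x) \<in> S" by simp
    then show ?case using smooth_functions_mult[OF AM w(1) \<theta>(1)] w(2) \<theta>(2) by (intro bexI[of _ ?\<theta>]) simp_all
  qed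
  have "\<exists>\<theta>\<in>C. \<theta> m \<noteq> 0 \<and> (\<forall>b\<in>Basis. (\<lambda>x. \<theta> x *\<^sub>R e b x) \<in> S)"
  proof (rule elim[OF finite_Basis])
    fix b :: 'eg
    \<comment> \<open>\<open>S\<close> contains a section with the value of \<open>e b\<close> at
      \<open>m\<close>. The difference vanishes at \<open>m\<close>, hence so do its frame
      coefficients: this starts the elimination.\<close>
    obtain s where s: "s \<in> S" "s m = e b m" using full[OF value_in[OF e]] by blast
    have "(\<lambda>x. e b x + (- 1) *\<^sub>R s x) \<in> K" using s SK by (intro K_add e K_scaleR) auto
    then obtain f where f: "\<And>b'. f b' \<in> C" "\<And>x b'. e b x + (- 1) *\<^sub>R s x = 0 \<Longrightarrow> f b' x = 0"
      "\<And>x. \<beta> x *\<^sub>R (e b x + (- 1) *\<^sub>R s x) = (\<Sum>b'\<in>Basis. f b' x *\<^sub>R e b' x)"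
      by (rule frame_onE[OF fr]) blast
    have "\<beta> x *\<^sub>R e b x = \<beta> x *\<^sub>R s x + (\<Sum>b'\<in>Basis. f b' x *\<^sub>R e b' x)" for x
      using f(3)[of x] by (simp add: scaleR_diff_right algebra_simps)
    moreover have "(\<lambda>x. \<beta> x *\<^sub>R s x) \<in> S" by (rule S_scale[OF \<beta> s(1)])
    moreover have "f b' m = 0" for b' using f(2)[of m b'] s(2) by simp
    ultimately show "\<exists>u\<in>C. u m \<noteq> 0 \<and> (\<exists>s\<in>S. \<exists>f. (\<forall>b'. f b' \<in> C \<and> f b' m = 0) \<and>
        (\<forall>x. u x *\<^sub>R e b x = s x + (\<Sum>b'\<in>Basis. f b' x *\<^sub>R e b' x)))"
      using \<beta> \<beta>m f(1) by (intro bexI[of _ \<beta>] conjI bexI[of _ "\<lambda>x. \<beta> x *\<^sub>R s x"] exI[of _ f]) simp_all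
  qed
  then obtain \<theta> where \<theta>: "\<theta> \<in> C" "\<theta> m \<noteq> 0" "\<And>b. b \<in> Basis \<Longrightarrow> (\<lambda>x. \<theta> x *\<^sub>R e b x) \<in> S" by auto
  have "(\<lambda>x. (\<theta> x * \<beta> x) *\<^sub>R k x) \<in> S" if k: "k \<in> K" for k
  proof -
    obtain f where f: "\<And>b'. f b' \<in> C" "\<And>x. \<beta> x *\<^sub>R k x = (\<Sum>b'\<in>Basis. f b' x *\<^sub>R e b' x)"
      by (rule frame_onE[OF fr k]) blast
    have "(\<lambda>x. \<Sum>b\<in>Basis. f b x *\<^sub>R (\<theta> x *\<^sub>R e b x)) \<in> S" by (rule S_sum[OF S_scale[OF f(1) \<theta>(3)]])
    moreover have "(\<theta> x * \<beta> x) *\<^sub>R k x = (\<Sum>b\<in>Basis. f b x *\<^sub>R (\<theta> x *\<^sub>R e b x))" for x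
      using f(2)[of x] by (simp flip: scaleR_scaleR) (simp add: scaleR_sum_right mult.commute)
    ultimately show ?thesis by simp
  qed
  then show ?thesis
    using smooth_functions_mult[OF AM \<theta>(1) \<beta>] \<theta>(2) \<beta>m by (intro bexI[of _ "\<lambda>x. \<theta> x * \<beta> x"]) simp_all
qed

end

context section_algebra
begin

text \<open>For fixed generators \<open>t\<close>, the sums \<open>\<Sum> [t d, c d]\<close> form a submodule with full fibers, so locally they are
  everything. The number of terms being fixed, they can be glued with a locally finite family.\<close>

lemma sections_perfect: "K \<subseteq> span {brK k l | k l. k \<in> K \<and> l \<in> K}"
proof -
  obtain t :: "('em \<times> 'eg \<times> real) \<Rightarrow> 'm \<Rightarrow> 'v" where t: "\<And>d. t d \<in> K" "\<And>x. L \<subseteq> span ((\<lambda>d. t d x) ` Basis)"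
    by (rule finitely_many_generators) blast
  let ?B = "Basis :: ('em \<times> 'eg \<times> real) set"
  define S where "S = {k. \<exists>c. (\<forall>d. c d \<in> K) \<and> (\<forall>x. k x = (\<Sum>d\<in>?B. br (t d x) (c d x)))}"
  note tL = value_in[OF t(1)]
  have SI: "k \<in> S" if "\<And>d. c d \<in> K" "\<And>x. k x = (\<Sum>d\<in>?B. br (t d x) (c d x))" for k c
    using that unfolding S_def by blast
  have SE: "\<exists>c. (\<forall>d. c d \<in> K) \<and> (\<forall>x. k x = (\<Sum>d\<in>?B. br (t d x) (c d x)))" if "k \<in> S" for k
    using that unfolding S_def by simp
  have S_add: "(\<lambda>x. k x + l x) \<in> S" if k: "k \<in> S" and l: "l \<in> S" for k l
  proof -
    obtain c c' where c: "\<And>d. c d \<in> K" "\<And>x. k x = (\<Sum>d\<in>?B. br (t d x) (c d x))"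
      and c': "\<And>d. c' d \<in> K" "\<And>x. l x = (\<Sum>d\<in>?B. br (t d x) (c' d x))"
      using SE[OF k] SE[OF l] by auto
    show ?thesis
      by (rule SI[of "\<lambda>d x. c d x + c' d x"])
        (simp_all add: K_add c c' br_add_right tL value_in sum.distrib)
  qed
  have S_scale: "(\<lambda>x. f x *\<^sub>R k x) \<in> S" if f: "f \<in> C" and k: "k \<in> S" for f k
  proof -
    obtain c where c: "\<And>d. c d \<in> K" "\<And>x. k x = (\<Sum>d\<in>?B. br (t d x) (c d x))"
      using SE[OF k] by auto
    show ?thesis
      by (rule SI[of "\<lambda>d x. f x *\<^sub>R c d x"])
        (simp_all add: scale f c br_scale_right tL value_in scaleR_sum_right)
  qed
  have S_zero: "(\<lambda>x. 0) \<in> S"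
    by (rule SI[of "\<lambda>d x. 0"]) (simp_all add: K_zero br_zero_right tL)
  have SK: "S \<subseteq> K"
  proof
    fix k assume "k \<in> S"
    then obtain c where c: "\<And>d. c d \<in> K" "\<And>x. k x = (\<Sum>d\<in>?B. br (t d x) (c d x))" using SE by blast
    have "k = (\<lambda>x. \<Sum>d\<in>?B. br (t d x) (c d x))" by (rule ext) (rule c(2))
    moreover have "(\<lambda>x. \<Sum>d\<in>?B. br (t d x) (c d x)) \<in> K" by (rule K_sum[OF bracket[OF t(1) c(1)]])
    ultimately show "k \<in> K" by simp
  qed
  have full: "\<exists>k\<in>S. k m = v" if "v \<in> L" for v m
  proof -
    let ?V = "(\<lambda>k. k m) ` S"
    have V: "subspace ?V"
    proof (rule subspaceI)
      show "0 \<in> ?V" using S_zero by (intro image_eqI[of _ _ "\<lambda>x. 0"]) simp_all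
      show "a + b \<in> ?V" if ab: "a \<in> ?V" "b \<in> ?V" for a b
      proof -
        obtain k l where "k \<in> S" "a = k m" "l \<in> S" "b = l m" using ab by auto
        then show ?thesis using S_add[of k l] by (intro image_eqI[of _ _ "\<lambda>x. k x + l x"]) simp_all
      qed
      show "r *\<^sub>R a \<in> ?V" if a: "a \<in> ?V" for r a
      proof -
        obtain k where "k \<in> S" "a = k m" using a by auto
        then show ?thesis
          using S_scale[OF smooth_functions_const[OF AM], of k r] by (intro image_eqI[of _ _ "\<lambda>x. r *\<^sub>R k x"]) simp_all
      qed
    qed
    have "br x y \<in> ?V" if x: "x \<in> L" and y: "y \<in> L" for x y
    proof -
      obtain l where l: "l \<in> K" "l m = y" using value_surj[OF y] by blast
      \<comment> \<open>For fixed y the first entry may be restricted to a spanning set of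
        \<open>L\<close>, namely the values of the generators at \<open>m\<close>.\<close>
      let ?X = "{x. x \<in> L \<and> br x y \<in> ?V}"
      have "subspace ?X"
        using V subspace_L y
        by (intro subspaceI) (auto simp: subspace_0 br_zero_left subspace_add br_add_left subspace_scale br_scale_left)
      moreover have "(\<lambda>d. t d m) ` ?B \<subseteq> ?X"
      proof
        fix z assume "z \<in> (\<lambda>d. t d m) ` ?B"
        then obtain d where d: "d \<in> ?B" "z = t d m" by auto
        have "(\<lambda>x. br (t d x) (l x)) \<in> S"
        proof (rule SI[of "\<lambda>d'. if d' = d then l else (\<lambda>x. 0)"])
          show "br (t d x) (l x) = (\<Sum>d'\<in>?B. br (t d' x) ((if d' = d then l else (\<lambda>x. 0)) x))" for x
          proof -
            have "(\<Sum>d'\<in>?B. br (t d' x) ((if d' = d then l else (\<lambda>x. 0)) x)) = (\<Sum>d'\<in>?B. if d' = d then br (t d' x) (l x) else 0)"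
              by (rule sum.cong) (simp_all add: br_zero_right tL)
            then show ?thesis using d(1) by simp
          qed
        qed (simp add: l K_zero)
        then have "br z y \<in> ?V" using d l by (intro image_eqI[of _ _ "\<lambda>x. br (t d x) (l x)"]) simp_all
        then show "z \<in> ?X" using d tL by simp
      qed
      ultimately have "span ((\<lambda>d. t d m) ` ?B) \<subseteq> ?X" by (rule span_minimal[rotated])
      then show ?thesis using t(2)[of m] x by blast
    qed
    then have "span {br x y | x y. x \<in> L \<and> y \<in> L} \<subseteq> ?V" by (intro span_minimal[OF _ V]) auto
    then have "v \<in> ?V" using perfect that by blast
    then show ?thesis by auto
  qed
  have KS: "k \<in> S" if k: "k \<in> K" for k
  proof -
    let ?Q = "{\<theta>\<in>C. \<forall>k\<in>K. (\<lambda>x. \<theta> x *\<^sub>R k x) \<in> S}"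
    have Q: "?Q \<subseteq> C" by auto
    have cover: "\<exists>\<theta>\<in>?Q. \<theta> m \<noteq> 0" for m
    proof -
      have "\<exists>\<theta>\<in>C. \<theta> m \<noteq> 0 \<and> (\<forall>k\<in>K. (\<lambda>x. \<theta> x *\<^sub>R k x) \<in> S)"
        by (rule submodule_full_fiber[OF S_add S_scale S_zero SK full])
      then obtain \<theta> where "\<theta> \<in> C" "\<theta> m \<noteq> 0" "\<forall>k\<in>K. (\<lambda>x. \<theta> x *\<^sub>R k x) \<in> S" by (elim bexE conjE)
      then show ?thesis by (intro bexI[of _ \<theta>]) simp_all
    qed
    obtain g where g: "\<And>n::nat. g n \<in> ?Q" "\<And>x. \<exists>n. g n x \<noteq> 0"
      by (rule smooth_functions_countable_cover[OF Q cover]) (rule that; assumption)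
    have gC: "g n \<in> C" for n using g(1)[of n] by simp
    obtain h where h: "\<And>n. h n \<in> C" "\<And>n x. h n x \<ge> 0" "\<And>n x. h n x \<noteq> 0 \<Longrightarrow> g n x \<noteq> 0"
      "\<And>x. \<exists>n. h n x \<noteq> 0" "locally_finite_family h"
      by (rule smooth_functions_locally_finite_refinement[OF AM gC g(2)]) blast
    have "\<exists>c. (\<forall>d. c d \<in> K) \<and> (\<forall>x. g n x *\<^sub>R k x = (\<Sum>d\<in>?B. br (t d x) (c d x)))" for n
      using SE[of "\<lambda>x. g n x *\<^sub>R k x"] g(1)[of n] k by simp
    then obtain c where c: "\<And>n d. c n d \<in> K" "\<And>n x. g n x *\<^sub>R k x = (\<Sum>d\<in>?B. br (t d x) (c n d x))"
      by metis
    \<comment> \<open>\<open>c n\<close> represents \<open>g n\<close> times \<open>k\<close>, so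
      the weights must make the sum of \<open>\<sigma> n * g n\<close> equal to 1. With
      \<open>\<sigma> n = h n * g n / R\<close> this forces \<open>R\<close> to be the sum of
      \<open>h n * (g n)\<^sup>2\<close>, which is positive.\<close>
    define R where "R x = (\<Sum>n | h n x \<noteq> 0. h n x * (g n x)\<^sup>2)" for x
    have R: "R \<in> C" unfolding R_def
      by (rule smooth_functions_locally_finite_sum[OF AM h(1) smooth_functions_power[OF AM gC] h(5)])
    have R_pos: "R x > 0" for x
      unfolding R_def
    proof (rule sum_pos)
      show "finite {n. h n x \<noteq> 0}" by (rule locally_finite_family_finite[OF h(5)])
      show "{n. h n x \<noteq> 0} \<noteq> {}" using h(4)[of x] by simp
      show "0 < h n x * (g n x)\<^sup>2" if "n \<in> {n. h n x \<noteq> 0}" for n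
        using that h(2)[of n x] h(3)[of n x] by simp
    qed
    define \<sigma> where "\<sigma> n x = h n x * (g n x * inverse (R x))" for n x
    have Rinv: "(\<lambda>x. inverse (R x)) \<in> C" by (rule smooth_functions_inverse[OF AM R]) (metis R_pos less_irrefl)
    have \<sigma>: "\<sigma> n \<in> C" for n
      unfolding \<sigma>_def by (rule smooth_functions_mult[OF AM h(1) smooth_functions_mult[OF AM gC Rinv]])
    have \<sigma>_lf: "locally_finite_family \<sigma>"
      by (rule locally_finite_family_subset[OF h(5)]) (simp add: \<sigma>_def)
    have \<sigma>_iff: "\<sigma> n x \<noteq> 0 \<longleftrightarrow> h n x \<noteq> 0" for n x using h(3)[of n x] R_pos[of x] by (auto simp: \<sigma>_def)
    show ?thesis
    proof (rule SI[of "\<lambda>d x. \<Sum>n | \<sigma> n x \<noteq> 0. \<sigma> n x *\<^sub>R c n d x"])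
      show "(\<lambda>x. \<Sum>n | \<sigma> n x \<noteq> 0. \<sigma> n x *\<^sub>R c n d x) \<in> K" for d
        by (rule locally_finite_sum[OF \<sigma> c(1) \<sigma>_lf])
      fix x
      let ?N = "{n. \<sigma> n x \<noteq> 0}"
      have "(\<Sum>d\<in>?B. br (t d x) (\<Sum>n\<in>?N. \<sigma> n x *\<^sub>R c n d x)) =
          (\<Sum>d\<in>?B. \<Sum>n\<in>?N. \<sigma> n x *\<^sub>R br (t d x) (c n d x))"
        by (rule sum.cong[OF refl]) (rule br_sum_right[OF tL value_in[OF c(1)]])
      also have "\<dots> = (\<Sum>n\<in>?N. \<sigma> n x *\<^sub>R (g n x *\<^sub>R k x))"
        by (subst sum.swap) (simp only: c(2) scaleR_sum_right)
      also have "\<dots> = (\<Sum>n\<in>?N. \<sigma> n x * g n x) *\<^sub>R k x"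
        by (simp add: scaleR_sum_left)
      also have "(\<Sum>n\<in>?N. \<sigma> n x * g n x) = R x * inverse (R x)"
        unfolding \<sigma>_iff by (simp add: R_def \<sigma>_def sum_distrib_right power2_eq_square mult_ac)
      also have "\<dots> = 1" using R_pos[of x] by simp
      finally show "k x = (\<Sum>d\<in>?B. br (t d x) (\<Sum>n\<in>?N. \<sigma> n x *\<^sub>R c n d x))" by simp
    qed
  qed
  show ?thesis
  proof
    fix k assume "k \<in> K"
    then obtain c where c: "\<And>d. c d \<in> K" "\<And>x. k x = (\<Sum>d\<in>?B. br (t d x) (c d x))" using SE[OF KS] by blast
    have "k = (\<Sum>d\<in>?B. brK (t d) (c d))" by (rule ext) (simp only: c(2) sum_fun_apply)
    moreover have "(\<Sum>d\<in>?B. brK (t d) (c d)) \<in> span {brK k l | k l. k \<in> K \<and> l \<in> K}"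
      by (intro span_sum span_base) (use t(1) c(1) in blast)
    ultimately show "k \<in> span {brK k l | k l. k \<in> K \<and> l \<in> K}" by simp
  qed
qed

lemma poly_smooth: "f \<in> C \<Longrightarrow> (\<lambda>x. poly p (f x)) \<in> C"
proof (induction p)
  case 0
  then show ?case using AM by simp
next
  case (pCons a p)
  then show ?case
    using smooth_functions_add[OF AM smooth_functions_const[OF AM] smooth_functions_mult[OF AM pCons.prems pCons.IH]]
    by simp
qed

section \<open>Ideals determined at one point\<close>

definition fiber_ideal :: "'m \<Rightarrow> 'v set \<Rightarrow> ('m \<Rightarrow> 'v) set"
  where "fiber_ideal m g = {k \<in> K. k m \<in> g}"

lemma fiber_ideal_ideal:
  assumes g: "lie_ideal L br g"
  shows "lie_ideal K brK (fiber_ideal m g)"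
  unfolding lie_ideal_def
proof (intro conjI ballI)
  note gs = lie_idealD(1)[OF g]
  show "subspace (fiber_ideal m g)"
    by (rule subspaceI)
      (simp_all add: fiber_ideal_def subspace_0[OF subspace_K] subspace_0[OF gs] subspace_add[OF subspace_K]
        subspace_add[OF gs] subspace_scale[OF subspace_K] subspace_scale[OF gs] scaleR_fun_def[of _ "_ :: 'm \<Rightarrow> 'v", symmetric],
       simp add: scaleR_fun_def subspace_scale[OF gs])
  show "fiber_ideal m g \<subseteq> K" by (auto simp: fiber_ideal_def)
  show "brK k l \<in> fiber_ideal m g" if "k \<in> K" "l \<in> fiber_ideal m g" for k l
    using that bracket[of k l] lie_idealD(3)[OF g value_in[of k m]] by (simp add: fiber_ideal_def)
qed

text \<open>Freezing the frame coefficients of \<open>k\<close> at \<open>m\<close> gives a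
  combination of finitely many frame sections with the same value at \<open>m\<close>; the
  difference vanishes there.\<close>

lemma fiber_ideal_finite_codim:
  assumes g: "subspace g"
  shows "finite_codim K (fiber_ideal m g)"
proof -
  obtain \<beta> e where fr: "frame_on \<beta> e" and m: "\<beta> m \<noteq> 0" by (rule frame_at)
  note e = frame_onD(2)[OF fr]
  have "K \<subseteq> span (fiber_ideal m g \<union> e ` Basis)" (is "_ \<subseteq> span ?U")
  proof
    fix k assume k: "k \<in> K"
    obtain f where f: "\<And>x. \<beta> x *\<^sub>R k x = (\<Sum>b\<in>Basis. f b x *\<^sub>R e b x)" by (rule frame_onE[OF fr k]) blast
    let ?l = "\<Sum>b\<in>Basis. (f b m / \<beta> m) *\<^sub>R e b"
    have l: "?l \<in> K" by (intro subspace_sum[OF subspace_K] subspace_scale[OF subspace_K] e)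
    have "?l m = inverse (\<beta> m) *\<^sub>R (\<beta> m *\<^sub>R k m)"
      unfolding f by (simp add: sum_fun_apply scaleR_fun_def scaleR_sum_right divide_inverse mult.commute)
    then have "(k - ?l) m = 0" using m by simp
    then have "k - ?l \<in> fiber_ideal m g"
      using subspace_diff[OF subspace_K k l] subspace_0[OF g] by (simp add: fiber_ideal_def)
    then have "k - ?l \<in> span ?U" by (intro span_base) simp
    moreover have "?l \<in> span ?U" by (intro span_sum span_scale span_base) auto
    ultimately have "(k - ?l) + ?l \<in> span ?U" by (rule span_add)
    then show "k \<in> span ?U" by simp
  qed
  then show ?thesis unfolding finite_codim_def using e by (intro exI[of _ "e ` Basis"]) auto
qed

text \<open>Evaluation at \<open>m\<close> maps a larger ideal \<open>J\<close> to an ideal of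
  \<open>L\<close> above \<open>g\<close>, by surjectivity. As \<open>J\<close> contains the
  sections vanishing at \<open>m\<close>, it is the full preimage of that image, so maximality of
  \<open>g\<close> leaves no room.\<close>

lemma fiber_ideal_maximal:
  assumes g: "maximal_lie_ideal L br g"
  shows "maximal_finite_codim_lie_ideal K brK (fiber_ideal m g)"
  unfolding maximal_finite_codim_lie_ideal_def
proof (intro conjI notI)
  have gi: "lie_ideal L br g" and gL: "g \<noteq> L"
    and g_max: "\<And>J. lie_ideal L br J \<Longrightarrow> J \<noteq> L \<Longrightarrow> \<not> g \<subset> J"
    using g unfolding maximal_lie_ideal_def by auto
  show "lie_ideal K brK (fiber_ideal m g)" by (rule fiber_ideal_ideal[OF gi])
  show "finite_codim K (fiber_ideal m g)" by (rule fiber_ideal_finite_codim[OF lie_idealD(1)[OF gi]])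
  show False if eq: "fiber_ideal m g = K"
  proof -
    have "v \<in> g" if "v \<in> L" for v using value_surj[OF that, of m] eq by (auto simp: fiber_ideal_def)
    then show False using gL lie_idealD(2)[OF gi] by blast
  qed
  assume "\<exists>J. lie_ideal K brK J \<and> finite_codim K J \<and> J \<noteq> K \<and> fiber_ideal m g \<subset> J"
  then obtain J where J: "lie_ideal K brK J" "J \<noteq> K" "fiber_ideal m g \<subset> J" by blast
  note Js = lie_idealD(1)[OF J(1)] and JK = lie_idealD(2)[OF J(1)]
  let ?V = "(\<lambda>k. k m) ` J"
  have V: "lie_ideal L br ?V"
    unfolding lie_ideal_def
  proof (intro conjI ballI)
    have "linear (\<lambda>k :: 'm \<Rightarrow> 'v. k m)" by (rule linearI) (simp_all add: scaleR_fun_def)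
    then show "subspace ?V" using Js by (rule linear_subspace_image)
    show "?V \<subseteq> L" using JK value_in by auto
    show "br x y \<in> ?V" if x: "x \<in> L" and y: "y \<in> ?V" for x y
    proof -
      obtain k l where k: "k \<in> K" "k m = x" and l: "l \<in> J" "l m = y" using value_surj[OF x, of m] y by auto
      then show ?thesis using lie_idealD(3)[OF J(1) k(1) l(1)] by (intro image_eqI[of _ _ "brK k l"]) simp_all
    qed
  qed
  have J_full: "k \<in> J" if k: "k \<in> K" and kV: "k m \<in> ?V" for k
  proof -
    obtain l where l: "l \<in> J" "k m = l m" using kV by auto
    then have "k - l \<in> fiber_ideal m g"
      using subspace_diff[OF subspace_K k, of l] JK subspace_0[OF lie_idealD(1)[OF gi]] by (auto simp: fiber_ideal_def)
    then have "(k - l) + l \<in> J" using J(3) by (intro subspace_add[OF Js _ l(1)]) auto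
    then show ?thesis by simp
  qed
  have "?V \<noteq> L"
  proof
    assume "?V = L"
    then have "K \<subseteq> J" using J_full value_in by blast
    then show False using J(2) JK by blast
  qed
  moreover have "g \<subset> ?V"
  proof
    show "g \<subseteq> ?V"
    proof
      fix v assume v: "v \<in> g"
      then obtain k where "k \<in> K" "k m = v" using value_surj[of v m] lie_idealD(2)[OF gi] by blast
      then show "v \<in> ?V" using v J(3) by (intro image_eqI[of _ _ k]) (auto simp: fiber_ideal_def)
    qed
    show "g \<noteq> ?V"
    proof
      assume "g = ?V"
      then have "J \<subseteq> fiber_ideal m g" using JK by (auto simp: fiber_ideal_def)
      then show False using J(3) by blast
    qed
  qed
  ultimately show False using g_max[OF V] by blast
qed

end

section \<open>Maximal ideals of finite codimension\<close>

locale maximal_ideal = section_algebra +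
  fixes I
  assumes maximal: "maximal_finite_codim_lie_ideal K brK I"
begin

text \<open>Finite codimension passes to larger subspaces, so in \<open>larger\<close> maximality
  can be tested on arbitrary ideals above \<open>I\<close>.\<close>

lemma ideal: "lie_ideal K brK I" and codim: "finite_codim K I" and proper: "I \<noteq> K"
  and larger: "lie_ideal K brK J \<Longrightarrow> I \<subseteq> J \<Longrightarrow> J = I \<or> J = K"
proof -
  show "lie_ideal K brK I" "finite_codim K I" "I \<noteq> K"
    using maximal unfolding maximal_finite_codim_lie_ideal_def by auto
  show "lie_ideal K brK J \<Longrightarrow> I \<subseteq> J \<Longrightarrow> J = I \<or> J = K"
    using maximal finite_codim_mono[of K I J] unfolding maximal_finite_codim_lie_ideal_def by blast
qed

lemmas subspace_I = lie_idealD(1)[OF ideal] and I_subset = lie_idealD(2)[OF ideal] and I_bracket = lie_idealD(3)[OF ideal]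

text \<open>The ideal \<open>C I\<close> cannot be \<open>K\<close>, since then \<open>K = [K, C I] = [C K, I] \<subseteq> I\<close>.\<close>

lemma submodule:
  assumes "f \<in> C" "i \<in> I"
  shows "(\<lambda>x. f x *\<^sub>R i x) \<in> I"
proof -
  define G where "G = {\<lambda>x. f x *\<^sub>R i x | f i. f \<in> C \<and> i \<in> I}"
  have GK: "G \<subseteq> K" using scale I_subset unfolding G_def by auto
  then have spanK: "span G \<subseteq> K" by (rule span_minimal[OF _ subspace_K])
  have in_G: "(\<lambda>x. f x *\<^sub>R i x) \<in> G" if "f \<in> C" "i \<in> I" for f i using that unfolding G_def by auto
  have bil: "brK k (l + l') = brK k l + brK k l'" "brK k (c *\<^sub>R l) = c *\<^sub>R brK k l"
    if "k \<in> K" "l \<in> K" "l' \<in> K" for k l l' c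
    using that by (simp_all add: fun_eq_iff scaleR_fun_def br_add_right br_scale_right value_in)
  \<comment> \<open>Applied to \<open>span G\<close> and to \<open>I\<close> in place of
    \<open>Y\<close>: the condition on l is linear, so inclusions of brackets with
    \<open>span G\<close> need checking on the products of functions with elements of
    \<open>I\<close> only.\<close>
  have sub_X: "subspace {l. l \<in> K \<and> (\<forall>k\<in>K. brK k l \<in> Y)}" if Y: "subspace Y" for Y
  proof (rule subspaceI)
    have "brK k 0 = 0" if "k \<in> K" for k using that by (simp add: fun_eq_iff br_zero_right value_in)
    then show "0 \<in> {l. l \<in> K \<and> (\<forall>k\<in>K. brK k l \<in> Y)}"
      using subspace_0[OF subspace_K] subspace_0[OF Y] by simp
    show "l + l' \<in> {l. l \<in> K \<and> (\<forall>k\<in>K. brK k l \<in> Y)}"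
      if "l \<in> {l. l \<in> K \<and> (\<forall>k\<in>K. brK k l \<in> Y)}" "l' \<in> {l. l \<in> K \<and> (\<forall>k\<in>K. brK k l \<in> Y)}" for l l'
      using that bil(1) subspace_add[OF subspace_K] subspace_add[OF Y] by simp
    show "c *\<^sub>R l \<in> {l. l \<in> K \<and> (\<forall>k\<in>K. brK k l \<in> Y)}"
      if "l \<in> {l. l \<in> K \<and> (\<forall>k\<in>K. brK k l \<in> Y)}" for c l
      using that bil(2)[of _ l l c] subspace_scale[OF subspace_K] subspace_scale[OF Y] by simp
  qed
  have br_scale: "brK k (\<lambda>x. f x *\<^sub>R i x) = (\<lambda>x. f x *\<^sub>R brK k i x)" "(\<lambda>x. f x *\<^sub>R brK k i x) = brK (\<lambda>x. f x *\<^sub>R k x) i"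
    if "k \<in> K" "i \<in> K" for k i f
    using that by (simp_all add: fun_eq_iff br_scale_right br_scale_left value_in)
  have "lie_ideal K brK (span G)"
    unfolding lie_ideal_def
  proof (intro conjI ballI)
    have "G \<subseteq> {l. l \<in> K \<and> (\<forall>k\<in>K. brK k l \<in> span G)}"
    proof
      fix l assume l: "l \<in> G"
      then obtain f i where fi: "f \<in> C" "i \<in> I" "l = (\<lambda>x. f x *\<^sub>R i x)" unfolding G_def by auto
      have iK: "i \<in> K" using fi(2) I_subset by blast
      have "brK k l \<in> span G" if "k \<in> K" for k
        unfolding fi(3) br_scale(1)[OF that iK] by (rule span_base[OF in_G[OF fi(1) I_bracket[OF that fi(2)]]])
      then show "l \<in> {l. l \<in> K \<and> (\<forall>k\<in>K. brK k l \<in> span G)}" using l GK by auto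
    qed
    then have "span G \<subseteq> {l. l \<in> K \<and> (\<forall>k\<in>K. brK k l \<in> span G)}" by (rule span_minimal[OF _ sub_X[OF subspace_span]])
    then show "brK k l \<in> span G" if "k \<in> K" "l \<in> span G" for k l using that by blast
  qed (use spanK in auto)
  moreover have "I \<subseteq> span G"
  proof
    fix i assume "i \<in> I"
    from in_G[OF smooth_functions_const[OF AM, of 1] this] show "i \<in> span G" by (simp add: span_base)
  qed
  ultimately have "span G = I \<or> span G = K" by (rule larger)
  moreover have "span G \<noteq> K"
  proof
    assume GK': "span G = K"
    have "G \<subseteq> {l. l \<in> K \<and> (\<forall>k\<in>K. brK k l \<in> I)}"
    proof
      fix l assume l: "l \<in> G"
      then obtain f i where fi: "f \<in> C" "i \<in> I" "l = (\<lambda>x. f x *\<^sub>R i x)" unfolding G_def by auto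
      have iK: "i \<in> K" using fi(2) I_subset by blast
      have "brK k l \<in> I" if "k \<in> K" for k
        unfolding fi(3) br_scale(1)[OF that iK] br_scale(2)[OF that iK]
        by (rule I_bracket[OF scale[OF fi(1) that] fi(2)])
      then show "l \<in> {l. l \<in> K \<and> (\<forall>k\<in>K. brK k l \<in> I)}" using l GK by auto
    qed
    then have "K \<subseteq> {l. l \<in> K \<and> (\<forall>k\<in>K. brK k l \<in> I)}"
      using span_minimal[OF _ sub_X[OF subspace_I], of G] GK' by simp
    then have "{brK k l | k l. k \<in> K \<and> l \<in> K} \<subseteq> I" by blast
    then have "span {brK k l | k l. k \<in> K \<and> l \<in> K} \<subseteq> I" by (rule span_minimal[OF _ subspace_I])
    then show False using sections_perfect proper I_subset by blast
  qed
  ultimately show ?thesis using span_base[OF in_G[OF assms]] by simp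
qed

definition annihilator :: "('a \<Rightarrow> real) set"
  where "annihilator = {f \<in> C. \<forall>k\<in>K. (\<lambda>x. f x *\<^sub>R k x) \<in> I}"

text \<open>\<open>?N\<close> is an ideal by bilinearity of the bracket over functions, and it
  contains \<open>I\<close> because \<open>I\<close> is a submodule. If it is not everything, it is
  \<open>I\<close> itself.\<close>

lemma annihilator_dichotomy:
  assumes f: "f \<in> C" "f \<notin> annihilator" and k: "k \<in> K" "(\<lambda>x. f x *\<^sub>R k x) \<in> I"
  shows "k \<in> I"
proof -
  let ?N = "{k \<in> K. (\<lambda>x. f x *\<^sub>R k x) \<in> I}"
  have "lie_ideal K brK ?N"
    unfolding lie_ideal_def
  proof (intro conjI ballI)
    show "subspace ?N"
    proof (rule subspaceI)
      show "0 \<in> ?N" using subspace_0[OF subspace_K] subspace_0[OF subspace_I] by (simp add: zero_fun_def)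
      show "k + l \<in> ?N" if "k \<in> ?N" "l \<in> ?N" for k l
      proof -
        have "(\<lambda>x. f x *\<^sub>R (k + l) x) = (\<lambda>x. f x *\<^sub>R k x) + (\<lambda>x. f x *\<^sub>R l x)"
          by (simp add: fun_eq_iff scaleR_add_right)
        then show ?thesis using that subspace_add[OF subspace_K, of k l] subspace_add[OF subspace_I] by simp
      qed
      show "c *\<^sub>R k \<in> ?N" if "k \<in> ?N" for c k
      proof -
        have "(\<lambda>x. f x *\<^sub>R (c *\<^sub>R k) x) = c *\<^sub>R (\<lambda>x. f x *\<^sub>R k x)"
          by (simp add: fun_eq_iff scaleR_fun_def mult.commute)
        then show ?thesis using that subspace_scale[OF subspace_K, of k c] subspace_scale[OF subspace_I] by simp
      qed
    qed
    show "brK k l \<in> ?N" if k: "k \<in> K" and l: "l \<in> ?N" for k l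
    proof -
      have "(\<lambda>x. f x *\<^sub>R brK k l x) = brK k (\<lambda>x. f x *\<^sub>R l x)"
        using k l by (simp add: fun_eq_iff br_scale_right value_in)
      then show ?thesis using I_bracket[OF k, of "\<lambda>x. f x *\<^sub>R l x"] bracket[OF k, of l] l by simp
    qed
  qed auto
  moreover have "I \<subseteq> ?N" using submodule[OF f(1)] I_subset by auto
  ultimately have "?N = I \<or> ?N = K" by (rule larger)
  moreover have "?N \<noteq> K" using f unfolding annihilator_def by auto
  ultimately show ?thesis using k by auto
qed

text \<open>If \<open>g\<close> lies outside the annihilator, multiplication by \<open>g\<close> is
  injective modulo \<open>I\<close>, so \<open>g\<close> can be cancelled.\<close>

lemma annihilator_prime:
  assumes "f \<in> C" "g \<in> C" "(\<lambda>x. f x * g x) \<in> annihilator"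
  shows "f \<in> annihilator \<or> g \<in> annihilator"
proof (rule disjCI)
  assume g: "g \<notin> annihilator"
  have "(\<lambda>x. f x *\<^sub>R k x) \<in> I" if k: "k \<in> K" for k
  proof (rule annihilator_dichotomy[OF assms(2) g scale[OF assms(1) k]])
    show "(\<lambda>x. g x *\<^sub>R f x *\<^sub>R k x) \<in> I"
      using assms(3) k by (simp add: annihilator_def mult.commute)
  qed
  then show "f \<in> annihilator" using assms(1) by (simp add: annihilator_def)
qed

lemma annihilator_mult:
  assumes "f \<in> C" "g \<in> annihilator"
  shows "(\<lambda>x. f x * g x) \<in> annihilator"
proof -
  have g: "g \<in> C" "\<And>k. k \<in> K \<Longrightarrow> (\<lambda>x. g x *\<^sub>R k x) \<in> I" using assms(2) by (auto simp: annihilator_def)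
  have "(\<lambda>x. (f x * g x) *\<^sub>R k x) \<in> I" if "k \<in> K" for k
    using submodule[OF assms(1) g(2)[OF that]] by simp
  then show ?thesis using smooth_functions_mult[OF AM assms(1) g(1)] by (simp add: annihilator_def)
qed

lemma annihilator_add:
  assumes "f \<in> annihilator" "g \<in> annihilator"
  shows "(\<lambda>x. f x + g x) \<in> annihilator"
proof -
  have fg: "f \<in> C" "\<And>k. k \<in> K \<Longrightarrow> (\<lambda>x. f x *\<^sub>R k x) \<in> I" "g \<in> C" "\<And>k. k \<in> K \<Longrightarrow> (\<lambda>x. g x *\<^sub>R k x) \<in> I"
    using assms by (auto simp: annihilator_def)
  have "(\<lambda>x. (f x + g x) *\<^sub>R k x) \<in> I" if "k \<in> K" for k
    using subspace_add[OF subspace_I fg(2)[OF that] fg(4)[OF that]] by (simp add: plus_fun_def scaleR_add_left)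
  then show ?thesis using smooth_functions_add[OF AM fg(1,3)] by (simp add: annihilator_def)
qed

lemma one_not_annihilator: "(\<lambda>x. 1) \<notin> annihilator"
  using proper I_subset by (auto simp: annihilator_def)

lemma annihilator_sum:
  assumes "finite A" "\<And>i. i \<in> A \<Longrightarrow> f i \<in> annihilator"
  shows "(\<lambda>x. \<Sum>i\<in>A. f i x) \<in> annihilator"
  using assms
proof (induction A rule: finite_induct)
  case empty
  have "(\<lambda>x. 0 *\<^sub>R k x) \<in> I" if "k \<in> K" for k
    using subspace_0[OF subspace_I] by (simp add: zero_fun_def)
  then show ?case using AM by (simp add: annihilator_def)
qed (simp add: annihilator_add)

text \<open>A nowhere vanishing member would be invertible in \<open>C\<close> and bring the
  constant 1 into the annihilator.\<close>

lemma annihilator_has_zero: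
  assumes "f \<in> annihilator"
  obtains x where "f x = 0"
proof (rule ccontr)
  assume "\<not> thesis"
  then have nz: "f x \<noteq> 0" for x using that by blast
  have f: "f \<in> C" using assms by (simp add: annihilator_def)
  have "(\<lambda>x. inverse (f x) * f x) \<in> annihilator"
    by (rule annihilator_mult[OF smooth_functions_inverse[OF AM f nz] assms])
  then show False using nz one_not_annihilator by simp
qed

text \<open>For a section \<open>k\<close> outside \<open>I\<close>, the products of
  \<open>k\<close> with the powers of \<open>f\<close> are dependent modulo \<open>I\<close>. A
  dependence is a nonzero polynomial \<open>p\<close> such that \<open>p\<close> of \<open>f\<close>
  times \<open>k\<close> lies in \<open>I\<close>, and the dichotomy applies because
  \<open>k\<close> does not.\<close>

lemma annihilator_algebraic:
  assumes f: "f \<in> C"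
  obtains p where "p \<noteq> 0" "(\<lambda>x. poly p (f x)) \<in> annihilator"
proof -
  obtain k where k: "k \<in> K" "k \<notin> I" using proper I_subset by blast
  obtain B where B: "finite B" "K \<subseteq> span (I \<union> B)" using codim unfolding finite_codim_def by auto
  have fk: "(\<lambda>x. f x ^ n *\<^sub>R k x) \<in> K" for n by (rule scale[OF smooth_functions_power[OF AM f] k(1)])
  then have "(\<lambda>x. f x ^ n *\<^sub>R k x) \<in> span (I \<union> B)" for n using B(2) by blast
  from finite_codim_dependence[where v="\<lambda>n x. f x ^ n *\<^sub>R k x", OF B(1) subspace_I this]
  obtain c N where c: "\<exists>i<N. c i \<noteq> 0" "(\<Sum>i<N. c i *\<^sub>R (\<lambda>x. f x ^ i *\<^sub>R k x)) \<in> I" by blast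
  define p where "p = (\<Sum>i<N. monom (c i) i)"
  have "coeff p i = c i" if "i < N" for i using that by (simp add: p_def coeff_sum)
  then have "p \<noteq> 0" using c(1) by auto
  have "poly p y = (\<Sum>i<N. c i * y ^ i)" for y by (simp add: p_def poly_sum poly_monom)
  then have "(\<lambda>x. poly p (f x) *\<^sub>R k x) = (\<Sum>i<N. c i *\<^sub>R (\<lambda>x. f x ^ i *\<^sub>R k x))"
    by (simp add: fun_eq_iff sum_fun_apply scaleR_fun_def scaleR_sum_left)
  then have "(\<lambda>x. poly p (f x)) \<in> annihilator"
    using annihilator_dichotomy[OF poly_smooth[OF f, of p] _ k(1)] c(2) k(2) by auto
  with \<open>p \<noteq> 0\<close> show ?thesis by (rule that)
qed

text \<open>If no point were a common zero, take countably many \<open>g n\<close> in the annihilator without common zero and \<open>\<rho>\<close>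
  such that \<open>\<rho> x > N\<close> wherever \<open>g 0, \<dots>, g N\<close> vanish. Once \<open>N\<close> exceeds the roots of a polynomial \<open>p\<close> with
  \<open>p \<circ> \<rho>\<close> in the annihilator, \<open>(p \<circ> \<rho>)\<^sup>2 + (g 0)\<^sup>2 + \<dots> + (g N)\<^sup>2\<close> vanishes nowhere.\<close>

lemma annihilator_common_zero:
  obtains m where "\<And>f. f \<in> annihilator \<Longrightarrow> f m = 0"
proof (rule ccontr)
  assume none: "\<not> thesis"
  have cover: "\<exists>f\<in>annihilator. f m \<noteq> 0" for m
  proof (rule ccontr)
    assume "\<not> (\<exists>f\<in>annihilator. f m \<noteq> 0)"
    then have "thesis" by (intro that[of m]) blast
    then show False using none by blast
  qed
  have sub: "annihilator \<subseteq> C" by (auto simp: annihilator_def)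
  obtain g where g: "\<And>n::nat. g n \<in> annihilator" "\<And>x. \<exists>n. g n x \<noteq> 0"
    using smooth_functions_countable_cover[OF sub cover] by blast
  have gC: "g n \<in> C" for n using g(1) sub by blast
  obtain h where h: "\<And>n. h n \<in> C" "\<And>n x. h n x \<ge> 0" "\<And>n x. h n x \<noteq> 0 \<Longrightarrow> g n x \<noteq> 0"
    "\<And>x. \<exists>n. h n x \<noteq> 0" "locally_finite_family h"
    by (rule smooth_functions_locally_finite_refinement[OF AM gC g(2)]) blast
  let ?N = "\<lambda>x. {n. h n x \<noteq> 0}"
  note fin = locally_finite_family_finite[OF h(5)]
  define R where "R x = (\<Sum>n\<in>?N x. h n x)" for x
  have "(\<lambda>x. \<Sum>n\<in>?N x. h n x * 1) \<in> C"
    by (rule smooth_functions_locally_finite_sum[OF AM h(1) smooth_functions_const[OF AM] h(5)])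
  then have R: "R \<in> C" by (simp add: R_def[abs_def])
  have R_pos: "R x > 0" for x
    unfolding R_def by (rule sum_pos[OF fin]) (use h(2,4) in \<open>auto simp: less_le\<close>)
  define S where "S x = (\<Sum>n\<in>?N x. h n x * real n)" for x
  have S: "S \<in> C" unfolding S_def
    by (rule smooth_functions_locally_finite_sum[OF AM h(1) smooth_functions_const[OF AM] h(5)])
  \<comment> \<open>The average of the indices n with weights \<open>h n x / R x\<close>. Where the
    first N functions \<open>g i\<close> vanish, only indices from N on have weight, so the average
    is at least N.\<close>
  define \<rho> where "\<rho> x = S x * inverse (R x)" for x
  have Rn: "R x \<noteq> 0" for x using R_pos[of x] by simp
  have \<rho>: "\<rho> \<in> C" unfolding \<rho>_def by (rule smooth_functions_mult[OF AM S smooth_functions_inverse[OF AM R Rn]])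
  have \<rho>_large: "\<rho> x \<ge> real N" if "\<And>i. i < N \<Longrightarrow> g i x = 0" for x N
  proof -
    have "R x * real N \<le> S x"
      unfolding R_def S_def sum_distrib_right
    proof (rule sum_mono)
      fix n assume "n \<in> ?N x"
      then have "\<not> n < N" using h(3)[of n x] that[of n] by auto
      then show "h n x * real N \<le> h n x * real n" using h(2)[of n x] by (intro mult_left_mono) auto
    qed
    then show ?thesis using R_pos[of x] by (simp add: \<rho>_def field_simps)
  qed
  obtain p where p: "p \<noteq> 0" "(\<lambda>x. poly p (\<rho> x)) \<in> annihilator" by (rule annihilator_algebraic[OF \<rho>])
  have "bdd_above {y. poly p y = 0}" using poly_roots_finite[OF p(1)] by (rule bdd_above_finite)
  then obtain M where M: "\<And>y. poly p y = 0 \<Longrightarrow> y \<le> M" unfolding bdd_above_def by auto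
  obtain N where N: "real N > M" using reals_Archimedean2 by blast
  \<comment> \<open>Members are squared so that a zero of the sum is a common zero; squares stay in
    the annihilator because it is an ideal of \<open>C\<close>.\<close>
  let ?F = "\<lambda>x. poly p (\<rho> x) * poly p (\<rho> x) + (\<Sum>i<N. g i x * g i x)"
  have "?F \<in> annihilator"
    by (rule annihilator_add[OF annihilator_mult[OF poly_smooth[OF \<rho>] p(2)]
          annihilator_sum[OF finite_lessThan annihilator_mult[OF gC g(1)]]])
  then obtain x where x: "?F x = 0" by (rule annihilator_has_zero)
  have s: "(\<Sum>i<N. g i x * g i x) \<ge> 0" by (intro sum_nonneg) simp
  have p0: "poly p (\<rho> x) * poly p (\<rho> x) \<ge> 0" by simp
  have "poly p (\<rho> x) * poly p (\<rho> x) = 0" "(\<Sum>i<N. g i x * g i x) = 0" using x s p0 by linarith+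
  then have "poly p (\<rho> x) = 0" "\<forall>i<N. g i x = 0" by (simp_all add: sum_nonneg_eq_0_iff)
  then have "\<rho> x \<le> M" "\<rho> x \<ge> real N" using M \<rho>_large by simp_all
  then show False using N by simp
qed

text \<open>Take a nonzero \<open>p\<close> whose composite with \<open>f\<close> lies in the
  annihilator and split off its zero at 0: p = x^n q with q nonzero at 0. The composite of q with
  \<open>f\<close> does not vanish at \<open>m\<close>, so it lies outside; primeness leaves the
  n-th power of \<open>f\<close> and finally \<open>f\<close>.\<close>

lemma annihilator_point:
  obtains m where "\<And>f. f \<in> C \<Longrightarrow> f m = 0 \<Longrightarrow> f \<in> annihilator" "\<And>f. f \<in> annihilator \<Longrightarrow> f m = 0"
proof -
  obtain m where m: "\<And>f. f \<in> annihilator \<Longrightarrow> f m = 0" by (rule annihilator_common_zero) blast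
  have "f \<in> annihilator" if f: "f \<in> C" "f m = 0" for f
  proof -
    obtain p where p: "p \<noteq> 0" "(\<lambda>x. poly p (f x)) \<in> annihilator" by (rule annihilator_algebraic[OF f(1)])
    obtain q where q: "p = [:- 0, 1:] ^ order 0 p * q" "\<not> [:- 0, 1:] dvd q"
      using order_decomp[OF p(1), of 0] by blast
    let ?n = "order 0 p"
    have "poly q 0 \<noteq> 0" using q(2) by (simp add: poly_eq_0_iff_dvd)
    then have "(\<lambda>x. poly q (f x)) \<notin> annihilator" using m[of "\<lambda>x. poly q (f x)"] f(2) by auto
    moreover have "poly p y = y ^ ?n * poly q y" for y
      by (subst q(1)) (simp add: poly_power)
    then have "(\<lambda>x. f x ^ ?n * poly q (f x)) \<in> annihilator" using p(2) by simp
    ultimately have "(\<lambda>x. f x ^ ?n) \<in> annihilator"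
      using annihilator_prime[OF smooth_functions_power[OF AM f(1)] poly_smooth[OF f(1)]] by blast
    then show ?thesis
    proof (induction ?n)
      case 0
      then show ?case using one_not_annihilator by simp
    next
      case (Suc n)
      have "(\<lambda>x. f x ^ n) \<in> annihilator \<Longrightarrow> f \<in> annihilator" for n
      proof (induction n)
        case 0
        then show ?case using one_not_annihilator by simp
      next
        case (Suc n)
        then show ?case using annihilator_prime[OF f(1) smooth_functions_power[OF AM f(1)], of n] by auto
      qed
      then show ?case using Suc.prems by blast
    qed
  qed
  then show ?thesis using m by (rule that)
qed

text \<open>A section \<open>k\<close> vanishing at \<open>m\<close> has frame coefficients
  vanishing at \<open>m\<close>, which lie in the annihilator. Hence \<open>\<beta>\<close> times
  \<open>k\<close> is in \<open>I\<close>, and \<open>\<beta>\<close>, being nonzero at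
  \<open>m\<close>, is cancelled by the dichotomy. So \<open>I\<close> is a full preimage under
  evaluation, and ideals above its image pull back to ideals above \<open>I\<close>, which gives
  maximality of the image.\<close>

lemma is_fiber_ideal:
  obtains m g where "maximal_lie_ideal L br g" "I = fiber_ideal m g"
proof -
  obtain m where m: "\<And>f. f \<in> C \<Longrightarrow> f m = 0 \<Longrightarrow> f \<in> annihilator" "\<And>f. f \<in> annihilator \<Longrightarrow> f m = 0"
    by (rule annihilator_point) blast
  have vanish: "k \<in> I" if k: "k \<in> K" "k m = 0" for k
  proof -
    obtain \<beta> e where fr: "frame_on \<beta> e" and \<beta>m: "\<beta> m \<noteq> 0" by (rule frame_at)
    obtain f where f: "\<And>b. f b \<in> C" "\<And>x b. k x = 0 \<Longrightarrow> f b x = 0"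
      "\<And>x. \<beta> x *\<^sub>R k x = (\<Sum>b\<in>Basis. f b x *\<^sub>R e b x)" by (rule frame_onE[OF fr k(1)]) blast
    have "f b \<in> annihilator" for b using m(1)[OF f(1)] f(2) k(2) by blast
    then have "(\<lambda>x. f b x *\<^sub>R e b x) \<in> I" for b using frame_onD(2)[OF fr] by (simp add: annihilator_def)
    then have "(\<Sum>b\<in>Basis. (\<lambda>x. f b x *\<^sub>R e b x)) \<in> I" by (intro subspace_sum[OF subspace_I])
    moreover have "(\<Sum>b\<in>Basis. (\<lambda>x. f b x *\<^sub>R e b x)) = (\<lambda>x. \<beta> x *\<^sub>R k x)"
      by (simp add: fun_eq_iff sum_fun_apply f(3))
    ultimately have "(\<lambda>x. \<beta> x *\<^sub>R k x) \<in> I" by simp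
    then show ?thesis using annihilator_dichotomy[OF frame_onD(1)[OF fr] _ k(1)] m(2) \<beta>m by blast
  qed
  let ?g = "(\<lambda>k. k m) ` I"
  have I_eq: "I = fiber_ideal m ?g"
  proof
    show "I \<subseteq> fiber_ideal m ?g" using I_subset by (auto simp: fiber_ideal_def)
    show "fiber_ideal m ?g \<subseteq> I"
    proof
      fix k assume "k \<in> fiber_ideal m ?g"
      then obtain i where i: "k \<in> K" "i \<in> I" "k m = i m" by (auto simp: fiber_ideal_def)
      then have "k - i \<in> I" using vanish[of "k - i"] subspace_diff[OF subspace_K, of k i] I_subset by auto
      then have "(k - i) + i \<in> I" using i(2) by (rule subspace_add[OF subspace_I])
      then show "k \<in> I" by simp
    qed
  qed
  have gi: "lie_ideal L br ?g"
    unfolding lie_ideal_def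
  proof (intro conjI ballI)
    have "linear (\<lambda>k :: 'a \<Rightarrow> 'c. k m)" by (rule linearI) (simp_all add: scaleR_fun_def)
    then show "subspace ?g" using subspace_I by (rule linear_subspace_image)
    show "?g \<subseteq> L" using I_subset value_in by auto
    show "br x y \<in> ?g" if x: "x \<in> L" and y: "y \<in> ?g" for x y
    proof -
      obtain k l where k: "k \<in> K" "k m = x" and l: "l \<in> I" "l m = y" using value_surj[OF x, of m] y by auto
      then show ?thesis using I_bracket[OF k(1) l(1)] by (intro image_eqI[of _ _ "brK k l"]) simp_all
    qed
  qed
  have "maximal_lie_ideal L br ?g"
    unfolding maximal_lie_ideal_def
  proof (intro conjI notI)
    show "lie_ideal L br ?g" by (rule gi)
    show False if gL: "?g = L"
    proof -
      have "K \<subseteq> fiber_ideal m ?g" unfolding gL fiber_ideal_def using value_in by auto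
      then show False using I_eq proper I_subset by blast
    qed
    assume "\<exists>J. lie_ideal L br J \<and> J \<noteq> L \<and> ?g \<subset> J"
    then obtain J where J: "lie_ideal L br J" "J \<noteq> L" "?g \<subset> J" by blast
    have "I \<subseteq> fiber_ideal m J" using I_subset J(3) by (auto simp: fiber_ideal_def)
    with fiber_ideal_ideal[OF J(1)] have "fiber_ideal m J = I \<or> fiber_ideal m J = K" by (rule larger)
    moreover have "fiber_ideal m J \<noteq> K"
    proof
      assume eq: "fiber_ideal m J = K"
      have "v \<in> J" if "v \<in> L" for v using value_surj[OF that, of m] eq by (auto simp: fiber_ideal_def)
      then show False using J(2) lie_idealD(2)[OF J(1)] by blast
    qed
    moreover have "fiber_ideal m J \<noteq> I"
    proof
      assume eq: "fiber_ideal m J = I"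
      obtain v where v: "v \<in> J" "v \<notin> ?g" using J(3) by blast
      then obtain k where "k \<in> K" "k m = v" using value_surj[of v m] lie_idealD(2)[OF J(1)] by blast
      then have "k \<in> I" using v eq by (auto simp: fiber_ideal_def)
      then show False using v \<open>k m = v\<close> by blast
    qed
    ultimately show False by blast
  qed
  then show ?thesis using I_eq by (rule that)
qed

end

context section_algebra
begin

lemma maximal_ideals:
  "maximal_finite_codim_lie_ideal K brK I \<longleftrightarrow> (\<exists>m g. maximal_lie_ideal L br g \<and> I = fiber_ideal m g)"
proof
  assume "maximal_finite_codim_lie_ideal K brK I"
  then interpret maximal_ideal AM K L br frame_type I by unfold_locales
  show "\<exists>m g. maximal_lie_ideal L br g \<and> I = fiber_ideal m g" by (rule is_fiber_ideal) blast
qed (auto intro: fiber_ideal_maximal)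

end

section \<open>The kernel of the Atiyah sequence\<close>

text \<open>The fields and their values carry brackets of opposite sign. Ideals are subspaces, hence
  closed under negation, so an injective linear map that reverses the bracket still matches ideals,
  together with codimension and inclusions.\<close>

locale lie_anti_embedding =
  fixes \<Phi> :: "'v::real_vector \<Rightarrow> 'w::real_vector" and K :: "'v set" and brA brB
  assumes linear: "linear \<Phi>" and inj: "inj_on \<Phi> K" and subspace: "subspace K"
    and closed: "x \<in> K \<Longrightarrow> y \<in> K \<Longrightarrow> brA x y \<in> K"
    and bracket: "x \<in> K \<Longrightarrow> y \<in> K \<Longrightarrow> \<Phi> (brA x y) = - brB (\<Phi> x) (\<Phi> y)"
begin

lemma subspace_iff:
  assumes "I \<subseteq> K"
  shows "Real_Vector_Spaces.subspace (\<Phi> ` I) \<longleftrightarrow> Real_Vector_Spaces.subspace I"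
proof
  assume s: "Real_Vector_Spaces.subspace (\<Phi> ` I)"
  have mem: "x \<in> I" if "x \<in> K" "\<Phi> x \<in> \<Phi> ` I" for x
    using inj_on_image_mem_iff[OF inj that(1) assms] that(2) by simp
  show "Real_Vector_Spaces.subspace I"
  proof (rule subspaceI)
    show "0 \<in> I" by (rule mem) (use subspace_0[OF subspace] subspace_0[OF s] linear_0[OF linear] in auto)
    show "x + y \<in> I" if "x \<in> I" "y \<in> I" for x y
      by (rule mem) (use that assms subspace_add[OF subspace, of x y] subspace_add[OF s, of "\<Phi> x" "\<Phi> y"] linear_add[OF linear] in auto)
    show "c *\<^sub>R x \<in> I" if "x \<in> I" for c x
      by (rule mem) (use that assms subspace_scale[OF subspace, of x c] subspace_scale[OF s, of "\<Phi> x" c] linear_cmul[OF linear] in auto)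
  qed
qed (rule linear_subspace_image[OF linear])

lemma lie_ideal_iff:
  assumes I: "I \<subseteq> K"
  shows "lie_ideal (\<Phi> ` K) brB (\<Phi> ` I) \<longleftrightarrow> lie_ideal K brA I"
proof -
  have "brB (\<Phi> x) (\<Phi> y) \<in> \<Phi> ` I \<longleftrightarrow> brA x y \<in> I" if s: "Real_Vector_Spaces.subspace I" and "x \<in> K" "y \<in> I" for x y
  proof -
    have yK: "y \<in> K" using that I by auto
    have "brB (\<Phi> x) (\<Phi> y) = - \<Phi> (brA x y)" using bracket[OF that(2) yK] by simp
    then have "brB (\<Phi> x) (\<Phi> y) \<in> \<Phi> ` I \<longleftrightarrow> \<Phi> (brA x y) \<in> \<Phi> ` I"
      using subspace_neg[OF linear_subspace_image[OF linear s], of "brB (\<Phi> x) (\<Phi> y)"]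
        subspace_neg[OF linear_subspace_image[OF linear s], of "\<Phi> (brA x y)"] by auto
    also have "\<dots> \<longleftrightarrow> brA x y \<in> I" by (rule inj_on_image_mem_iff[OF inj closed[OF that(2) yK] I])
    finally show ?thesis .
  qed
  then show ?thesis using I subspace_iff[OF I] unfolding lie_ideal_def by auto
qed

lemma finite_codim_iff:
  assumes I: "I \<subseteq> K"
  shows "finite_codim (\<Phi> ` K) (\<Phi> ` I) \<longleftrightarrow> finite_codim K I"
proof
  assume "finite_codim K I"
  then obtain B where B: "finite B" "B \<subseteq> K" "K \<subseteq> span (I \<union> B)" unfolding finite_codim_def by auto
  have "\<Phi> ` K \<subseteq> span (\<Phi> ` I \<union> \<Phi> ` B)"
    using image_mono[OF B(3), of \<Phi>] by (simp add: linear_span_image[OF linear] image_Un[symmetric])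
  then show "finite_codim (\<Phi> ` K) (\<Phi> ` I)" unfolding finite_codim_def using B by (intro exI[of _ "\<Phi> ` B"]) auto
next
  assume "finite_codim (\<Phi> ` K) (\<Phi> ` I)"
  then obtain B' where B': "finite B'" "B' \<subseteq> \<Phi> ` K" "\<Phi> ` K \<subseteq> span (\<Phi> ` I \<union> B')" unfolding finite_codim_def by auto
  obtain B where B: "B \<subseteq> K" "finite B" "B' = \<Phi> ` B" using finite_subset_image[OF B'(1,2)] by metis
  have span: "span (I \<union> B) \<subseteq> K" by (rule span_minimal[OF _ subspace]) (use I B in auto)
  have "x \<in> span (I \<union> B)" if "x \<in> K" for x
  proof -
    have "\<Phi> x \<in> \<Phi> ` span (I \<union> B)"
      using B'(3) that by (auto simp: B(3) linear_span_image[OF linear] image_Un[symmetric])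
    then show ?thesis using inj_on_image_mem_iff[OF inj that span] by simp
  qed
  then show "finite_codim K I" unfolding finite_codim_def using B by (intro exI[of _ B]) auto
qed

lemma maximal_iff:
  assumes I: "I \<subseteq> K"
  shows "maximal_finite_codim_lie_ideal (\<Phi> ` K) brB (\<Phi> ` I) \<longleftrightarrow> maximal_finite_codim_lie_ideal K brA I"
proof -
  have eq: "\<Phi> ` A = \<Phi> ` B \<longleftrightarrow> A = B" if "A \<subseteq> K" "B \<subseteq> K" for A B by (rule inj_on_image_eq_iff[OF inj that])
  have sub: "\<Phi> ` I \<subset> \<Phi> ` J \<longleftrightarrow> I \<subset> J" if "J \<subseteq> K" for J
    using eq[OF I that] inj_on_image_subset_iff[OF inj I that] by (simp add: psubset_eq)
  have "(\<exists>J. lie_ideal (\<Phi> ` K) brB J \<and> finite_codim (\<Phi> ` K) J \<and> J \<noteq> \<Phi> ` K \<and> \<Phi> ` I \<subset> J) \<longleftrightarrow>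
      (\<exists>J. lie_ideal K brA J \<and> finite_codim K J \<and> J \<noteq> K \<and> I \<subset> J)"
  proof
    assume "\<exists>J. lie_ideal (\<Phi> ` K) brB J \<and> finite_codim (\<Phi> ` K) J \<and> J \<noteq> \<Phi> ` K \<and> \<Phi> ` I \<subset> J"
    then obtain J' where J': "lie_ideal (\<Phi> ` K) brB J'" "finite_codim (\<Phi> ` K) J'" "J' \<noteq> \<Phi> ` K" "\<Phi> ` I \<subset> J'" by blast
    then obtain J where J: "J \<subseteq> K" "J' = \<Phi> ` J" using lie_idealD(2)[OF J'(1)] by (meson subset_imageE)
    then show "\<exists>J. lie_ideal K brA J \<and> finite_codim K J \<and> J \<noteq> K \<and> I \<subset> J"
      using J' lie_ideal_iff[OF J(1)] finite_codim_iff[OF J(1)] sub[OF J(1)] by (intro exI[of _ J]) auto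
  next
    assume "\<exists>J. lie_ideal K brA J \<and> finite_codim K J \<and> J \<noteq> K \<and> I \<subset> J"
    then obtain J where J: "lie_ideal K brA J" "finite_codim K J" "J \<noteq> K" "I \<subset> J" by blast
    have JK: "J \<subseteq> K" by (rule lie_idealD(2)[OF J(1)])
    show "\<exists>J. lie_ideal (\<Phi> ` K) brB J \<and> finite_codim (\<Phi> ` K) J \<and> J \<noteq> \<Phi> ` K \<and> \<Phi> ` I \<subset> J"
      using J lie_ideal_iff[OF JK] finite_codim_iff[OF JK] sub[OF JK] eq[OF JK order_refl]
      by (intro exI[of _ "\<Phi> ` J"]) simp
  qed
  then show ?thesis
    unfolding maximal_finite_codim_lie_ideal_def lie_ideal_iff[OF I] finite_codim_iff[OF I] eq[OF I order_refl]
    by simp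
qed

end

context principal
begin

text \<open>The value of a section is the set of all vectors of \<open>k\<close> over
  \<open>m\<close>; the class of a fundamental vector is its orbit. Comparing the members based at
  \<open>u\<close> recovers the element of the Lie algebra, and conversely invariance of
  \<open>k\<close> fills the orbit.\<close>

lemma section_value_iff:
  assumes k: "k \<in> K" and u: "pr u = m" and g: "g \<subseteq> LG"
  shows "section_value pr k m \<in> fiber_identification AP act u ` g \<longleftrightarrow> ev u k \<in> g"
proof
  let ?T = "\<lambda>h. tangent_map AP (\<lambda>g. act u g) h"
  have fid: "fiber_identification AP act u h = {(act u g, tangent_map AP (\<lambda>w. act w g) (?T h)) | g. True}" for h
    by (simp add: fiber_identification_def atiyah_class_def)
  {
    assume "section_value pr k m \<in> fiber_identification AP act u ` g"
    then obtain h where h: "h \<in> g" "section_value pr k m = fiber_identification AP act u h" by auto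
    have "(act u \<one>, tangent_map AP (\<lambda>w. act w \<one>) (?T h)) \<in> section_value pr k m"
      unfolding h(2) fid by blast
    then have ku: "k u = tangent_map AP (\<lambda>w. w) (?T h)" by (simp add: section_value_def)
    have "ev u k = h"
    proof (rule ev_eqI)
      show "h \<in> LG" using h(1) g by blast
      show "k u f = h (\<lambda>g. f (act u g))" if "f \<in> smooth_functions AP" for f
        using that by (simp add: ku tangent_map_smooth)
    qed
    then show "ev u k \<in> g" using h(1) by simp
  }
  assume ev: "ev u k \<in> g"
  have ku: "k u = ?T (ev u k)"
  proof
    show "k u f = ?T (ev u k) f" for f
      using ev_apply[OF k, of f u] kernel_eq_outside[OF k, of f u]
      by (cases "f \<in> smooth_functions AP") (simp_all add: tangent_map_smooth tangent_map_nonsmooth)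
  qed
  have "section_value pr k m = fiber_identification AP act u (ev u k)"
  proof (intro equalityI subsetI)
    fix z assume "z \<in> section_value pr k m"
    then obtain w where w: "z = (w, k w)" "pr w = m" by (auto simp: section_value_def)
    obtain g where "w = act u g" using fiber_transitive[of u w] u w(2) by auto
    then show "z \<in> fiber_identification AP act u (ev u k)"
      unfolding fid ku[symmetric] using w(1) kernel_invariant[OF k, of u g] by auto
  next
    fix z assume "z \<in> fiber_identification AP act u (ev u k)"
    then obtain g where "z = (act u g, tangent_map AP (\<lambda>w. act w g) (k u))"
      unfolding fid ku[symmetric] by auto
    then show "z \<in> section_value pr k m"
      using kernel_invariant[OF k, of u g] u by (auto simp: section_value_def)
  qed
  then show "section_value pr k m \<in> fiber_identification AP act u ` g" using ev by simp
qed

end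

section \<open>Sections as functions with values in the Lie algebra\<close>

locale semisimple_principal = principal G AG AP AM act pr
  for G :: "'g::{t2_space,second_countable_topology} monoid" (structure)
    and AG :: "('g, 'eg::euclidean_space) atlas"
    and AP :: "('p::{t2_space,second_countable_topology}, 'ep::euclidean_space) atlas"
    and AM :: "('m::{t2_space,second_countable_topology}, 'em::euclidean_space) atlas"
    and act :: "'p \<Rightarrow> 'g \<Rightarrow> 'p"
    and pr :: "'p \<Rightarrow> 'm" +
  fixes s :: "'m \<Rightarrow> 'p"
  assumes semisimple: "semisimple_lie_group G AG" and pr_s: "pr (s m) = m"
begin

definition fiber_values :: "'p vfield \<Rightarrow> 'm \<Rightarrow> ('g \<Rightarrow> real) \<Rightarrow> real"
  where "fiber_values k m = ev (s m) k"

lemma linear_fiber_values: "linear fiber_values"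
  by (rule linearI)
    (simp_all add: fiber_values_def fun_eq_iff scaleR_fun_def[of _ "_ :: 'm \<Rightarrow> ('g \<Rightarrow> real) \<Rightarrow> real"]
      linear_add[OF linear_ev] linear_cmul[OF linear_ev])

lemma kernel_zero_at:
  assumes "k \<in> K" "ev u k = 0"
  shows "k u = 0"
  using ev_inj[OF assms(1) subspace_0[OF subspace_kernel], of u] assms(2) linear_0[OF linear_ev] by simp

text \<open>\<open>s\<close> meets every fiber, and an invariant field is determined on a fiber by
  one of its values.\<close>

lemma inj_fiber_values: "inj_on fiber_values K"
proof (rule inj_onI)
  fix k l assume k: "k \<in> K" and l: "l \<in> K" and eq: "fiber_values k = fiber_values l"
  show "k = l"
  proof
    fix u
    have "ev (s (pr u)) k = ev (s (pr u)) l" using fun_cong[OF eq, of "pr u"] by (simp add: fiber_values_def)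
    from kernel_fiber_eq[OF k l ev_inj[OF k l this], of u] show "k u = l u" by (simp add: pr_s)
  qed
qed

sublocale emb: lie_anti_embedding fiber_values K vfield_bracket "\<lambda>k l m. brG (k m) (l m)"
proof
  show "fiber_values (vfield_bracket k l) = - (\<lambda>m. brG (fiber_values k m) (fiber_values l m))"
    if "k \<in> K" "l \<in> K" for k l
    by (rule ext) (simp add: fiber_values_def ev_bracket[OF that])
qed (rule linear_fiber_values[unfolded linear_iff, THEN conjunct1, rule_format]
      linear_fiber_values[unfolded linear_iff, THEN conjunct2, rule_format]
      inj_fiber_values subspace_kernel kernel_bracket; assumption?)+

text \<open>As \<open>s\<close> is arbitrary, the value functions are not smooth in general. Closure
  under multiplication, brackets and locally finite sums is inherited from the invariant fields,
  where smoothness makes sense; evaluation at \<open>s x\<close> turns functions of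
  \<open>pr u\<close> into functions of x.\<close>

sublocale sec: section_algebra AM "fiber_values ` K" LG brG "TYPE('eg)"
proof
  show "smooth_manifold AM" by (rule AM)
  show "subspace (fiber_values ` K)" by (rule linear_subspace_image[OF linear_fiber_values subspace_kernel])
  show "subspace LG" by (rule subspace_tangent_space)
  show "brG (x + y) z = brG x z + brG y z" if "x \<in> LG" "y \<in> LG" "z \<in> LG" for x y z by (rule brG_add_left[OF that])
  show "brG (c *\<^sub>R x) z = c *\<^sub>R brG x z" if "x \<in> LG" "z \<in> LG" for x z c by (rule brG_scale_left[OF that])
  show "brG x y = - brG y x" if "x \<in> LG" "y \<in> LG" for x y by (rule brG_skew[OF that])
  show "\<kappa> m \<in> LG" if "\<kappa> \<in> fiber_values ` K" for \<kappa> m using that ev_in by (auto simp: fiber_values_def)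
  show "\<exists>\<kappa>\<in>fiber_values ` K. \<kappa> m = v" if v: "v \<in> LG" for v m
  proof -
    obtain k where "k \<in> K" "ev (s m) k = v" by (rule ev_surj[OF v])
    then show ?thesis by (intro bexI[of _ "fiber_values k"]) (simp_all add: fiber_values_def)
  qed
  show "(\<lambda>x. f x *\<^sub>R \<kappa> x) \<in> fiber_values ` K" if f: "f \<in> smooth_functions AM" and \<kappa>: "\<kappa> \<in> fiber_values ` K" for f \<kappa>
  proof -
    obtain k where k: "k \<in> K" "\<kappa> = fiber_values k" using \<kappa> by auto
    have "(\<lambda>x. f x *\<^sub>R \<kappa> x) = fiber_values (\<lambda>u. f (pr u) *\<^sub>R k u)"
      by (rule ext) (simp add: k(2) fiber_values_def ev_kernel_scale pr_s)
    then show ?thesis using kernel_scale[OF f k(1)] by simp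
  qed
  show "(\<lambda>x. brG (\<kappa> x) (\<mu> x)) \<in> fiber_values ` K" if \<kappa>: "\<kappa> \<in> fiber_values ` K" and \<mu>: "\<mu> \<in> fiber_values ` K" for \<kappa> \<mu>
  proof -
    obtain k l where k: "k \<in> K" "\<kappa> = fiber_values k" and l: "l \<in> K" "\<mu> = fiber_values l" using \<kappa> \<mu> by auto
    \<comment> \<open>The sign of the anti-embedding is absorbed by negating the field.\<close>
    have "(\<lambda>x. brG (\<kappa> x) (\<mu> x)) = - fiber_values (vfield_bracket k l)"
      using emb.bracket[OF k(1) l(1)] k(2) l(2) by simp
    also have "\<dots> = fiber_values (- vfield_bracket k l)" by (simp add: linear_neg[OF linear_fiber_values])
    finally show ?thesis using subspace_neg[OF subspace_kernel kernel_bracket[OF k(1) l(1)]] by simp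
  qed
  show "(\<lambda>x. \<Sum>n | \<rho> n x \<noteq> 0. \<rho> n x *\<^sub>R \<kappa> n x) \<in> fiber_values ` K"
    if \<rho>: "\<And>n. \<rho> n \<in> smooth_functions AM" and \<kappa>: "\<And>n. \<kappa> n \<in> fiber_values ` K" and lf: "locally_finite_family \<rho>"
    for \<rho> \<kappa>
  proof -
    have "\<forall>n. \<exists>k. k \<in> K \<and> \<kappa> n = fiber_values k" using \<kappa> by blast
    from choice[OF this] obtain k where k: "\<And>n. k n \<in> K" "\<And>n. \<kappa> n = fiber_values (k n)" by blast
    have "(\<lambda>x. \<Sum>n | \<rho> n x \<noteq> 0. \<rho> n x *\<^sub>R \<kappa> n x) = fiber_values (\<lambda>u. \<Sum>n | \<rho> n (pr u) \<noteq> 0. \<rho> n (pr u) *\<^sub>R k n u)"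
      by (rule ext) (simp add: k(2) fiber_values_def pr_s ev_sum[where I="\<lambda>u. {n. \<rho> n (pr u) \<noteq> 0}" and c="\<lambda>n u. \<rho> n (pr u)" and k=k])
    moreover have "(\<lambda>u. \<Sum>n | \<rho> n (pr u) \<noteq> 0. \<rho> n (pr u) *\<^sub>R k n u) \<in> K"
      by (rule kernel_locally_finite_sum[OF \<rho> k(1) lf[unfolded locally_finite_family_def, rule_format]])
    ultimately show ?thesis by simp
  qed
  show "\<exists>\<beta> e. \<beta> \<in> smooth_functions AM \<and> \<beta> x0 \<noteq> 0 \<and> (\<forall>b::'eg. e b \<in> fiber_values ` K) \<and>
      (\<forall>\<kappa>\<in>fiber_values ` K. \<exists>f. (\<forall>b. f b \<in> smooth_functions AM) \<and> (\<forall>x. \<kappa> x = 0 \<longrightarrow> (\<forall>b. f b x = 0)) \<and>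
        (\<forall>x. \<beta> x *\<^sub>R \<kappa> x = (\<Sum>b\<in>Basis. f b x *\<^sub>R e b x)))" for x0
  proof -
    obtain \<beta> e where \<beta>: "\<beta> \<in> smooth_functions AM" "\<beta> x0 \<noteq> 0" and e: "\<And>b :: 'eg. e b \<in> K"
      and frame: "\<And>k. k \<in> K \<Longrightarrow> \<exists>f. (\<forall>b. f b \<in> smooth_functions AM) \<and> (\<forall>u. k u = 0 \<longrightarrow> (\<forall>b. f b (pr u) = 0)) \<and>
        (\<forall>u. \<beta> (pr u) *\<^sub>R k u = (\<Sum>b\<in>Basis. f b (pr u) *\<^sub>R e b u))"
      by (rule kernel_frame[of x0]) blast
    have "\<exists>f. (\<forall>b. f b \<in> smooth_functions AM) \<and> (\<forall>x. \<kappa> x = 0 \<longrightarrow> (\<forall>b. f b x = 0)) \<and>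
        (\<forall>x. \<beta> x *\<^sub>R \<kappa> x = (\<Sum>b\<in>Basis. f b x *\<^sub>R fiber_values (e b) x))" if "\<kappa> \<in> fiber_values ` K" for \<kappa>
    proof -
      obtain k where k: "k \<in> K" "\<kappa> = fiber_values k" using \<open>\<kappa> \<in> fiber_values ` K\<close> by auto
      obtain f where f: "\<forall>b. f b \<in> smooth_functions AM" "\<forall>u. k u = 0 \<longrightarrow> (\<forall>b. f b (pr u) = 0)"
        "\<forall>u. \<beta> (pr u) *\<^sub>R k u = (\<Sum>b\<in>Basis. f b (pr u) *\<^sub>R e b u)"
        using frame[OF k(1)] by (elim exE conjE)
      have "\<forall>b. f b x = 0" if "\<kappa> x = 0" for x
      proof -
        have "k (s x) = 0" using kernel_zero_at[OF k(1)] \<open>\<kappa> x = 0\<close> by (simp add: k(2) fiber_values_def)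
        then show ?thesis using f(2)[rule_format, of "s x"] by (simp add: pr_s)
      qed
      moreover have "\<beta> x *\<^sub>R \<kappa> x = (\<Sum>b\<in>Basis. f b x *\<^sub>R fiber_values (e b) x)" for x
      proof -
        have "ev (s x) (\<lambda>u. \<beta> (pr u) *\<^sub>R k u) = ev (s x) (\<lambda>u. \<Sum>b\<in>Basis. f b (pr u) *\<^sub>R e b u)"
          by (rule ev_cong) (rule f(3)[rule_format])
        then show ?thesis
          using ev_sum[where u="s x" and I="\<lambda>_. Basis" and c="\<lambda>b u. f b (pr u)" and k=e]
          by (simp add: ev_kernel_scale pr_s k(2) fiber_values_def)
      qed
      ultimately show ?thesis using f(1) by (intro exI[of _ f]) simp
    qed
    then show ?thesis
      using \<beta> e by (intro exI[of _ \<beta>] exI[of _ "\<lambda>b. fiber_values (e b)"]) simp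
  qed
  have "semisimple_lie_algebra LG brG"
    using semisimple by (simp add: semisimple_lie_group_def lie_algebra_of_def)
  then show "LG \<subseteq> span {brG x y | x y. x \<in> LG \<and> y \<in> LG}" by (rule semisimple_lie_algebra_perfect)
qed

lemma fiber_values_kernel_ideal:
  assumes "g \<subseteq> LG"
  shows "fiber_values ` kernel_ideal AP AM act pr s m g = sec.fiber_ideal m g"
proof -
  have "kernel_ideal AP AM act pr s m g = {k \<in> K. fiber_values k m \<in> g}"
    unfolding kernel_ideal_def using section_value_iff[OF _ pr_s assms] by (auto simp: fiber_values_def)
  then show ?thesis by (auto simp: sec.fiber_ideal_def)
qed

lemma maximal_ideals_of_kernel:
  "maximal_finite_codim_lie_ideal K vfield_bracket I \<longleftrightarrow>
    (\<exists>m g. I = kernel_ideal AP AM act pr s m g \<and> maximal_lie_ideal LG brG g)"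
proof (cases "I \<subseteq> K")
  case True
  have "fiber_values ` I = sec.fiber_ideal m g \<longleftrightarrow> I = kernel_ideal AP AM act pr s m g"
    if "maximal_lie_ideal LG brG g" for m g
  proof -
    have g: "g \<subseteq> LG" using that lie_idealD(2) unfolding maximal_lie_ideal_def by blast
    have "kernel_ideal AP AM act pr s m g \<subseteq> K" by (auto simp: kernel_ideal_def)
    from inj_on_image_eq_iff[OF inj_fiber_values True this] show ?thesis
      by (simp add: fiber_values_kernel_ideal[OF g])
  qed
  then show ?thesis
    unfolding emb.maximal_iff[OF True, symmetric] sec.maximal_ideals by blast
next
  case False
  then show ?thesis
    using lie_idealD(2) by (auto simp: maximal_finite_codim_lie_ideal_def kernel_ideal_def)
qed

end

theorem theorem4:
  fixes G :: "'g::{t2_space,second_countable_topology} monoid"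
    and AG :: "('g, 'eg::euclidean_space) atlas"
    and AP :: "('p::{t2_space,second_countable_topology}, 'ep::euclidean_space) atlas"
    and AM :: "('m::{t2_space,second_countable_topology}, 'em::euclidean_space) atlas"
    and act :: "'p \<Rightarrow> 'g \<Rightarrow> 'p"
    and pr :: "'p \<Rightarrow> 'm"
    and s :: "'m \<Rightarrow> 'p"
  assumes "principal_bundle G AG AP AM act pr"
    and "semisimple_lie_group G AG"
    and "\<And>m. pr (s m) = m"
  shows "{I. maximal_finite_codim_lie_ideal (atiyah_kernel AP AM act pr) vfield_bracket I} =
    {kernel_ideal AP AM act pr s m \<gg>\<^sub>0 | m \<gg>\<^sub>0.
      maximal_lie_ideal (lie_algebra_of G AG) (lie_algebra_bracket G AG) \<gg>\<^sub>0}"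
proof -
  interpret semisimple_principal G AG AP AM act pr s
    using assms by unfold_locales
  show ?thesis
    by (auto simp: maximal_ideals_of_kernel lie_algebra_of_def)
qed

end
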